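(* Let $G$ be a locally compact group, $N$ be a closed normal subgroup of $G$, and $\xi\in\Gamma(G,N)$. The covariant involution ${}^\natural:\mathcal{C}_\xi(G,N)\to\mathcal{C}_\xi(G,N)$ has a unique extension to an isometric involution ${}^\natural:L^1_\xi(G,N)\to L^1_\xi(G,N)$, in which the covariant Banach algebra $L^1_\xi(G,N)$ (with the extended covariant convolution as product) equipped with the extended involution is a Banach $*$-algebra.
   Context: Fix left Haar measures $\lambda_G$ on $G$ and $\lambda_N$ on $N$, and let $\lambda_{G/N}$ be the left Haar measure on $G/N$ normalized by Weil's formula $\int_{G/N}\int_N f(xs)\,d\lambda_N(s)\,d\lambda_{G/N}(xN)=\int_G f\,d\lambda_G$ for $f\in L^1(G)$. Modular functions follow the convention $\lambda(Ex)=\Delta(x)\lambda(E)$. A character of $N$ is a continuous homomorphism $\xi:N\to\mathbb{T}=\{z\in\mathbb{C}:|z|=1\}$. $\Gamma(G,N)$ is the set of $G$-invariant characters of $N$: those $\xi$ with $\xi(x^{-1}sx)=\xi(s)$ for all $x\in G$, $s\in N$. For a character $\xi$, $\mathcal{C}_\xi(G,N)$ is the space of continuous $\psi:G\to\mathbb{C}$ such that $\psi(xs)=\xi(s)\psi(x)$ for all $x\in G$, $s\in N$ and the image of $\mathrm{supp}(\psi)$ under the quotient map $G\to G/N$ is compact. $L^1_\xi(G,N)$ is the Banach completion of $\mathcal{C}_\xi(G,N)$ with respect to $\|\psi\|_{(1)}=\int_{G/N}|\psi(y)|\,d\lambda_{G/N}(yN)$. For $\xi\in\Gamma(G,N)$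 and $\psi,\phi\in\mathcal{C}_\xi(G,N)$ the covariant convolution is $\psi\natural\phi(x)=\int_{G/N}\psi(y)\phi(y^{-1}x)\,d\lambda_{G/N}(yN)$; it satisfies $\|\psi\natural\phi\|_{(1)}\le\|\psi\|_{(1)}\|\phi\|_{(1)}$ and extends uniquely by continuity to a product on $L^1_\xi(G,N)$ making it a Banach algebra. The covariant involution of $\psi\in\mathcal{C}_\xi(G,N)$ is $\psi^\natural(x)=\Delta_{G/N}(x^{-1}N)\overline{\psi(x^{-1})}$, $x\in G$. *)

theory Defs
  imports "HOL-Analysis.Analysis" "HOL-Algebra.Algebraic_Closure_Type"
begin

section \<open>Locally compact groups and Haar measures\<close>

locale topological_group = group G for G (structure) +
  fixes T :: "'a topology"
  assumes topspace_eq: "topspace T = carrier G"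
    and continuous_mult: "continuous_map (prod_topology T T) T (\<lambda>(x, y). x \<otimes> y)"
    and continuous_inv: "continuous_map T T (\<lambda>x. inv x)"

locale locally_compact_group = topological_group +
  assumes Hausdorff: "Hausdorff_space T"
    and locally_compact: "locally_compact_space T"

text \<open>The underlying set of \<open>G Mod N\<close> consists of the cosets \<open>N #> x\<close>; for normal \<open>N\<close> these
  are the cosets \<open>xN\<close>.\<close>

definition coset_topology :: "('a, 'm) monoid_scheme \<Rightarrow> 'a set \<Rightarrow> 'a topology \<Rightarrow> 'a set topology" where
  "coset_topology G N T =
    topology (\<lambda>W. W \<subseteq> carrier (G Mod N) \<and> openin T {x \<in> carrier G. N #>\<^bsub>G\<^esub> x \<in> W})"

lemma openin_coset_topology:
  assumes "topspace T = carrier G"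
  shows "openin (coset_topology G N T) W \<longleftrightarrow>
    W \<subseteq> carrier (G Mod N) \<and> openin T {x \<in> carrier G. N #>\<^bsub>G\<^esub> x \<in> W}"
proof -
  have "{x \<in> carrier G. N #>\<^bsub>G\<^esub> x \<in> S \<inter> S'} =
      {x \<in> carrier G. N #>\<^bsub>G\<^esub> x \<in> S} \<inter> {x \<in> carrier G. N #>\<^bsub>G\<^esub> x \<in> S'}" for S S'
    by blast
  moreover have "{x \<in> carrier G. N #>\<^bsub>G\<^esub> x \<in> \<Union>\<K>} =
      (\<Union>S\<in>\<K>. {x \<in> carrier G. N #>\<^bsub>G\<^esub> x \<in> S})" for \<K>
    by blast
  ultimately have "istopology (\<lambda>W. W \<subseteq> carrier (G Mod N) \<and>
      openin T {x \<in> carrier G. N #>\<^bsub>G\<^esub> x \<in> W})"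
    unfolding istopology_def by (auto intro!: openin_Union)
  then show ?thesis
    unfolding coset_topology_def by (simp add: topology_inverse')
qed

lemma quotient_map_coset_topology:
  assumes "topspace T = carrier G"
  shows "quotient_map T (coset_topology G N T) (\<lambda>x. N #>\<^bsub>G\<^esub> x)"
proof -
  have img: "(\<lambda>x. N #>\<^bsub>G\<^esub> x) ` carrier G = carrier (G Mod N)"
    by (auto simp: FactGroup_def RCOSETS_def)
  have "{x \<in> carrier G. N #>\<^bsub>G\<^esub> x \<in> carrier (G Mod N)} = carrier G"
    using img by blast
  then have "openin (coset_topology G N T) (carrier (G Mod N))"
    using assms openin_topspace[of T] by (simp add: openin_coset_topology)
  then have "topspace (coset_topology G N T) = carrier (G Mod N)"
    by (metis assms openin_coset_topology openin_subset openin_topspace subset_antisym)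
  then show ?thesis
    using img assms by (auto simp: quotient_map_def openin_coset_topology)
qed

text \<open>Nonzero left-invariant Radon measures (outer regular on Borel sets, inner regular on open
  sets), defined on the Borel \<open>\<sigma>\<close>-algebra.\<close>

definition left_haar_measure ::
    "('a, 'm) monoid_scheme \<Rightarrow> 'a topology \<Rightarrow> 'a measure \<Rightarrow> bool" where
  "left_haar_measure G T M \<longleftrightarrow>
     sets M = sigma_sets (topspace T) {U. openin T U} \<and>
     (\<forall>K. compactin T K \<longrightarrow> emeasure M K < \<infinity>) \<and>
     (\<forall>E\<in>sets M. emeasure M E = (INF U\<in>{U. openin T U \<and> E \<subseteq> U}. emeasure M U)) \<and>
     (\<forall>U. openin T U \<longrightarrow>
        emeasure M U = (SUP K\<in>{K. compactin T K \<and> K \<subseteq> U}. emeasure M K)) \<and>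
     (\<forall>x\<in>carrier G. \<forall>E\<in>sets M. emeasure M (x <#\<^bsub>G\<^esub> E) = emeasure M E) \<and>
     emeasure M (space M) \<noteq> 0"

definition modular_function :: "('a, 'm) monoid_scheme \<Rightarrow> 'a measure \<Rightarrow> 'a \<Rightarrow> real" where
  "modular_function G M x =
     (THE c. 0 < c \<and> (\<forall>E\<in>sets M. emeasure M (E #>\<^bsub>G\<^esub> x) = ennreal c * emeasure M E))"

text \<open>Integral over \<open>G/N\<close> of a function on \<open>G\<close> that is constant on the cosets of \<open>N\<close>.\<close>

definition coset_integral ::
    "'a set measure \<Rightarrow> ('a \<Rightarrow> 'b) \<Rightarrow> 'b :: {banach, second_countable_topology}" where
  "coset_integral M f = (\<integral>c. f (SOME y. y \<in> c) \<partial>M)"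

text \<open>Weil's formula for all \<open>f \<in> L\<^sup>1(G)\<close>.  For \<open>G\<close> not second countable the inner integral need
  only be measurable with respect to the completed measure, so all three integrals are taken
  with respect to completions.\<close>

definition weil_formula ::
    "('a, 'm) monoid_scheme \<Rightarrow> 'a measure \<Rightarrow> 'a measure \<Rightarrow> 'a set measure \<Rightarrow> bool" where
  "weil_formula G \<mu>G \<mu>N \<mu>Q \<longleftrightarrow>
     (\<forall>f :: 'a \<Rightarrow> complex. integrable (completion \<mu>G) f \<longrightarrow>
        coset_integral (completion \<mu>Q) (\<lambda>x. \<integral>s. f (x \<otimes>\<^bsub>G\<^esub> s) \<partial>completion \<mu>N) =
        (\<integral>x. f x \<partial>completion \<mu>G))"

section \<open>Complex Banach algebras with an explicit carrier\<close>

text \<open>Algebras need not be unital: the field \<open>one\<close> inherited from \<open>ring\<close> is never used.\<close>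

record 'v normed_alg = "(complex, 'v) module" + nrm :: "'v \<Rightarrow> real"

definition cauchy_seqs :: "('v, 'm) normed_alg_scheme \<Rightarrow> (nat \<Rightarrow> 'v) set" where
  "cauchy_seqs A = {\<sigma>. range \<sigma> \<subseteq> carrier A \<and>
     (\<forall>e>0. \<exists>K. \<forall>m\<ge>K. \<forall>n\<ge>K. nrm A (\<sigma> m \<ominus>\<^bsub>A\<^esub> \<sigma> n) < e)}"

locale complex_normed_space =
  fixes A :: "('v, 'm) normed_alg_scheme" (structure)
  assumes vector_space: "Module.module (ring_of_type_algebra :: complex ring) A"
    and nrm_nonneg: "x \<in> carrier A \<Longrightarrow> 0 \<le> nrm A x"
    and nrm_eq_0: "x \<in> carrier A \<Longrightarrow> nrm A x = 0 \<longleftrightarrow> x = \<zero>"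
    and nrm_triangle: "\<lbrakk>x \<in> carrier A; y \<in> carrier A\<rbrakk> \<Longrightarrow> nrm A (x \<oplus> y) \<le> nrm A x + nrm A y"
    and nrm_smult: "x \<in> carrier A \<Longrightarrow> nrm A (c \<odot> x) = cmod c * nrm A x"

locale complex_banach_algebra = complex_normed_space +
  assumes complete: "\<sigma> \<in> cauchy_seqs A \<Longrightarrow> \<exists>x\<in>carrier A. (\<lambda>n. nrm A (\<sigma> n \<ominus> x)) \<longlonglongrightarrow> 0"
    and mult_closed: "\<lbrakk>x \<in> carrier A; y \<in> carrier A\<rbrakk> \<Longrightarrow> x \<otimes> y \<in> carrier A"
    and mult_assoc: "\<lbrakk>x \<in> carrier A; y \<in> carrier A; z \<in> carrier A\<rbrakk> \<Longrightarrow>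
      (x \<otimes> y) \<otimes> z = x \<otimes> (y \<otimes> z)"
    and mult_add_left: "\<lbrakk>x \<in> carrier A; y \<in> carrier A; z \<in> carrier A\<rbrakk> \<Longrightarrow>
      (x \<oplus> y) \<otimes> z = x \<otimes> z \<oplus> y \<otimes> z"
    and mult_add_right: "\<lbrakk>x \<in> carrier A; y \<in> carrier A; z \<in> carrier A\<rbrakk> \<Longrightarrow>
      x \<otimes> (y \<oplus> z) = x \<otimes> y \<oplus> x \<otimes> z"
    and mult_smult_left: "\<lbrakk>x \<in> carrier A; y \<in> carrier A\<rbrakk> \<Longrightarrow> (c \<odot> x) \<otimes> y = c \<odot> (x \<otimes> y)"
    and mult_smult_right: "\<lbrakk>x \<in> carrier A; y \<in> carrier A\<rbrakk> \<Longrightarrow> x \<otimes> (c \<odot> y) = c \<odot> (x \<otimes> y)"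
    and nrm_mult: "\<lbrakk>x \<in> carrier A; y \<in> carrier A\<rbrakk> \<Longrightarrow> nrm A (x \<otimes> y) \<le> nrm A x * nrm A y"

locale banach_star_algebra = complex_banach_algebra +
  fixes star :: "'a \<Rightarrow> 'a"
  assumes star_closed: "x \<in> carrier A \<Longrightarrow> star x \<in> carrier A"
    and star_add: "\<lbrakk>x \<in> carrier A; y \<in> carrier A\<rbrakk> \<Longrightarrow> star (x \<oplus> y) = star x \<oplus> star y"
    and star_smult: "x \<in> carrier A \<Longrightarrow> star (c \<odot> x) = cnj c \<odot> star x"
    and star_star: "x \<in> carrier A \<Longrightarrow> star (star x) = x"
    and star_mult: "\<lbrakk>x \<in> carrier A; y \<in> carrier A\<rbrakk> \<Longrightarrow> star (x \<otimes> y) = star y \<otimes> star x"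

text \<open>Only the Banach space structure enters here; compatibility with the product is part of
  \<open>banach_star_algebra\<close>.\<close>

definition isometric_involution :: "('v, 'm) normed_alg_scheme \<Rightarrow> ('v \<Rightarrow> 'v) \<Rightarrow> bool" where
  "isometric_involution A J \<longleftrightarrow>
     (\<forall>x\<in>carrier A. J x \<in> carrier A \<and> J (J x) = x \<and> nrm A (J x) = nrm A x) \<and>
     (\<forall>x\<in>carrier A. \<forall>y\<in>carrier A. J (x \<oplus>\<^bsub>A\<^esub> y) = J x \<oplus>\<^bsub>A\<^esub> J y) \<and>
     (\<forall>c. \<forall>x\<in>carrier A. J (c \<odot>\<^bsub>A\<^esub> x) = cnj c \<odot>\<^bsub>A\<^esub> J x)"

text \<open>The completion consists of Cauchy sequences modulo null sequences.  Operations are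
  evaluated termwise on representatives; in particular the product of two classes is the class of
  \<open>\<lambda>n. \<sigma> n \<otimes> \<tau> n\<close>, that is, the extension by continuity of the product of \<open>A\<close>.\<close>

definition null_rel :: "('v, 'm) normed_alg_scheme \<Rightarrow> ((nat \<Rightarrow> 'v) \<times> (nat \<Rightarrow> 'v)) set" where
  "null_rel A = {(\<sigma>, \<tau>). \<sigma> \<in> cauchy_seqs A \<and> \<tau> \<in> cauchy_seqs A \<and>
     (\<lambda>n. nrm A (\<sigma> n \<ominus>\<^bsub>A\<^esub> \<tau> n)) \<longlonglongrightarrow> 0}"

definition banach_completion :: "'v normed_alg \<Rightarrow> (nat \<Rightarrow> 'v) set normed_alg" where
  "banach_completion A =
    \<lparr>carrier = cauchy_seqs A // null_rel A,
     mult = (\<lambda>P Q. \<Union>\<sigma>\<in>P. \<Union>\<tau>\<in>Q. null_rel A `` {\<lambda>n. \<sigma> n \<otimes>\<^bsub>A\<^esub> \<tau> n}),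
     one = undefined,
     zero = null_rel A `` {\<lambda>n. \<zero>\<^bsub>A\<^esub>},
     add = (\<lambda>P Q. \<Union>\<sigma>\<in>P. \<Union>\<tau>\<in>Q. null_rel A `` {\<lambda>n. \<sigma> n \<oplus>\<^bsub>A\<^esub> \<tau> n}),
     smult = (\<lambda>c P. \<Union>\<sigma>\<in>P. null_rel A `` {\<lambda>n. c \<odot>\<^bsub>A\<^esub> \<sigma> n}),
     nrm = (\<lambda>P. THE r. \<forall>\<sigma>\<in>P. (\<lambda>n. nrm A (\<sigma> n)) \<longlonglongrightarrow> r)\<rparr>"

definition to_completion :: "'v normed_alg \<Rightarrow> 'v \<Rightarrow> (nat \<Rightarrow> 'v) set" where
  "to_completion A v = null_rel A `` {\<lambda>n. v}"

section \<open>Covariant functions\<close>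

definition is_character ::
    "('a, 'm) monoid_scheme \<Rightarrow> 'a set \<Rightarrow> 'a topology \<Rightarrow> ('a \<Rightarrow> complex) \<Rightarrow> bool" where
  "is_character G N T \<xi> \<longleftrightarrow>
     continuous_map (subtopology T N) euclidean \<xi> \<and>
     (\<forall>s\<in>N. cmod (\<xi> s) = 1) \<and>
     (\<forall>s\<in>N. \<forall>t\<in>N. \<xi> (s \<otimes>\<^bsub>G\<^esub> t) = \<xi> s * \<xi> t)"

definition invariant_characters ::
    "('a, 'm) monoid_scheme \<Rightarrow> 'a set \<Rightarrow> 'a topology \<Rightarrow> ('a \<Rightarrow> complex) set" where
  "invariant_characters G N T = {\<xi>. is_character G N T \<xi> \<and>
     (\<forall>x\<in>carrier G. \<forall>s\<in>N. \<xi> (inv\<^bsub>G\<^esub> x \<otimes>\<^bsub>G\<^esub> s \<otimes>\<^bsub>G\<^esub> x) = \<xi> s)}"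

text \<open>Functions on \<open>G\<close> are represented by extensional functions (\<open>undefined\<close> off the carrier).\<close>

definition covariant_functions ::
    "('a, 'm) monoid_scheme \<Rightarrow> 'a set \<Rightarrow> 'a topology \<Rightarrow> ('a \<Rightarrow> complex) \<Rightarrow> ('a \<Rightarrow> complex) set" where
  "covariant_functions G N T \<xi> = {\<psi> \<in> extensional (carrier G).
     continuous_map T euclidean \<psi> \<and>
     (\<forall>x\<in>carrier G. \<forall>s\<in>N. \<psi> (x \<otimes>\<^bsub>G\<^esub> s) = \<xi> s * \<psi> x) \<and>
     compactin (coset_topology G N T)
       ((\<lambda>x. N #>\<^bsub>G\<^esub> x) ` (T closure_of {x \<in> carrier G. \<psi> x \<noteq> 0}))}"

definition covariant_convolution :: "('a, 'm) monoid_scheme \<Rightarrow> 'a set measure \<Rightarrow>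
    ('a \<Rightarrow> complex) \<Rightarrow> ('a \<Rightarrow> complex) \<Rightarrow> 'a \<Rightarrow> complex" where
  "covariant_convolution G \<mu>Q \<psi> \<eta> =
     (\<lambda>x\<in>carrier G. coset_integral \<mu>Q (\<lambda>y. \<psi> y * \<eta> (inv\<^bsub>G\<^esub> y \<otimes>\<^bsub>G\<^esub> x)))"

definition covariant_involution :: "('a, 'm) monoid_scheme \<Rightarrow> 'a set \<Rightarrow> 'a set measure \<Rightarrow>
    ('a \<Rightarrow> complex) \<Rightarrow> 'a \<Rightarrow> complex" where
  "covariant_involution G N \<mu>Q \<psi> =
     (\<lambda>x\<in>carrier G. complex_of_real (modular_function (G Mod N) \<mu>Q (N #>\<^bsub>G\<^esub> inv\<^bsub>G\<^esub> x)) *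
        cnj (\<psi> (inv\<^bsub>G\<^esub> x)))"

definition covariant_alg :: "('a, 'm) monoid_scheme \<Rightarrow> 'a set \<Rightarrow> 'a topology \<Rightarrow>
    'a set measure \<Rightarrow> ('a \<Rightarrow> complex) \<Rightarrow> ('a \<Rightarrow> complex) normed_alg" where
  "covariant_alg G N T \<mu>Q \<xi> =
    \<lparr>carrier = covariant_functions G N T \<xi>,
     mult = covariant_convolution G \<mu>Q,
     one = undefined,
     zero = (\<lambda>x\<in>carrier G. 0),
     add = (\<lambda>\<psi> \<eta>. \<lambda>x\<in>carrier G. \<psi> x + \<eta> x),
     smult = (\<lambda>c \<psi>. \<lambda>x\<in>carrier G. c * \<psi> x),
     nrm = (\<lambda>\<psi>. coset_integral \<mu>Q (\<lambda>y. cmod (\<psi> y)))\<rparr>"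

definition covariant_L1 :: "('a, 'm) monoid_scheme \<Rightarrow> 'a set \<Rightarrow> 'a topology \<Rightarrow>
    'a set measure \<Rightarrow> ('a \<Rightarrow> complex) \<Rightarrow> (nat \<Rightarrow> 'a \<Rightarrow> complex) set normed_alg" where
  "covariant_L1 G N T \<mu>Q \<xi> = banach_completion (covariant_alg G N T \<mu>Q \<xi>)"

definition extends_covariant_involution :: "('a, 'm) monoid_scheme \<Rightarrow> 'a set \<Rightarrow> 'a topology \<Rightarrow>
    'a set measure \<Rightarrow> ('a \<Rightarrow> complex) \<Rightarrow>
    ((nat \<Rightarrow> 'a \<Rightarrow> complex) set \<Rightarrow> (nat \<Rightarrow> 'a \<Rightarrow> complex) set) \<Rightarrow> bool" where
  "extends_covariant_involution G N T \<mu>Q \<xi> J \<longleftrightarrow>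
     (\<forall>\<psi>\<in>covariant_functions G N T \<xi>.
        J (to_completion (covariant_alg G N T \<mu>Q \<xi>) \<psi>) =
        to_completion (covariant_alg G N T \<mu>Q \<xi>) (covariant_involution G N \<mu>Q \<psi>))"

end

theory Submission
  imports Defs
begin

text \<open>
  On \<open>L\<^sup>1\<close> of the locally compact group \<open>G/N\<close> the involution \<open>f\<^sup>*(x) = \<Delta>(x\<^sup>-\<^sup>1) cnj (f (x\<^sup>-\<^sup>1))\<close> is
  isometric because Haar measure and its image under inversion differ by the density \<open>\<Delta>(x\<^sup>-\<^sup>1)\<close>.  The
  covariant case is no different: by the \<open>G\<close>-invariance of the character, \<open>|\<psi>|\<close> and the convolution
  integrands \<open>y \<mapsto> \<psi>(y) \<phi>(y\<^sup>-\<^sup>1 x)\<close> are constant on cosets of \<open>N\<close>, so that all integrals are integrals of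
  compactly supported continuous functions on \<open>G/N\<close>.  There left invariance and Fubini yield an
  associative, submultiplicative convolution (\<open>convolution_assoc\<close>, \<open>norm_convolution_le\<close>), on which
  the involution acts as an anti-automorphism (\<open>star_convolution\<close>) and isometrically (\<open>norm_star\<close>).

  An isometric involution of a seminormed algebra acts termwise on Cauchy sequences, hence on the
  completion, and it inherits all algebraic identities (\<open>banach_star_algebra_completion\<close>).  It is the
  only isometric extension since the constant sequences are dense.

  The analytic substance lies in the modular function, whose definition presupposes that right
  translates of Haar measure are multiples of it.  A single double integral gives this together with
  the inversion formula: for compactly supported continuous \<open>f\<close> and \<open>g\<close>,
  \<open>\<integral>f \<cdot> \<integral>g = \<integral>(\<integral>f(ts) dt) g(s\<^sup>-\<^sup>1) ds\<close> (\<open>integral_mult_integral\<close>).  Since \<open>g\<close> is arbitrary, the function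
  \<open>s \<mapsto> \<integral>f(ts) dt / \<integral>f\<close> does not depend on \<open>f\<close>; it is \<open>\<Delta>(s\<^sup>-\<^sup>1)\<close>, and dividing the identity by \<open>\<integral>f\<close> is
  the inversion formula.  The regularity of the measure carries the scaling over to Borel sets
  (\<open>emeasure_r_coset\<close>).  The exchange of integrals that is needed throughout is proved directly for
  compactly supported continuous functions (\<open>fubini_compact_support\<close>), as Haar measure need not be
  \<open>\<sigma>\<close>-finite.
\<close>

section \<open>Completing a seminormed star-algebra\<close>

lemma carrier_ring_of_type_algebra [simp]: "carrier (ring_of_type_algebra :: 'a :: ring_1 ring) = UNIV"
  and one_ring_of_type_algebra [simp]: "\<one>\<^bsub>ring_of_type_algebra :: 'a :: ring_1 ring\<^esub> = 1"
  and zero_ring_of_type_algebra [simp]: "\<zero>\<^bsub>ring_of_type_algebra :: 'a :: ring_1 ring\<^esub> = 0"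
  and add_ring_of_type_algebra [simp]: "x \<oplus>\<^bsub>ring_of_type_algebra :: 'a :: ring_1 ring\<^esub> y = x + y"
  and mult_ring_of_type_algebra [simp]: "x \<otimes>\<^bsub>ring_of_type_algebra :: 'a :: ring_1 ring\<^esub> y = x * y"
  by (simp_all add: ring_of_type_algebra_def)

text \<open>The norm may vanish on nonzero vectors here.  Definiteness appears only in the completion, where
  null sequences are divided out.\<close>

locale seminormed_space = module "ring_of_type_algebra :: complex ring" A
  for A :: "'v normed_alg" (structure) +
  assumes nrm_triangle: "\<lbrakk>x \<in> carrier A; y \<in> carrier A\<rbrakk> \<Longrightarrow> nrm A (x \<oplus> y) \<le> nrm A x + nrm A y"
    and nrm_smult: "x \<in> carrier A \<Longrightarrow> nrm A (c \<odot> x) = cmod c * nrm A x"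
begin

lemma smult_in [simp, intro]: "x \<in> carrier A \<Longrightarrow> c \<odot> x \<in> carrier A"
  using smult_closed by simp

lemma neg_eq_smult: "x \<in> carrier A \<Longrightarrow> \<ominus> x = (-1) \<odot> x"
proof -
  assume x: "x \<in> carrier A"
  have "(-1) \<odot> x \<oplus> x = ((-1) + 1) \<odot> x"
    using smult_l_distr[of "-1" 1 x] smult_one[of x] x by simp
  also have "\<dots> = \<zero>" using smult_l_null[of x] x by simp
  finally show ?thesis using x by (metis M.minus_equality smult_in)
qed

lemma minus_eq_smult: "x \<in> carrier A \<Longrightarrow> y \<in> carrier A \<Longrightarrow> x \<ominus> y = x \<oplus> (-1) \<odot> y"
  by (simp add: a_minus_def neg_eq_smult)

lemma nrm_zero [simp]: "nrm A \<zero> = 0"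
  using nrm_smult[of \<zero> 0] smult_l_null[of \<zero>] by simp

lemma nrm_neg [simp]: "x \<in> carrier A \<Longrightarrow> nrm A (\<ominus> x) = nrm A x"
  by (simp add: neg_eq_smult nrm_smult)

lemma nrm_nonneg: "x \<in> carrier A \<Longrightarrow> 0 \<le> nrm A x"
  using nrm_triangle[of x "\<ominus> x"] by (simp add: M.r_neg)

lemma nrm_minus_commute:
  "x \<in> carrier A \<Longrightarrow> y \<in> carrier A \<Longrightarrow> nrm A (x \<ominus> y) = nrm A (y \<ominus> x)"
  using nrm_neg[of "x \<ominus> y"] by (simp add: a_minus_def M.minus_add M.a_comm)

lemma nrm_minus_triangle:
  assumes "x \<in> carrier A" "y \<in> carrier A" "z \<in> carrier A"
  shows "nrm A (x \<ominus> z) \<le> nrm A (x \<ominus> y) + nrm A (y \<ominus> z)"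
proof -
  have "x \<ominus> z = (x \<ominus> y) \<oplus> (y \<ominus> z)"
    using assms by (simp add: a_minus_def M.a_assoc) (simp flip: M.a_assoc add: M.l_neg)
  then show ?thesis using assms nrm_triangle by simp
qed

lemma nrm_diff_le:
  assumes "x \<in> carrier A" "y \<in> carrier A"
  shows "\<bar>nrm A x - nrm A y\<bar> \<le> nrm A (x \<ominus> y)"
proof -
  have "x \<ominus> \<zero> = x" "y \<ominus> \<zero> = y"
    using assms M.r_neg[of \<zero>] by (auto simp: a_minus_def)
  then have "nrm A x \<le> nrm A (x \<ominus> y) + nrm A y" "nrm A y \<le> nrm A (y \<ominus> x) + nrm A x"
    using nrm_minus_triangle[of x y \<zero>] nrm_minus_triangle[of y x \<zero>] assms by simp_all
  then show ?thesis using nrm_minus_commute assms by force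
qed

lemma minus_self [simp]: "x \<in> carrier A \<Longrightarrow> x \<ominus> x = \<zero>"
  by (simp add: a_minus_def M.r_neg)

lemma minus_zero_right [simp]: "x \<in> carrier A \<Longrightarrow> x \<ominus> \<zero> = x"
  using M.r_neg[of \<zero>] by (simp add: a_minus_def)

lemma add_minus_add:
  assumes "x \<in> carrier A" "y \<in> carrier A" "x' \<in> carrier A" "y' \<in> carrier A"
  shows "(x \<oplus> y) \<ominus> (x' \<oplus> y') = (x \<ominus> x') \<oplus> (y \<ominus> y')"
  using assms by (simp add: a_minus_def M.minus_add M.a_ac)

lemma smult_minus:
  assumes "x \<in> carrier A" "y \<in> carrier A"
  shows "c \<odot> x \<ominus> c \<odot> y = c \<odot> (x \<ominus> y)"
  using assms smult_r_distr[of c x "(-1) \<odot> y"] smult_assoc1[of c "-1" y] smult_assoc1[of "-1" c y]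
  by (simp add: minus_eq_smult)

abbreviation \<B> where "\<B> \<equiv> banach_completion A"

abbreviation cls :: "(nat \<Rightarrow> 'v) \<Rightarrow> (nat \<Rightarrow> 'v) set" where
  "cls u \<equiv> null_rel A `` {u}"

lemma cauchy_seqs_iff:
  "u \<in> cauchy_seqs A \<longleftrightarrow> (\<forall>n. u n \<in> carrier A) \<and>
     (\<forall>e>0. \<exists>K. \<forall>m\<ge>K. \<forall>n\<ge>K. nrm A (u m \<ominus> u n) < e)"
  by (auto simp: cauchy_seqs_def)

lemma cauchy_seqs_in: "u \<in> cauchy_seqs A \<Longrightarrow> u n \<in> carrier A"
  by (simp add: cauchy_seqs_iff)

text \<open>That termwise operations preserve Cauchy sequences and respect null sequences has one reason: the
  distance of two results is bounded by a multiple of the distances of the arguments.  This lemma and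
  \<open>null_rel_dominated\<close> isolate it; unary operations use them with a constant second sequence.\<close>

lemma cauchy_seqs_dominated:
  assumes u: "u \<in> cauchy_seqs A" and v: "v \<in> cauchy_seqs A"
    and w: "\<And>n. w n \<in> carrier A"
    and le: "\<And>m n. nrm A (w m \<ominus> w n) \<le> C * nrm A (u m \<ominus> u n) + C * nrm A (v m \<ominus> v n)"
  shows "w \<in> cauchy_seqs A"
  unfolding cauchy_seqs_iff
proof (intro conjI allI impI w)
  fix e :: real assume e: "e > 0"
  define d where "d = e / (2 * (\<bar>C\<bar> + 1))"
  have d: "d > 0" using e by (simp add: d_def)
  obtain K L where K: "\<And>m n. m \<ge> K \<Longrightarrow> n \<ge> K \<Longrightarrow> nrm A (u m \<ominus> u n) < d"
    and L: "\<And>m n. m \<ge> L \<Longrightarrow> n \<ge> L \<Longrightarrow> nrm A (v m \<ominus> v n) < d"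
    using u v d unfolding cauchy_seqs_iff by meson
  have "nrm A (w m \<ominus> w n) < e" if "m \<ge> max K L" "n \<ge> max K L" for m n
  proof -
    have *: "C * nrm A (x \<ominus> y) \<le> \<bar>C\<bar> * d" if "nrm A (x \<ominus> y) < d" "x \<in> carrier A" "y \<in> carrier A" for x y
    proof -
      have "C * nrm A (x \<ominus> y) \<le> \<bar>C\<bar> * nrm A (x \<ominus> y)"
        using nrm_nonneg[of "x \<ominus> y"] that by (intro mult_right_mono) auto
      also have "\<dots> \<le> \<bar>C\<bar> * d" using that by (intro mult_left_mono) auto
      finally show ?thesis .
    qed
    have "nrm A (w m \<ominus> w n) \<le> \<bar>C\<bar> * d + \<bar>C\<bar> * d"
      using le[of m n] *[OF K[of m n] cauchy_seqs_in[OF u] cauchy_seqs_in[OF u]]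
        *[OF L[of m n] cauchy_seqs_in[OF v] cauchy_seqs_in[OF v]] that by linarith
    also have "\<dots> < 2 * (\<bar>C\<bar> + 1) * d" using d by (simp add: algebra_simps)
    also have "\<dots> = e" by (simp add: d_def add_nonneg_eq_0_iff)
    finally show ?thesis .
  qed
  then show "\<exists>K. \<forall>m\<ge>K. \<forall>n\<ge>K. nrm A (w m \<ominus> w n) < e" by blast
qed

lemma null_rel_iff:
  "(u, v) \<in> null_rel A \<longleftrightarrow> u \<in> cauchy_seqs A \<and> v \<in> cauchy_seqs A \<and>
     (\<lambda>n. nrm A (u n \<ominus> v n)) \<longlonglongrightarrow> 0"
  by (simp add: null_rel_def)

lemma null_rel_dominated:
  assumes "(u, u') \<in> null_rel A" "(v, v') \<in> null_rel A"
    and "w \<in> cauchy_seqs A" "w' \<in> cauchy_seqs A"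
    and le: "\<And>n. nrm A (w n \<ominus> w' n) \<le> C * nrm A (u n \<ominus> u' n) + C * nrm A (v n \<ominus> v' n)"
  shows "(w, w') \<in> null_rel A"
proof -
  have "(\<lambda>n. C * nrm A (u n \<ominus> u' n) + C * nrm A (v n \<ominus> v' n)) \<longlonglongrightarrow> C * 0 + C * 0"
    using assms(1,2) unfolding null_rel_iff
    by (intro tendsto_add tendsto_mult tendsto_const) blast+
  then have lim: "(\<lambda>n. C * nrm A (u n \<ominus> u' n) + C * nrm A (v n \<ominus> v' n)) \<longlonglongrightarrow> 0" by simp
  have "(\<lambda>n. nrm A (w n \<ominus> w' n)) \<longlonglongrightarrow> 0"
    by (rule tendsto_sandwich[OF _ _ tendsto_const lim])
      (simp_all add: le nrm_nonneg cauchy_seqs_in[OF assms(3)] cauchy_seqs_in[OF assms(4)])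
  then show ?thesis using assms by (simp add: null_rel_iff)
qed

lemma null_relD:
  assumes "(u, v) \<in> null_rel A"
  shows "u \<in> cauchy_seqs A" "v \<in> cauchy_seqs A" "u n \<in> carrier A" "v n \<in> carrier A"
  using assms by (auto simp: null_rel_iff intro: cauchy_seqs_in)

lemma equiv_null_rel: "equiv (cauchy_seqs A) (null_rel A)"
proof (rule equivI)
  show "null_rel A \<subseteq> cauchy_seqs A \<times> cauchy_seqs A" by (auto simp: null_rel_def)
  show "refl_on (cauchy_seqs A) (null_rel A)"
    by (auto simp: refl_on_def null_rel_iff cauchy_seqs_in)
  show "sym (null_rel A)"
    by (rule symI) (simp add: null_rel_iff nrm_minus_commute[OF cauchy_seqs_in cauchy_seqs_in])
  show "trans (null_rel A)"
  proof (rule transI)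
    fix u v w assume *: "(u, v) \<in> null_rel A" "(v, w) \<in> null_rel A"
    note [simp] = null_relD[OF *(1)] null_relD[OF *(2)]
    show "(u, w) \<in> null_rel A"
      by (rule null_rel_dominated[OF *, where C = 1]) (simp_all add: nrm_minus_triangle)
  qed
qed

lemma cauchy_seqs_const [simp]: "x \<in> carrier A \<Longrightarrow> (\<lambda>n. x) \<in> cauchy_seqs A"
  by (simp add: cauchy_seqs_iff)

lemma cauchy_seqs_add [simp]:
  assumes "u \<in> cauchy_seqs A" "v \<in> cauchy_seqs A"
  shows "(\<lambda>n. u n \<oplus> v n) \<in> cauchy_seqs A"
proof -
  note [simp] = cauchy_seqs_in[OF assms(1)] cauchy_seqs_in[OF assms(2)]
  show ?thesis
    by (rule cauchy_seqs_dominated[OF assms, where C = 1]) (simp_all add: add_minus_add nrm_triangle)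
qed

lemma cauchy_seqs_smult [simp]:
  assumes "u \<in> cauchy_seqs A"
  shows "(\<lambda>n. c \<odot> u n) \<in> cauchy_seqs A"
proof -
  note [simp] = cauchy_seqs_in[OF assms]
  show ?thesis
    by (rule cauchy_seqs_dominated[OF assms cauchy_seqs_const[OF M.zero_closed], where C = "cmod c"])
      (simp_all add: smult_minus nrm_smult)
qed

lemma cls_eq_iff:
  "u \<in> cauchy_seqs A \<Longrightarrow> v \<in> cauchy_seqs A \<Longrightarrow> cls u = cls v \<longleftrightarrow> (u, v) \<in> null_rel A"
  using eq_equiv_class_iff[OF equiv_null_rel] .

lemma carrier_completion: "carrier \<B> = cls ` cauchy_seqs A"
  by (auto simp: banach_completion_def quotient_def)

lemma cls_in [simp]: "u \<in> cauchy_seqs A \<Longrightarrow> cls u \<in> carrier \<B>"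
  by (simp add: carrier_completion)

lemma completion_cases:
  assumes "P \<in> carrier \<B>"
  obtains u where "u \<in> cauchy_seqs A" "P = cls u" "\<forall>n. u n \<in> carrier A"
  using assms by (auto simp: carrier_completion intro: cauchy_seqs_in)

lemma zero_completion: "\<zero>\<^bsub>\<B>\<^esub> = cls (\<lambda>n. \<zero>)"
  by (simp add: banach_completion_def)

text \<open>A termwise operation passes to classes as soon as it is Lipschitz.  The constant may depend on the
  representatives, because the product is Lipschitz only on bounded sequences.\<close>

lemma class_op2:
  assumes op: "\<And>u v. u \<in> cauchy_seqs A \<Longrightarrow> v \<in> cauchy_seqs A \<Longrightarrow> f u v \<in> cauchy_seqs A"
    and C: "\<And>u u' v v'. (u, u') \<in> null_rel A \<Longrightarrow> (v, v') \<in> null_rel A \<Longrightarrow>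
      \<exists>C. \<forall>n. nrm A (f u v n \<ominus> f u' v' n) \<le> C * nrm A (u n \<ominus> u' n) + C * nrm A (v n \<ominus> v' n)"
    and u: "u \<in> cauchy_seqs A" and v: "v \<in> cauchy_seqs A"
  shows "(\<Union>u\<in>cls u. \<Union>v\<in>cls v. cls (f u v)) = cls (f u v)"
proof (rule UN_equiv_class2[OF equiv_null_rel equiv_null_rel _ u v])
  show "congruent2 (null_rel A) (null_rel A) (\<lambda>u v. cls (f u v))"
  proof (rule congruent2I')
    fix u u' v v' assume *: "(u, u') \<in> null_rel A" "(v, v') \<in> null_rel A"
    then have mem: "f u v \<in> cauchy_seqs A" "f u' v' \<in> cauchy_seqs A"
      using op by (simp_all add: null_rel_iff)
    obtain C where "\<And>n. nrm A (f u v n \<ominus> f u' v' n) \<le> C * nrm A (u n \<ominus> u' n) + C * nrm A (v n \<ominus> v' n)"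
      using C[OF *] by blast
    from null_rel_dominated[OF * mem this] show "cls (f u v) = cls (f u' v')"
      by (simp add: cls_eq_iff mem)
  qed
qed

lemma class_op1:
  assumes op: "\<And>u. u \<in> cauchy_seqs A \<Longrightarrow> f u \<in> cauchy_seqs A"
    and C: "\<And>u v n. u \<in> cauchy_seqs A \<Longrightarrow> v \<in> cauchy_seqs A \<Longrightarrow>
      nrm A (f u n \<ominus> f v n) \<le> C * nrm A (u n \<ominus> v n)"
    and u: "u \<in> cauchy_seqs A"
  shows "(\<Union>u\<in>cls u. cls (f u)) = cls (f u)"
proof (rule UN_equiv_class[OF equiv_null_rel _ u])
  show "congruent (null_rel A) (\<lambda>u. cls (f u))"
  proof (rule congruentI)
    fix u v assume *: "(u, v) \<in> null_rel A"
    then have mem: "u \<in> cauchy_seqs A" "v \<in> cauchy_seqs A" "f u \<in> cauchy_seqs A" "f v \<in> cauchy_seqs A"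
      using op by (simp_all add: null_rel_iff)
    have "(\<lambda>n. \<zero>, \<lambda>n. \<zero>) \<in> null_rel A" by (simp add: null_rel_iff)
    from null_rel_dominated[OF * this mem(3,4), of C] C[OF mem(1,2)] show "cls (f u) = cls (f v)"
      using mem by (simp add: cls_eq_iff)
  qed
qed

lemma add_cls:
  assumes "u \<in> cauchy_seqs A" "v \<in> cauchy_seqs A"
  shows "cls u \<oplus>\<^bsub>\<B>\<^esub> cls v = cls (\<lambda>n. u n \<oplus> v n)"
proof -
  have "cls u \<oplus>\<^bsub>\<B>\<^esub> cls v = (\<Union>u\<in>cls u. \<Union>v\<in>cls v. cls (\<lambda>n. u n \<oplus> v n))"
    by (simp add: banach_completion_def)
  also have "\<dots> = cls (\<lambda>n. u n \<oplus> v n)"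
  proof (rule class_op2[where f = "\<lambda>u v n. u n \<oplus> v n"])
    fix u u' v v' assume *: "(u, u') \<in> null_rel A" "(v, v') \<in> null_rel A"
    note [simp] = null_relD[OF *(1)] null_relD[OF *(2)]
    show "\<exists>C. \<forall>n. nrm A (u n \<oplus> v n \<ominus> (u' n \<oplus> v' n)) \<le>
        C * nrm A (u n \<ominus> u' n) + C * nrm A (v n \<ominus> v' n)"
      by (intro exI[of _ 1]) (simp add: add_minus_add nrm_triangle)
  qed (use assms in simp_all)
  finally show ?thesis .
qed

lemma smult_cls:
  assumes "u \<in> cauchy_seqs A"
  shows "c \<odot>\<^bsub>\<B>\<^esub> cls u = cls (\<lambda>n. c \<odot> u n)"
proof -
  have "c \<odot>\<^bsub>\<B>\<^esub> cls u = (\<Union>u\<in>cls u. cls (\<lambda>n. c \<odot> u n))"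
    by (simp add: banach_completion_def)
  also have "\<dots> = cls (\<lambda>n. c \<odot> u n)"
    using assms
    by (intro class_op1[where f = "\<lambda>u n. c \<odot> u n" and C = "cmod c"])
      (simp_all add: smult_minus[OF cauchy_seqs_in cauchy_seqs_in] nrm_smult[OF M.minus_closed[OF cauchy_seqs_in cauchy_seqs_in]])
  finally show ?thesis .
qed

lemma nrm_cls:
  assumes u: "u \<in> cauchy_seqs A"
  shows "(\<lambda>n. nrm A (u n)) \<longlonglongrightarrow> nrm \<B> (cls u)"
proof -
  have "Cauchy (\<lambda>n. nrm A (u n))"
  proof (rule metric_CauchyI)
    fix e :: real assume "e > 0"
    with u obtain K where K: "\<And>m n. m \<ge> K \<Longrightarrow> n \<ge> K \<Longrightarrow> nrm A (u m \<ominus> u n) < e"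
      unfolding cauchy_seqs_iff by meson
    have "dist (nrm A (u m)) (nrm A (u n)) < e" if "m \<ge> K" "n \<ge> K" for m n
      using K[OF that] nrm_diff_le[OF cauchy_seqs_in[OF u] cauchy_seqs_in[OF u], of m n]
      by (simp add: dist_real_def)
    then show "\<exists>M. \<forall>m\<ge>M. \<forall>n\<ge>M. dist (nrm A (u m)) (nrm A (u n)) < e" by blast
  qed
  then obtain r where r: "(\<lambda>n. nrm A (u n)) \<longlonglongrightarrow> r"
    using Cauchy_convergent convergent_def by blast
  have *: "(\<lambda>n. nrm A (v n)) \<longlonglongrightarrow> r" if "v \<in> cls u" for v
  proof -
    have v: "v \<in> cauchy_seqs A" and lim: "(\<lambda>n. nrm A (u n \<ominus> v n)) \<longlonglongrightarrow> 0"
      using that by (auto simp: null_rel_iff)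
    have "(\<lambda>n. nrm A (u n) - nrm A (v n)) \<longlonglongrightarrow> 0"
      by (rule Lim_null_comparison[OF _ lim])
        (simp add: nrm_diff_le cauchy_seqs_in[OF u] cauchy_seqs_in[OF v])
    then show ?thesis using tendsto_diff[OF r, of "\<lambda>n. nrm A (u n) - nrm A (v n)" 0] by simp
  qed
  have "u \<in> cls u" using equiv_class_self[OF equiv_null_rel u] .
  then have "(THE r. \<forall>v\<in>cls u. (\<lambda>n. nrm A (v n)) \<longlonglongrightarrow> r) = r"
    by (intro the_equality ballI *) (auto intro: LIMSEQ_unique[OF _ r])
  then have "nrm \<B> (cls u) = r"
    by (simp add: banach_completion_def)
  with r show ?thesis by simp
qed

lemma seminormed_space_completion: "seminormed_space \<B>"
proof -
  let ?B = "\<B>"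
  have zero: "\<zero>\<^bsub>?B\<^esub> = cls (\<lambda>n. \<zero>)" by (rule zero_completion)
  have ab: "abelian_group ?B"
  proof (rule abelian_groupI)
    fix x assume "x \<in> carrier ?B"
    then obtain u where u: "u \<in> cauchy_seqs A" "x = cls u" "\<forall>n. u n \<in> carrier A" by (rule completion_cases)
    then have "cls (\<lambda>n. (-1) \<odot> u n) \<oplus>\<^bsub>?B\<^esub> x = cls (\<lambda>n. (-1) \<odot> u n \<oplus> u n)"
      by (simp add: add_cls)
    also have "\<dots> = \<zero>\<^bsub>?B\<^esub>"
      using u by (simp add: zero M.l_neg flip: neg_eq_smult)
    finally have "cls (\<lambda>n. (-1) \<odot> u n) \<oplus>\<^bsub>?B\<^esub> x = \<zero>\<^bsub>?B\<^esub>" .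
    then show "\<exists>y\<in>carrier ?B. y \<oplus>\<^bsub>?B\<^esub> x = \<zero>\<^bsub>?B\<^esub>" 
      using cls_in[OF cauchy_seqs_smult[OF u(1)]] by blast
  qed ((elim completion_cases)?; simp add: add_cls zero M.a_ac)+
  have "Module.module (ring_of_type_algebra :: complex ring) ?B"
    by (rule moduleI[OF cring_from_type_algebra ab]; elim completion_cases)
      (simp_all add: add_cls smult_cls smult_r_distr
        smult_l_distr[simplified] smult_assoc1[simplified] smult_one[simplified])
  then show ?thesis
  proof (intro seminormed_space.intro seminormed_space_axioms.intro)
    fix x y assume "x \<in> carrier ?B" "y \<in> carrier ?B"
    then obtain u v where *: "u \<in> cauchy_seqs A" "x = cls u" "v \<in> cauchy_seqs A" "y = cls v"
      "\<forall>n. u n \<in> carrier A" "\<forall>n. v n \<in> carrier A"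
      by (meson completion_cases)
    then have "(\<lambda>n. nrm A (u n) + nrm A (v n)) \<longlonglongrightarrow> nrm ?B x + nrm ?B y"
      "(\<lambda>n. nrm A (u n \<oplus> v n)) \<longlonglongrightarrow> nrm ?B (x \<oplus>\<^bsub>?B\<^esub> y)"
      by (simp_all add: add_cls tendsto_add nrm_cls)
    from LIMSEQ_le[OF this(2,1)] show "nrm ?B (x \<oplus>\<^bsub>?B\<^esub> y) \<le> nrm ?B x + nrm ?B y"
      using * nrm_triangle by simp
  next
    fix x c assume "x \<in> carrier ?B"
    then obtain u where u: "u \<in> cauchy_seqs A" "x = cls u" "\<forall>n. u n \<in> carrier A" by (rule completion_cases)
    have "(\<lambda>n. nrm A (c \<odot> u n)) \<longlonglongrightarrow> cmod c * nrm ?B x"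
      using u by (simp add: nrm_smult tendsto_mult_left nrm_cls)
    moreover have "(\<lambda>n. nrm A (c \<odot> u n)) \<longlonglongrightarrow> nrm ?B (c \<odot>\<^bsub>?B\<^esub> x)"
      using u by (simp add: smult_cls nrm_cls)
    ultimately show "nrm ?B (c \<odot>\<^bsub>?B\<^esub> x) = cmod c * nrm ?B x" by (rule LIMSEQ_unique[symmetric])
  qed simp
qed

lemma minus_cls:
  assumes "u \<in> cauchy_seqs A" "v \<in> cauchy_seqs A"
  shows "cls u \<ominus>\<^bsub>\<B>\<^esub> cls v = cls (\<lambda>n. u n \<ominus> v n)"
proof -
  interpret B: seminormed_space "\<B>" by (rule seminormed_space_completion)
  show ?thesis using assms cauchy_seqs_in[OF assms(1)] cauchy_seqs_in[OF assms(2)]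
    by (simp add: B.minus_eq_smult add_cls smult_cls minus_eq_smult)
qed

text \<open>A class of norm zero consists of null sequences, whatever the kernel of the seminorm is.\<close>

lemma nrm_completion_eq_0_iff:
  assumes "x \<in> carrier \<B>"
  shows "nrm \<B> x = 0 \<longleftrightarrow> x = \<zero>\<^bsub>\<B>\<^esub>"
proof -
  interpret B: seminormed_space "\<B>" by (rule seminormed_space_completion)
  obtain u where u: "u \<in> cauchy_seqs A" "x = cls u" "\<forall>n. u n \<in> carrier A" using assms by (rule completion_cases)
  have "x = \<zero>\<^bsub>\<B>\<^esub>" if "nrm \<B> x = 0"
    using nrm_cls[of u] u that by (simp add: zero_completion cls_eq_iff null_rel_iff)
  then show ?thesis by auto
qed

text \<open>The constant sequences are dense: a Cauchy sequence is the limit of its own terms.\<close>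

lemma nrm_cls_minus_const_tendsto_0:
  assumes u: "u \<in> cauchy_seqs A"
  shows "(\<lambda>k. nrm \<B> (cls u \<ominus>\<^bsub>\<B>\<^esub> cls (\<lambda>n. u k))) \<longlonglongrightarrow> 0"
proof -
  interpret B: seminormed_space "\<B>" by (rule seminormed_space_completion)
  show ?thesis
  proof (rule LIMSEQ_I)
    fix e :: real assume "e > 0"
    with u have "\<exists>K. \<forall>m\<ge>K. \<forall>n\<ge>K. nrm A (u m \<ominus> u n) < e / 2"
      unfolding cauchy_seqs_iff using half_gt_zero by blast
    then obtain K where K: "\<And>m n. m \<ge> K \<Longrightarrow> n \<ge> K \<Longrightarrow> nrm A (u m \<ominus> u n) < e / 2"
      by meson
    have "nrm \<B> (cls u \<ominus>\<^bsub>\<B>\<^esub> cls (\<lambda>n. u k)) \<le> e / 2" if "k \<ge> K" for k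
    proof (rule LIMSEQ_le_const2)
      show "(\<lambda>n. nrm A (u n \<ominus> u k)) \<longlonglongrightarrow>
          nrm \<B> (cls u \<ominus>\<^bsub>\<B>\<^esub> cls (\<lambda>n. u k))"
        using u nrm_cls[of "\<lambda>n. u n \<ominus> u k"] by (simp add: minus_cls minus_eq_smult cauchy_seqs_in[OF u])
    qed (use K that less_imp_le in blast)
    moreover have "0 \<le> nrm \<B> (cls u \<ominus>\<^bsub>\<B>\<^esub> cls (\<lambda>n. u k))" for k
      using u cauchy_seqs_in[OF u] by (intro B.nrm_nonneg B.M.minus_closed) simp_all
    ultimately show "\<exists>no. \<forall>n\<ge>no. norm (nrm \<B>
        (cls u \<ominus>\<^bsub>\<B>\<^esub> cls (\<lambda>m. u n)) - 0) < e"
      using \<open>e > 0\<close> by (intro exI[of _ K]) force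
  qed
qed

text \<open>Approximate the \<open>k\<close>-th class by a constant class within \<open>1 / (k + 1)\<close>; the approximating
  constants themselves form a Cauchy sequence, whose class is the limit.\<close>

lemma completion_complete:
  assumes P: "P \<in> cauchy_seqs \<B>"
  shows "\<exists>x\<in>carrier \<B>.
    (\<lambda>k. nrm \<B> (P k \<ominus>\<^bsub>\<B>\<^esub> x)) \<longlonglongrightarrow> 0"
proof -
  let ?B = "\<B>"
  interpret B: seminormed_space ?B by (rule seminormed_space_completion)
  have PB: "P k \<in> carrier ?B" for k using B.cauchy_seqs_in[OF P] .
  have "\<exists>b\<in>carrier A. nrm ?B (P k \<ominus>\<^bsub>?B\<^esub> cls (\<lambda>n. b)) < 1 / real (Suc k)" for k
  proof -
    obtain u where u: "u \<in> cauchy_seqs A" "P k = cls u" "\<forall>n. u n \<in> carrier A" using PB by (rule completion_cases)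
    have "eventually (\<lambda>j. nrm ?B (cls u \<ominus>\<^bsub>?B\<^esub> cls (\<lambda>n. u j)) < 1 / real (Suc k)) sequentially"
      by (rule order_tendstoD[OF nrm_cls_minus_const_tendsto_0[OF u(1)]]) simp
    then obtain j where "nrm ?B (cls u \<ominus>\<^bsub>?B\<^esub> cls (\<lambda>n. u j)) < 1 / real (Suc k)"
      unfolding eventually_sequentially by blast
    then show ?thesis using u by (intro bexI[of _ "u j"]) simp_all
  qed
  then obtain v where v: "\<And>k. v k \<in> carrier A"
    "\<And>k. nrm ?B (P k \<ominus>\<^bsub>?B\<^esub> cls (\<lambda>n. v k)) < 1 / real (Suc k)" by metis
  have nrm_const: "nrm ?B (cls (\<lambda>n. x)) = nrm A x" if "x \<in> carrier A" for x
    using LIMSEQ_unique[OF nrm_cls[of "\<lambda>n. x"]] that by simp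
  have "v \<in> cauchy_seqs A"
    unfolding cauchy_seqs_iff
  proof (intro conjI allI impI v)
    fix e :: real assume e: "e > 0"
    then obtain K where K: "\<And>m n. m \<ge> K \<Longrightarrow> n \<ge> K \<Longrightarrow> nrm ?B (P m \<ominus>\<^bsub>?B\<^esub> P n) < e / 3"
      using P unfolding B.cauchy_seqs_iff by (meson divide_pos_pos zero_less_numeral)
    obtain L where L: "1 / real (Suc L) < e / 3"
      using reals_Archimedean[of "e / 3"] e by (auto simp: field_simps)
    have small: "1 / real (Suc k) < e / 3" if "k \<ge> L" for k
    proof -
      have "1 / real (Suc k) \<le> 1 / real (Suc L)" using that by (simp add: frac_le)
      with L show ?thesis by simp
    qed
    have "nrm A (v m \<ominus> v n) < e" if "m \<ge> max K L" "n \<ge> max K L" for m n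
    proof -
      have "nrm A (v m \<ominus> v n) = nrm ?B (cls (\<lambda>i. v m) \<ominus>\<^bsub>?B\<^esub> cls (\<lambda>i. v n))"
        using v(1) nrm_const by (simp add: minus_cls)
      also have "\<dots> \<le> nrm ?B (cls (\<lambda>i. v m) \<ominus>\<^bsub>?B\<^esub> P m) + nrm ?B (P m \<ominus>\<^bsub>?B\<^esub> cls (\<lambda>i. v n))"
        using v(1) PB by (intro B.nrm_minus_triangle) simp_all
      also have "nrm ?B (P m \<ominus>\<^bsub>?B\<^esub> cls (\<lambda>i. v n)) \<le>
          nrm ?B (P m \<ominus>\<^bsub>?B\<^esub> P n) + nrm ?B (P n \<ominus>\<^bsub>?B\<^esub> cls (\<lambda>i. v n))"
        using v(1) PB by (intro B.nrm_minus_triangle) simp_all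
      also have "nrm ?B (cls (\<lambda>i. v m) \<ominus>\<^bsub>?B\<^esub> P m) = nrm ?B (P m \<ominus>\<^bsub>?B\<^esub> cls (\<lambda>i. v m))"
        using v(1) PB by (intro B.nrm_minus_commute) simp_all
      finally show ?thesis
        using v(2)[of m] v(2)[of n] K[of m n] small[of m] small[of n] that by force
    qed
    then show "\<exists>K. \<forall>m\<ge>K. \<forall>n\<ge>K. nrm A (v m \<ominus> v n) < e" by blast
  qed
  have "(\<lambda>k. nrm ?B (P k \<ominus>\<^bsub>?B\<^esub> cls v)) \<longlonglongrightarrow> 0"
  proof (rule tendsto_sandwich[OF _ _ tendsto_const])
    show "\<forall>\<^sub>F k in sequentially. 0 \<le> nrm ?B (P k \<ominus>\<^bsub>?B\<^esub> cls v)"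
      using PB \<open>v \<in> cauchy_seqs A\<close> B.nrm_nonneg by simp
    show "\<forall>\<^sub>F k in sequentially. nrm ?B (P k \<ominus>\<^bsub>?B\<^esub> cls v) \<le>
        1 / real (Suc k) + nrm ?B (cls v \<ominus>\<^bsub>?B\<^esub> cls (\<lambda>n. v k))"
    proof (rule always_eventually, rule allI)
      fix k
      show "nrm ?B (P k \<ominus>\<^bsub>?B\<^esub> cls v) \<le> 1 / real (Suc k) + nrm ?B (cls v \<ominus>\<^bsub>?B\<^esub> cls (\<lambda>n. v k))"
        using B.nrm_minus_triangle[of "P k" "cls (\<lambda>n. v k)" "cls v"] v(2)[of k] PB v(1)
          \<open>v \<in> cauchy_seqs A\<close> B.nrm_minus_commute[of "cls (\<lambda>n. v k)" "cls v"] by simp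
    qed
    have "(\<lambda>k. 1 / real (Suc k) + nrm ?B (cls v \<ominus>\<^bsub>?B\<^esub> cls (\<lambda>n. v k))) \<longlonglongrightarrow> 0 + 0"
      using nrm_cls_minus_const_tendsto_0[OF \<open>v \<in> cauchy_seqs A\<close>] LIMSEQ_inverse_real_of_nat
      by (intro tendsto_add) (simp_all add: inverse_eq_divide)
    then show "(\<lambda>k. 1 / real (Suc k) + nrm ?B (cls v \<ominus>\<^bsub>?B\<^esub> cls (\<lambda>n. v k))) \<longlonglongrightarrow> 0" by simp
  qed
  then show ?thesis using \<open>v \<in> cauchy_seqs A\<close> by (intro bexI[of _ "cls v"]) simp_all
qed

end

text \<open>The isometry of the involution makes it act on Cauchy sequences and preserve null sequences;
  the submultiplicative norm does the same for the product, since Cauchy sequences are bounded.\<close>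

locale seminormed_star_algebra = seminormed_space +
  fixes star :: "'a \<Rightarrow> 'a"
  assumes mult_closed: "\<lbrakk>x \<in> carrier A; y \<in> carrier A\<rbrakk> \<Longrightarrow> x \<otimes> y \<in> carrier A"
    and mult_assoc: "\<lbrakk>x \<in> carrier A; y \<in> carrier A; z \<in> carrier A\<rbrakk> \<Longrightarrow>
      (x \<otimes> y) \<otimes> z = x \<otimes> (y \<otimes> z)"
    and mult_add_left: "\<lbrakk>x \<in> carrier A; y \<in> carrier A; z \<in> carrier A\<rbrakk> \<Longrightarrow>
      (x \<oplus> y) \<otimes> z = x \<otimes> z \<oplus> y \<otimes> z"
    and mult_add_right: "\<lbrakk>x \<in> carrier A; y \<in> carrier A; z \<in> carrier A\<rbrakk> \<Longrightarrow>
      x \<otimes> (y \<oplus> z) = x \<otimes> y \<oplus> x \<otimes> z"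
    and mult_smult_left: "\<lbrakk>x \<in> carrier A; y \<in> carrier A\<rbrakk> \<Longrightarrow> (c \<odot> x) \<otimes> y = c \<odot> (x \<otimes> y)"
    and mult_smult_right: "\<lbrakk>x \<in> carrier A; y \<in> carrier A\<rbrakk> \<Longrightarrow> x \<otimes> (c \<odot> y) = c \<odot> (x \<otimes> y)"
    and nrm_mult: "\<lbrakk>x \<in> carrier A; y \<in> carrier A\<rbrakk> \<Longrightarrow> nrm A (x \<otimes> y) \<le> nrm A x * nrm A y"
    and star_closed: "x \<in> carrier A \<Longrightarrow> star x \<in> carrier A"
    and star_add: "\<lbrakk>x \<in> carrier A; y \<in> carrier A\<rbrakk> \<Longrightarrow> star (x \<oplus> y) = star x \<oplus> star y"
    and star_smult: "x \<in> carrier A \<Longrightarrow> star (c \<odot> x) = cnj c \<odot> star x"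
    and star_star: "x \<in> carrier A \<Longrightarrow> star (star x) = x"
    and star_mult: "\<lbrakk>x \<in> carrier A; y \<in> carrier A\<rbrakk> \<Longrightarrow> star (x \<otimes> y) = star y \<otimes> star x"
    and nrm_star: "x \<in> carrier A \<Longrightarrow> nrm A (star x) = nrm A x"
begin

text \<open>Splitting the difference of two products as for the product rule gives a Lipschitz bound with the
  norm of one factor from each pair.\<close>

lemma mult_minus_mult:
  assumes "x \<in> carrier A" "y \<in> carrier A" "x' \<in> carrier A" "y' \<in> carrier A"
  shows "x \<otimes> y \<ominus> x' \<otimes> y' = (x \<ominus> x') \<otimes> y \<oplus> x' \<otimes> (y \<ominus> y')"
proof -
  have "(x \<ominus> x') \<otimes> y \<oplus> x' \<otimes> (y \<ominus> y') =
      (x \<otimes> y \<oplus> \<ominus> (x' \<otimes> y)) \<oplus> (x' \<otimes> y \<oplus> \<ominus> (x' \<otimes> y'))"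
    using assms by (simp add: minus_eq_smult mult_add_left mult_add_right mult_smult_left
        mult_smult_right neg_eq_smult mult_closed)
  also have "\<dots> = x \<otimes> y \<oplus> \<ominus> (x' \<otimes> y')"
    using assms mult_closed by (simp add: M.a_assoc) (simp flip: M.a_assoc add: M.l_neg)
  finally show ?thesis by (simp add: a_minus_def)
qed

lemma nrm_mult_minus_mult_le:
  assumes "x \<in> carrier A" "y \<in> carrier A" "x' \<in> carrier A" "y' \<in> carrier A"
    and "nrm A y \<le> C" "nrm A x' \<le> C"
  shows "nrm A (x \<otimes> y \<ominus> x' \<otimes> y') \<le> C * nrm A (x \<ominus> x') + C * nrm A (y \<ominus> y')"
proof -
  have "nrm A (x \<otimes> y \<ominus> x' \<otimes> y') \<le> nrm A ((x \<ominus> x') \<otimes> y) + nrm A (x' \<otimes> (y \<ominus> y'))"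
    using assms by (simp add: mult_minus_mult mult_closed nrm_triangle)
  also have "\<dots> \<le> nrm A (x \<ominus> x') * nrm A y + nrm A x' * nrm A (y \<ominus> y')"
    using assms by (intro add_mono nrm_mult) auto
  also have "\<dots> \<le> nrm A (x \<ominus> x') * C + C * nrm A (y \<ominus> y')"
    using assms by (intro add_mono mult_mono mult_left_mono mult_right_mono nrm_nonneg) auto
  finally show ?thesis by (simp add: mult.commute)
qed

lemma cauchy_seqs_bounded:
  assumes "u \<in> cauchy_seqs A"
  obtains C where "\<And>n. nrm A (u n) \<le> C"
proof -
  have "bounded (range (\<lambda>n. nrm A (u n)))"
    using convergent_imp_bounded nrm_cls[OF assms] by blast
  then obtain C where "\<And>n. \<bar>nrm A (u n)\<bar> \<le> C" unfolding bounded_iff by auto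
  then show thesis using that abs_le_D1 by blast
qed

lemma cauchy_seqs_bounded2:
  assumes "u \<in> cauchy_seqs A" "v \<in> cauchy_seqs A"
  obtains C where "\<And>n. nrm A (u n) \<le> C" "\<And>n. nrm A (v n) \<le> C"
proof -
  obtain C D where "\<And>n. nrm A (u n) \<le> C" "\<And>n. nrm A (v n) \<le> D"
    using assms cauchy_seqs_bounded by metis
  then show thesis using that[of "max C D"] by (simp add: le_max_iff_disj)
qed

lemma cauchy_seqs_mult [simp]:
  assumes "u \<in> cauchy_seqs A" "v \<in> cauchy_seqs A"
  shows "(\<lambda>n. u n \<otimes> v n) \<in> cauchy_seqs A"
proof -
  obtain C where "\<And>n. nrm A (u n) \<le> C" "\<And>n. nrm A (v n) \<le> C"
    using cauchy_seqs_bounded2 assms by blast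
  then show ?thesis
    using cauchy_seqs_in[OF assms(1)] cauchy_seqs_in[OF assms(2)]
    by (intro cauchy_seqs_dominated[OF assms] nrm_mult_minus_mult_le mult_closed) simp_all
qed

lemma mult_cls:
  assumes "u \<in> cauchy_seqs A" "v \<in> cauchy_seqs A"
  shows "cls u \<otimes>\<^bsub>\<B>\<^esub> cls v = cls (\<lambda>n. u n \<otimes> v n)"
proof -
  have "cls u \<otimes>\<^bsub>\<B>\<^esub> cls v = (\<Union>u\<in>cls u. \<Union>v\<in>cls v. cls (\<lambda>n. u n \<otimes> v n))"
    by (simp add: banach_completion_def)
  also have "\<dots> = cls (\<lambda>n. u n \<otimes> v n)"
  proof (rule class_op2[where f = "\<lambda>u v n. u n \<otimes> v n"])
    fix u u' v v' assume *: "(u, u') \<in> null_rel A" "(v, v') \<in> null_rel A"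
    note [simp] = null_relD[OF *(1)] null_relD[OF *(2)]
    obtain C where "\<And>n. nrm A (v n) \<le> C" "\<And>n. nrm A (u' n) \<le> C"
      using cauchy_seqs_bounded2[of v u'] by (metis null_relD[OF *(1)] null_relD[OF *(2)])
    then have "\<forall>n. nrm A (u n \<otimes> v n \<ominus> u' n \<otimes> v' n) \<le>
        C * nrm A (u n \<ominus> u' n) + C * nrm A (v n \<ominus> v' n)"
      by (intro allI nrm_mult_minus_mult_le) simp_all
    then show "\<exists>C. \<forall>n. nrm A (u n \<otimes> v n \<ominus> u' n \<otimes> v' n) \<le>
        C * nrm A (u n \<ominus> u' n) + C * nrm A (v n \<ominus> v' n)" by blast
  qed (use assms in simp_all)
  finally show ?thesis .
qed

lemma star_minus: "x \<in> carrier A \<Longrightarrow> y \<in> carrier A \<Longrightarrow> star x \<ominus> star y = star (x \<ominus> y)"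
  by (simp add: minus_eq_smult star_add star_smult star_closed)

lemma cauchy_seqs_star [simp]:
  assumes "u \<in> cauchy_seqs A"
  shows "(\<lambda>n. star (u n)) \<in> cauchy_seqs A"
proof -
  note [simp] = cauchy_seqs_in[OF assms]
  show ?thesis
    by (rule cauchy_seqs_dominated[OF assms cauchy_seqs_const[OF M.zero_closed], where C = 1])
      (simp_all add: star_closed star_minus nrm_star)
qed

definition completion_star :: "(nat \<Rightarrow> 'a) set \<Rightarrow> (nat \<Rightarrow> 'a) set" where
  "completion_star P = (\<Union>u\<in>P. cls (\<lambda>n. star (u n)))"

lemma completion_star_cls:
  "u \<in> cauchy_seqs A \<Longrightarrow> completion_star (cls u) = cls (\<lambda>n. star (u n))"
  unfolding completion_star_def
  by (intro class_op1[where f = "\<lambda>u n. star (u n)" and C = 1])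
    (simp_all add: star_minus[OF cauchy_seqs_in cauchy_seqs_in]
      nrm_star[OF M.minus_closed[OF cauchy_seqs_in cauchy_seqs_in]])

lemma banach_star_algebra_completion:
  "banach_star_algebra \<B> completion_star"
proof -
  let ?B = "\<B>"
  interpret B: seminormed_space ?B by (rule seminormed_space_completion)
  have mult_le: "nrm ?B (x \<otimes>\<^bsub>?B\<^esub> y) \<le> nrm ?B x * nrm ?B y"
    if xy: "x \<in> carrier ?B" "y \<in> carrier ?B" for x y
  proof -
    obtain u where u: "u \<in> cauchy_seqs A" "x = cls u" "\<forall>n. u n \<in> carrier A"
      using xy(1) by (rule completion_cases)
    obtain v where v: "v \<in> cauchy_seqs A" "y = cls v" "\<forall>n. v n \<in> carrier A"
      using xy(2) by (rule completion_cases)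
    note * = u v
    from u(1,2) v(1,2) have "(\<lambda>n. nrm A (u n) * nrm A (v n)) \<longlonglongrightarrow> nrm ?B x * nrm ?B y"
      "(\<lambda>n. nrm A (u n \<otimes> v n)) \<longlonglongrightarrow> nrm ?B (x \<otimes>\<^bsub>?B\<^esub> y)"
      by (simp_all add: mult_cls tendsto_mult nrm_cls)
    from LIMSEQ_le[OF this(2,1)] show ?thesis using * nrm_mult by simp
  qed
  have "complex_normed_space ?B"
    by (intro complex_normed_space.intro B.module_axioms B.nrm_nonneg nrm_completion_eq_0_iff
        B.nrm_triangle B.nrm_smult)
  moreover have "complex_banach_algebra_axioms ?B"
    by (rule complex_banach_algebra_axioms.intro; (rule completion_complete mult_le, assumption+)?;
        (elim completion_cases)?)
      (simp_all add: mult_cls add_cls smult_cls mult_assoc mult_add_left mult_add_right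
        mult_smult_left mult_smult_right)
  moreover have "banach_star_algebra_axioms ?B completion_star"
    by (rule banach_star_algebra_axioms.intro; elim completion_cases)
      (simp_all add: mult_cls add_cls smult_cls completion_star_cls star_add star_smult star_star star_mult)
  ultimately show ?thesis
    by (intro banach_star_algebra.intro complex_banach_algebra.intro)
qed

lemma isometric_involution_completion_star:
  "isometric_involution \<B> completion_star"
proof -
  interpret B: banach_star_algebra "\<B>" completion_star
    by (rule banach_star_algebra_completion)
  have "nrm \<B> (completion_star x) = nrm \<B> x"
    if x: "x \<in> carrier \<B>" for x
  proof -
    obtain u where u: "u \<in> cauchy_seqs A" "x = cls u" "\<forall>n. u n \<in> carrier A" using x by (rule completion_cases)
    have "(\<lambda>n. nrm A (star (u n))) \<longlonglongrightarrow> nrm \<B> x"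
      using u by (simp add: nrm_star nrm_cls)
    moreover have "(\<lambda>n. nrm A (star (u n))) \<longlonglongrightarrow> nrm \<B> (completion_star x)"
      using u by (simp add: completion_star_cls nrm_cls)
    ultimately show ?thesis by (rule LIMSEQ_unique[symmetric])
  qed
  then show ?thesis
    by (simp add: isometric_involution_def B.star_closed B.star_star B.star_add B.star_smult)
qed

lemma completion_star_to_completion:
  "x \<in> carrier A \<Longrightarrow> completion_star (to_completion A x) = to_completion A (star x)"
  by (simp add: to_completion_def completion_star_cls)

text \<open>Additive isometries are continuous, so their values on the dense image of \<open>A\<close> determine them.\<close>

lemma isometric_involution_completion_unique:
  assumes J: "isometric_involution \<B> J"
    and J_ext: "\<And>x. x \<in> carrier A \<Longrightarrow> J (to_completion A x) = to_completion A (star x)"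
    and a: "a \<in> carrier \<B>"
  shows "J a = completion_star a"
proof -
  let ?B = "\<B>"
  interpret B: seminormed_space ?B by (rule seminormed_space_completion)
  obtain u where u: "u \<in> cauchy_seqs A" "a = cls u" "\<forall>n. u n \<in> carrier A" using a by (rule completion_cases)
  have iso: "nrm ?B (I x \<ominus>\<^bsub>?B\<^esub> I y) = nrm ?B (x \<ominus>\<^bsub>?B\<^esub> y)"
    if "isometric_involution ?B I" "x \<in> carrier ?B" "y \<in> carrier ?B" for I x y
  proof -
    have "I x \<ominus>\<^bsub>?B\<^esub> I y = I (x \<ominus>\<^bsub>?B\<^esub> y)"
      using that by (simp add: B.minus_eq_smult isometric_involution_def)
    then show ?thesis using that by (simp add: isometric_involution_def)
  qed
  let ?c = "\<lambda>k. cls (\<lambda>n. u k)"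
  have mem: "J a \<in> carrier ?B" "completion_star a \<in> carrier ?B" "?c k \<in> carrier ?B"
    "completion_star (?c k) \<in> carrier ?B" for k
    using J isometric_involution_completion_star a u by (auto simp: isometric_involution_def)
  have le: "nrm ?B (J a \<ominus>\<^bsub>?B\<^esub> completion_star a) \<le> 2 * nrm ?B (a \<ominus>\<^bsub>?B\<^esub> ?c k)" for k
  proof -
    have "J (?c k) = completion_star (?c k)"
      using J_ext[of "u k"] u by (simp add: completion_star_cls to_completion_def)
    then have 1: "nrm ?B (J a \<ominus>\<^bsub>?B\<^esub> completion_star (?c k)) = nrm ?B (a \<ominus>\<^bsub>?B\<^esub> ?c k)"
      using iso[OF J a mem(3)[of k]] by simp
    have 2: "nrm ?B (completion_star (?c k) \<ominus>\<^bsub>?B\<^esub> completion_star a) = nrm ?B (a \<ominus>\<^bsub>?B\<^esub> ?c k)"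
      using iso[OF isometric_involution_completion_star mem(3)[of k] a]
        B.nrm_minus_commute[OF mem(3)[of k] a] by simp
    show ?thesis
      using B.nrm_minus_triangle[OF mem(1) mem(4)[of k] mem(2)] 1 2 by simp
  qed
  have "(\<lambda>k. 2 * nrm ?B (a \<ominus>\<^bsub>?B\<^esub> ?c k)) \<longlonglongrightarrow> 2 * 0"
    using nrm_cls_minus_const_tendsto_0[OF u(1)] u(2) by (intro tendsto_mult tendsto_const) simp
  then have "nrm ?B (J a \<ominus>\<^bsub>?B\<^esub> completion_star a) \<le> 2 * 0"
    by (rule LIMSEQ_le_const) (use le in blast)
  moreover have in_B: "J a \<ominus>\<^bsub>?B\<^esub> completion_star a \<in> carrier ?B"
    using mem(1,2) by (rule B.M.minus_closed)
  ultimately have "nrm ?B (J a \<ominus>\<^bsub>?B\<^esub> completion_star a) = 0"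
    using B.nrm_nonneg[OF in_B] by linarith
  then have "J a \<ominus>\<^bsub>?B\<^esub> completion_star a = \<zero>\<^bsub>?B\<^esub>"
    using nrm_completion_eq_0_iff[OF in_B] by blast
  then have "J a \<oplus>\<^bsub>?B\<^esub> \<ominus>\<^bsub>?B\<^esub> completion_star a = \<zero>\<^bsub>?B\<^esub>"
    by (simp add: a_minus_def)
  then show ?thesis
    using B.M.minus_equality[of "J a" "\<ominus>\<^bsub>?B\<^esub> completion_star a"] mem(1,2) by simp
qed

end

section \<open>Jointly continuous functions\<close>

lemma continuous_map_euclideanI:
  fixes f :: "'a \<Rightarrow> 'b::metric_space"
  assumes *: "\<And>x e. x \<in> topspace T \<Longrightarrow> e > 0 \<Longrightarrow>
    \<exists>U. openin T U \<and> x \<in> U \<and> (\<forall>y\<in>U. dist (f y) (f x) < e)"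
  shows "continuous_map T euclidean f"
  unfolding continuous_map
proof (intro conjI allI impI)
  fix V :: "'b set" assume "openin euclidean V"
  then have V: "open V" by simp
  show "openin T {x \<in> topspace T. f x \<in> V}"
  proof (subst openin_subopen, intro ballI)
    fix x assume x: "x \<in> {x \<in> topspace T. f x \<in> V}"
    then have "\<exists>e>0. \<forall>z. dist z (f x) < e \<longrightarrow> z \<in> V"
      using V unfolding open_dist by simp
    then obtain e where e: "e > 0" "\<forall>z. dist z (f x) < e \<longrightarrow> z \<in> V"
      by blast
    obtain U where U: "openin T U" "x \<in> U" "\<forall>y\<in>U. dist (f y) (f x) < e"
      using *[OF _ e(1), of x] x by blast
    then show "\<exists>W. openin T W \<and> x \<in> W \<and> W \<subseteq> {x \<in> topspace T. f x \<in> V}"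
      using e openin_subset[OF U(1)] by blast
  qed
qed simp

lemma continuous_map_euclidean_compose:
  assumes "continuous_map T euclidean f" "continuous_on UNIV h"
  shows "continuous_map T euclidean (\<lambda>x. h (f x))"
  using continuous_map_compose[OF assms(1), of euclidean h] assms(2) by (simp add: o_def)

lemma continuous_map_euclidean_compose2:
  assumes f: "continuous_map T euclidean f" and g: "continuous_map T euclidean g"
    and h: "continuous_on UNIV (\<lambda>p. h (fst p) (snd p))"
  shows "continuous_map T euclidean (\<lambda>x. h (f x) (g x))"
proof -
  have "continuous_map T (prod_topology euclidean euclidean) (\<lambda>x. (f x, g x))"
    by (rule continuous_map_pairedI[OF f g])
  then have "continuous_map T euclidean (\<lambda>x. (f x, g x))"
    by (simp only: prod_topology_euclidean)
  from continuous_map_euclidean_compose[OF this h] show ?thesis by simp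
qed

lemma continuous_map_prod_slice:
  assumes "continuous_map (prod_topology Y T) Z (\<lambda>(y, x). F y x)" "y \<in> topspace Y"
  shows "continuous_map T Z (F y)"
proof -
  have "continuous_map T (prod_topology Y T) (\<lambda>x. (y, x))"
    using assms(2) by (simp add: continuous_map_pairedI)
  from continuous_map_compose[OF this assms(1)] show ?thesis by (simp add: o_def)
qed

lemma continuous_map_prod_swap:
  assumes "continuous_map (prod_topology Y T) Z (\<lambda>(y, x). F y x)"
  shows "continuous_map (prod_topology T Y) Z (\<lambda>(x, y). F y x)"
proof -
  have "continuous_map (prod_topology T Y) (prod_topology Y T) (\<lambda>z. (snd z, fst z))"
    by (intro continuous_map_pairedI continuous_map_fst continuous_map_snd)
  from continuous_map_compose[OF this assms] show ?thesis by (simp add: o_def case_prod_unfold)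
qed

text \<open>The tube lemma turns joint continuity into continuity in the first variable that is uniform in
  the second one as long as it stays in a compact set.\<close>

lemma continuous_map_uniform_on_compact:
  fixes F :: "'a \<Rightarrow> 'b \<Rightarrow> 'c::metric_space"
  assumes F: "continuous_map (prod_topology Y T) euclidean (\<lambda>(y, x). F y x)"
    and L: "compactin T L" and y: "y \<in> topspace Y" and e: "e > 0"
  obtains U where "openin Y U" "y \<in> U" "\<forall>z\<in>U. \<forall>x\<in>L. dist (F z x) (F y x) < e"
proof -
  have Fy: "continuous_map (prod_topology Y T) euclidean (\<lambda>z. F y (snd z))"
    using continuous_map_compose[OF continuous_map_snd continuous_map_prod_slice[OF F y], of Y]
    by (simp add: o_def)
  define d where "d = (\<lambda>z. dist (case_prod F z) (F y (snd z)))"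
  have "continuous_map (prod_topology Y T) euclidean d"
    unfolding d_def
    by (rule continuous_map_euclidean_compose2[OF F Fy]) (intro continuous_intros)
  then have W: "openin (prod_topology Y T) {z \<in> topspace (prod_topology Y T). d z \<in> {..<e}}"
    by (rule openin_continuous_map_preimage) simp
  have "{y} \<times> L \<subseteq> {z \<in> topspace (prod_topology Y T). d z \<in> {..<e}}"
    using compactin_subset_topspace[OF L] y e by (auto simp: d_def)
  from tube_lemma_right[OF W L y this] obtain U V
    where UV: "openin Y U" "y \<in> U" "L \<subseteq> V" "U \<times> V \<subseteq> {z \<in> topspace (prod_topology Y T). d z \<in> {..<e}}"
    by blast
  show thesis
  proof (rule that[OF UV(1,2)], intro ballI)
    fix z x assume "z \<in> U" "x \<in> L"
    then have "(z, x) \<in> U \<times> V" using UV(3) by blast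
    then have "d (z, x) < e" using UV(4) by blast
    then show "dist (F z x) (F y x) < e" by (simp add: d_def)
  qed
qed

section \<open>Integrals of compactly supported continuous functions\<close>

definition compact_support :: "'a topology \<Rightarrow> ('a \<Rightarrow> 'b::{zero, topological_space}) \<Rightarrow> bool" where
  "compact_support T f \<longleftrightarrow> continuous_map T euclidean f \<and>
     (\<exists>K. compactin T K \<and> (\<forall>x\<in>topspace T - K. f x = 0))"

lemma compact_supportI:
  "continuous_map T euclidean f \<Longrightarrow> compactin T K \<Longrightarrow> (\<And>x. x \<in> topspace T \<Longrightarrow> x \<notin> K \<Longrightarrow> f x = 0) \<Longrightarrow>
    compact_support T f"
  unfolding compact_support_def by blast

lemma compact_supportE:
  assumes "compact_support T f"
  obtains K where "continuous_map T euclidean f" "compactin T K" "\<forall>x\<in>topspace T - K. f x = 0"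
  using assms unfolding compact_support_def by blast

text \<open>The properties of a Radon measure on which integration of compactly supported continuous functions
  rests.  Hausdorffness makes compact sets Borel.\<close>

locale locally_finite_borel =
  fixes T :: "'a topology" and M :: "'a measure"
  assumes sets_M: "sets M = sigma_sets (topspace T) {U. openin T U}"
    and compact_finite: "compactin T K \<Longrightarrow> emeasure M K < \<infinity>"
    and hausdorff: "Hausdorff_space T"
begin

lemma open_subset_Pow: "{U. openin T U} \<subseteq> Pow (topspace T)"
  using openin_subset by blast

lemma space_M: "space M = topspace T"
proof -
  have "sets M = sets (sigma (topspace T) {U. openin T U})"
    using open_subset_Pow by (simp add: sets_M)
  then have "space M = space (sigma (topspace T) {U. openin T U})"
    by (rule sets_eq_imp_space_eq)
  then show ?thesis using open_subset_Pow by simp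
qed

lemma open_in_sets: "openin T U \<Longrightarrow> U \<in> sets M"
  unfolding sets_M by blast

lemma closed_in_sets: "closedin T C \<Longrightarrow> C \<in> sets M"
proof -
  assume C: "closedin T C"
  then have "topspace T - C \<in> sets M" by (intro open_in_sets) (simp add: closedin_def)
  then have "space M - (topspace T - C) \<in> sets M" by (rule sets.compl_sets)
  moreover have "space M - (topspace T - C) = C"
    using closedin_subset[OF C] space_M by blast
  ultimately show ?thesis by simp
qed

lemma compact_in_sets: "compactin T K \<Longrightarrow> K \<in> sets M"
  using compactin_imp_closedin[OF hausdorff] closed_in_sets by blast

lemma continuous_measurable: "continuous_map T T f \<Longrightarrow> f \<in> measurable M M"
proof (rule measurable_sigma_sets[OF sets_M open_subset_Pow])
  assume f: "continuous_map T T f"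
  then show "f \<in> space M \<rightarrow> topspace T" by (simp add: space_M continuous_map_def)
  fix U assume "U \<in> {U. openin T U}"
  then have "openin T {x \<in> topspace T. f x \<in> U}"
    using f by (simp add: openin_continuous_map_preimage)
  moreover have "f -` U \<inter> space M = {x \<in> topspace T. f x \<in> U}"
    using space_M by blast
  ultimately show "f -` U \<inter> space M \<in> sets M"
    using open_in_sets by simp
qed

lemma continuous_borel_measurable:
  fixes f :: "'a \<Rightarrow> 'b::topological_space"
  assumes f: "continuous_map T euclidean f"
  shows "f \<in> borel_measurable M"
proof (rule borel_measurableI)
  fix S :: "'b set" assume "open S"
  then have "openin T {x \<in> topspace T. f x \<in> S}"
    by (intro openin_continuous_map_preimage[OF f]) simp
  moreover have "f -` S \<inter> space M = {x \<in> topspace T. f x \<in> S}"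
    using space_M by blast
  ultimately show "f -` S \<inter> space M \<in> sets M"
    using open_in_sets by simp
qed

lemma integrable_compact_support:
  fixes f :: "'a \<Rightarrow> 'b::{banach, second_countable_topology}"
  assumes "compact_support T f"
  shows "integrable M f"
proof -
  obtain K where f: "continuous_map T euclidean f" and K: "compactin T K"
    and zero: "\<forall>x\<in>topspace T - K. f x = 0"
    using assms by (rule compact_supportE)
  have "compact (f ` K)"
    using image_compactin[OF K f] by simp
  from compact_imp_bounded[OF this] obtain B where B: "\<forall>x\<in>K. norm (f x) \<le> B"
    unfolding bounded_iff by auto
  show ?thesis
  proof (rule integrableI_bounded_set[OF compact_in_sets[OF K] continuous_borel_measurable[OF f]
          compact_finite[OF K]])
    show "AE x in M. x \<in> K \<longrightarrow> norm (f x) \<le> B" using B by simp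
    show "AE x in M. x \<notin> K \<longrightarrow> f x = 0" using zero space_M by (intro AE_I2) simp
  qed
qed

lemma norm_integral_le_compact:
  fixes f :: "'a \<Rightarrow> 'b::{banach, second_countable_topology}"
  assumes f: "integrable M f" and K: "compactin T K"
    and bound: "\<And>x. x \<in> topspace T \<Longrightarrow> norm (f x) \<le> e * indicator K x"
  shows "norm (integral\<^sup>L M f) \<le> e * measure M K"
proof -
  have "norm (integral\<^sup>L M f) \<le> (\<integral>x. norm (f x) \<partial>M)" by (rule integral_norm_bound)
  also have "\<dots> \<le> (\<integral>x. e * indicator K x \<partial>M)"
  proof (rule integral_mono)
    show "integrable M (\<lambda>x. e * indicator K x)"
      using compact_in_sets[OF K] compact_finite[OF K] by simp
  qed (use f bound space_M in auto)
  also have "\<dots> = e * measure M K"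
    using compact_in_sets[OF K] sets.sets_into_space by (simp add: Int_absorb2)
  finally show ?thesis .
qed

text \<open>On a compact set the integrand varies uniformly with the parameter.  The support may move with
  the parameter, as for \<open>f (t \<otimes> s)\<close> with parameter \<open>s\<close>, hence the compact set is only locally
  uniform.\<close>

lemma continuous_map_integral:
  fixes F :: "'b \<Rightarrow> 'a \<Rightarrow> 'c::{banach, second_countable_topology}"
  assumes F: "continuous_map (prod_topology Y T) euclidean (\<lambda>(y, x). F y x)"
    and supp: "\<And>y. y \<in> topspace Y \<Longrightarrow> \<exists>U L. openin Y U \<and> y \<in> U \<and> compactin T L \<and>
      (\<forall>z\<in>U. \<forall>x\<in>topspace T - L. F z x = 0)"
  shows "continuous_map Y euclidean (\<lambda>y. \<integral>x. F y x \<partial>M)"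
proof (rule continuous_map_euclideanI)
  fix y and e :: real assume y: "y \<in> topspace Y" and e: "e > 0"
  obtain U L where U: "openin Y U" "y \<in> U" and L: "compactin T L"
    and zero: "\<forall>z\<in>U. \<forall>x\<in>topspace T - L. F z x = 0"
    using supp[OF y] by blast
  define d where "d = e / (measure M L + 1)"
  have pos: "measure M L + 1 > 0" using measure_nonneg[of M L] by linarith
  then have d: "d > 0" using e by (simp add: d_def)
  obtain V where V: "openin Y V" "y \<in> V"
    and close: "\<forall>z\<in>V. \<forall>x\<in>L. dist (F z x) (F y x) < d"
    by (rule continuous_map_uniform_on_compact[OF F L y d])
  have int: "integrable M (F z)" if "z \<in> U" for z
  proof (intro integrable_compact_support compact_supportI[OF continuous_map_prod_slice[OF F] L])
    show "z \<in> topspace Y" using that openin_subset[OF U(1)] by blast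
  qed (use zero that in blast)
  have "dist (\<integral>x. F z x \<partial>M) (\<integral>x. F y x \<partial>M) < e" if z: "z \<in> U \<inter> V" for z
  proof -
    have "norm (\<integral>x. F z x - F y x \<partial>M) \<le> d * measure M L"
    proof (rule norm_integral_le_compact[OF _ L])
      show "integrable M (\<lambda>x. F z x - F y x)" using int z U by simp
      fix x assume "x \<in> topspace T"
      then show "norm (F z x - F y x) \<le> d * indicator L x"
        using zero close z U(2)
        by (cases "x \<in> L") (simp_all add: dist_norm less_imp_le)
    qed
    also have "\<dots> < d * (measure M L + 1)" using d by simp
    also have "\<dots> = e" using pos by (simp add: d_def)
    finally show ?thesis using int z U by (simp add: dist_norm)
  qed
  then show "\<exists>U. openin Y U \<and> y \<in> U \<and> (\<forall>z\<in>U. dist (\<integral>x. F z x \<partial>M) (\<integral>x. F y x \<partial>M) < e)"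
    using U V by (intro exI[of _ "U \<inter> V"]) blast
qed

lemma continuous_map_integral_compact:
  fixes F :: "'b \<Rightarrow> 'a \<Rightarrow> 'c::{banach, second_countable_topology}"
  assumes F: "continuous_map (prod_topology Y T) euclidean (\<lambda>(y, x). F y x)"
    and L: "compactin T L"
    and supp: "\<And>y x. y \<in> topspace Y \<Longrightarrow> x \<in> topspace T \<Longrightarrow> x \<notin> L \<Longrightarrow> F y x = 0"
  shows "continuous_map Y euclidean (\<lambda>y. \<integral>x. F y x \<partial>M)"
  using L supp by (intro continuous_map_integral[OF F] exI[of _ "topspace Y"] exI[of _ L]) auto

end

text \<open>The general Fubini theorem does not apply: the measures need not be \<open>\<sigma>\<close>-finite, and a
  continuous function on the product need not be measurable for the product \<open>\<sigma>\<close>-algebra.  For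
  compactly supported continuous functions it is replaced by uniform approximation: the tube lemma
  provides a finite Borel partition of the support in the first variable on whose parts the
  function is almost independent of the first variable.\<close>

lemma fubini_step_approximation:
  fixes F :: "'a \<Rightarrow> 'b \<Rightarrow> 'c::{banach, second_countable_topology}"
  assumes MX: "locally_finite_borel T M"
    and F: "continuous_map (prod_topology T Y) euclidean (\<lambda>(x, y). F x y)"
    and K: "compactin T K" and L: "compactin Y L" and e: "e > 0"
    and zero: "\<And>x y. x \<in> topspace T \<Longrightarrow> y \<in> topspace Y \<Longrightarrow> x \<notin> K \<or> y \<notin> L \<Longrightarrow> F x y = 0"
  obtains n :: nat and E and p where "\<forall>i. E i \<in> sets M \<and> E i \<subseteq> K" "\<forall>i<n. p i \<in> K"
    "\<forall>x\<in>topspace T. \<forall>y\<in>topspace Y.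
      norm (F x y - (\<Sum>i<n. indicator (E i) x *\<^sub>R F (p i) y)) \<le> e * indicator K x * indicator L y"
proof -
  interpret locally_finite_borel T M by (rule MX)
  have KX: "K \<subseteq> topspace T" using K by (rule compactin_subset_topspace)
  have "\<exists>U. openin T U \<and> x \<in> U \<and> (\<forall>z\<in>U. \<forall>y\<in>L. dist (F z y) (F x y) < e)" if "x \<in> K" for x
  proof -
    have "x \<in> topspace T" using that KX by blast
    then show ?thesis by (rule continuous_map_uniform_on_compact[OF F L _ e]) blast
  qed
  then obtain U where "\<forall>x\<in>K. openin T (U x) \<and> x \<in> U x \<and>
      (\<forall>z\<in>U x. \<forall>y\<in>L. dist (F z y) (F x y) < e)"
    by (metis bchoice)
  then have U: "\<And>x. x \<in> K \<Longrightarrow> openin T (U x)" "\<And>x. x \<in> K \<Longrightarrow> x \<in> U x"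
    "\<And>x z y. x \<in> K \<Longrightarrow> z \<in> U x \<Longrightarrow> y \<in> L \<Longrightarrow> dist (F z y) (F x y) < e"
    by simp_all
  have "\<exists>\<F>. finite \<F> \<and> \<F> \<subseteq> U ` K \<and> K \<subseteq> \<Union>\<F>"
    using U(1,2) by (intro compactinD[OF K]) auto
  then obtain D where D: "finite D" "D \<subseteq> K" "K \<subseteq> \<Union>(U ` D)"
    by (metis finite_subset_image)
  obtain p and n :: nat where p: "D = p ` {i. i < n}"
    using finite_imp_nat_seg_image_inj_on[OF D(1)] by blast
  then have pK: "p i \<in> K" if "i < n" for i using that D(2) by blast
  define A where "A = (\<lambda>i. if i < n then K \<inter> U (p i) else {})"
  define E where "E = disjointed A"
  have "range A \<subseteq> sets M"
    using compact_in_sets[OF K] open_in_sets[OF U(1)[OF pK]] by (auto simp: A_def)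
  then have "range E \<subseteq> sets M" unfolding E_def by (rule sets.range_disjointed_sets)
  then have E_sets: "E i \<in> sets M" for i by blast
  have E_A: "E i \<subseteq> A i" for i unfolding E_def by (rule disjointed_subset)
  have E_K: "E i \<subseteq> K" for i using E_A[of i] by (auto simp: A_def split: if_splits)
  have E_disj: "i = j" if "x \<in> E i" "x \<in> E j" for i j x
    using disjoint_family_disjointed[of A] that unfolding E_def disjoint_family_on_def by blast
  have UN: "(\<Union>i. E i) = K"
  proof -
    have "(\<Union>i. E i) = (\<Union>i. A i)" unfolding E_def by (rule UN_disjointed_eq)
    also have "\<dots> = K" using D(3) p by (auto simp: A_def split: if_splits)
    finally show ?thesis .
  qed
  show thesis
  proof (rule that[of E n p]; intro allI ballI impI)
    show "E i \<in> sets M \<and> E i \<subseteq> K" for i using E_sets E_K by simp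
    show "p i \<in> K" if "i < n" for i using pK that by simp
    fix x y assume x: "x \<in> topspace T" and y: "y \<in> topspace Y"
    show "norm (F x y - (\<Sum>i<n. indicator (E i) x *\<^sub>R F (p i) y)) \<le> e * indicator K x * indicator L y"
    proof (cases "x \<in> K")
      case False
      then have "x \<notin> E i" for i using E_K by blast
      then show ?thesis using zero[OF x y] False by simp
    next
      case True
      then obtain j where j: "x \<in> E j" using UN by blast
      then have jn: "j < n" and xU: "x \<in> U (p j)" using E_A[of j] by (auto simp: A_def split: if_splits)
      have "(\<Sum>i<n. indicator (E i) x *\<^sub>R F (p i) y) = (\<Sum>i<n. if i = j then F (p i) y else 0)"
        using j E_disj by (intro sum.cong) (auto simp: indicator_def)
      also have "\<dots> = F (p j) y" using jn by simp
      finally have *: "(\<Sum>i<n. indicator (E i) x *\<^sub>R F (p i) y) = F (p j) y" .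
      show ?thesis
      proof (cases "y \<in> L")
        case True
        then have "dist (F x y) (F (p j) y) < e" using U(3) pK[OF jn] xU by blast
        then show ?thesis using True \<open>x \<in> K\<close> * by (simp add: dist_norm)
      next
        case False
        moreover have "p j \<in> topspace T" using pK[OF jn] KX by blast
        ultimately show ?thesis using zero[OF x y] zero[OF _ y] * by simp
      qed
    qed
  qed
qed

text \<open>Both iterated integrals of the step approximation are the same finite sum, and each of them is
  within \<open>e\<close> times the product of the measures of \<open>K\<close> and \<open>L\<close> of the corresponding iterated integral of \<open>F\<close>.\<close>

lemma fubini_compact_support:
  fixes F :: "'a \<Rightarrow> 'b \<Rightarrow> 'c::{banach, second_countable_topology}"
  assumes MX: "locally_finite_borel T M" and MY: "locally_finite_borel Y M'"
    and F: "continuous_map (prod_topology T Y) euclidean (\<lambda>(x, y). F x y)"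
    and K: "compactin T K" and L: "compactin Y L"
    and zero: "\<And>x y. x \<in> topspace T \<Longrightarrow> y \<in> topspace Y \<Longrightarrow> x \<notin> K \<or> y \<notin> L \<Longrightarrow> F x y = 0"
  shows "(\<integral>x. (\<integral>y. F x y \<partial>M') \<partial>M) = (\<integral>y. (\<integral>x. F x y \<partial>M) \<partial>M')"
proof -
  interpret X: locally_finite_borel T M by (rule MX)
  interpret Y: locally_finite_borel Y M' by (rule MY)
  let ?lhs = "\<integral>x. (\<integral>y. F x y \<partial>M') \<partial>M" and ?rhs = "\<integral>y. (\<integral>x. F x y \<partial>M) \<partial>M'"
  note F' = continuous_map_prod_swap[OF F]
  have KX: "K \<subseteq> topspace T" using K by (rule compactin_subset_topspace)
  have int_y: "integrable M' (F x)" if "x \<in> topspace T" for x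
    using zero that
    by (intro Y.integrable_compact_support compact_supportI[OF continuous_map_prod_slice[OF F] L]) auto
  have int_x: "integrable M (\<lambda>x. F x y)" if "y \<in> topspace Y" for y
    using zero that
    by (intro X.integrable_compact_support compact_supportI[OF continuous_map_prod_slice[OF F'] K]) auto
  have "integral\<^sup>L M' (F x) = 0" if "x \<in> topspace T" "x \<notin> K" for x
  proof -
    have "integral\<^sup>L M' (F x) = integral\<^sup>L M' (\<lambda>y. 0)"
      using that zero by (intro Bochner_Integration.integral_cong) (auto simp: Y.space_M)
    then show ?thesis by simp
  qed
  then have int_xy: "integrable M (\<lambda>x. \<integral>y. F x y \<partial>M')"
    using zero by (intro X.integrable_compact_support
        compact_supportI[OF Y.continuous_map_integral_compact[OF F L] K]) auto
  have "integral\<^sup>L M (\<lambda>x. F x y) = 0" if "y \<in> topspace Y" "y \<notin> L" for y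
  proof -
    have "integral\<^sup>L M (\<lambda>x. F x y) = integral\<^sup>L M (\<lambda>x. 0)"
      using that zero by (intro Bochner_Integration.integral_cong) (auto simp: X.space_M)
    then show ?thesis by simp
  qed
  then have int_yx: "integrable M' (\<lambda>y. \<integral>x. F x y \<partial>M)"
    using zero by (intro Y.integrable_compact_support
        compact_supportI[OF X.continuous_map_integral_compact[OF F' K] L]) auto
  have "dist ?lhs ?rhs \<le> e * (2 * (measure M K * measure M' L))" if e: "e > 0" for e
  proof -
    obtain n :: nat and E p where E': "\<forall>i. E i \<in> sets M \<and> E i \<subseteq> K" and p: "\<forall>i<n. p i \<in> K"
      and approx: "\<forall>x\<in>topspace T. \<forall>y\<in>topspace Y.
        norm (F x y - (\<Sum>i<n. indicator (E i) x *\<^sub>R F (p i) y)) \<le> e * indicator K x * indicator L y"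
      by (rule fubini_step_approximation[OF MX F K L e zero])
    have E: "E i \<in> sets M" "E i \<subseteq> K" for i using E' by simp_all
    define S where "S = (\<lambda>x y. \<Sum>i<n. indicator (E i) x *\<^sub>R F (p i) y)"
    have pX: "p i \<in> topspace T" if "i < n" for i using p that KX by blast
    have E_fin: "emeasure M (E i) < \<infinity>" for i
      using emeasure_mono[OF E(2) X.compact_in_sets[OF K]] X.compact_finite[OF K]
      by (rule le_less_trans)
    have ind: "integrable M (\<lambda>x. indicator (E i) x *\<^sub>R c)" for i and c :: 'c
      using E(1) E_fin by simp
    have S_int_y: "integrable M' (S x)" for x
      unfolding S_def using int_y pX by (intro Bochner_Integration.integrable_sum integrable_scaleR_right) auto
    have S_int_x: "integrable M (\<lambda>x. S x y)" for y
      unfolding S_def by (intro Bochner_Integration.integrable_sum ind)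
    have Sy: "integral\<^sup>L M' (S x) = (\<Sum>i<n. indicator (E i) x *\<^sub>R integral\<^sup>L M' (F (p i)))" for x
      unfolding S_def using int_y pX by (subst Bochner_Integration.integral_sum) auto
    have Sx: "integral\<^sup>L M (\<lambda>x. S x y) = (\<Sum>i<n. measure M (E i) *\<^sub>R F (p i) y)" for y
    proof -
      have "integral\<^sup>L M (\<lambda>x. S x y) = (\<Sum>i<n. \<integral>x. indicator (E i) x *\<^sub>R F (p i) y \<partial>M)"
        unfolding S_def by (rule Bochner_Integration.integral_sum) (rule ind)
      also have "\<dots> = (\<Sum>i<n. measure M (E i) *\<^sub>R F (p i) y)"
        using E(1) E_fin sets.sets_into_space[OF E(1)] by (intro sum.cong) (simp_all add: Int_absorb2)
      finally show ?thesis .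
    qed
    have "integral\<^sup>L M (\<lambda>x. integral\<^sup>L M' (S x)) = (\<Sum>i<n. measure M (E i) *\<^sub>R integral\<^sup>L M' (F (p i)))"
      unfolding Sy using E(1) E_fin sets.sets_into_space[OF E(1)] ind
      by (subst Bochner_Integration.integral_sum) (simp_all add: Int_absorb2)
    also have "\<dots> = integral\<^sup>L M' (\<lambda>y. integral\<^sup>L M (\<lambda>x. S x y))"
      unfolding Sx using int_y pX by (subst Bochner_Integration.integral_sum) auto
    finally have S_eq: "integral\<^sup>L M (\<lambda>x. integral\<^sup>L M' (S x)) =
        integral\<^sup>L M' (\<lambda>y. integral\<^sup>L M (\<lambda>x. S x y))" .
    have S_xy: "integrable M (\<lambda>x. integral\<^sup>L M' (S x))"
      unfolding Sy by (intro Bochner_Integration.integrable_sum ind)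
    have S_yx: "integrable M' (\<lambda>y. integral\<^sup>L M (\<lambda>x. S x y))"
      unfolding Sx using int_y pX by (intro Bochner_Integration.integrable_sum integrable_scaleR_right) auto
    have 1: "dist ?lhs (integral\<^sup>L M (\<lambda>x. integral\<^sup>L M' (S x))) \<le> e * measure M' L * measure M K"
    proof -
      have "norm (\<integral>x. integral\<^sup>L M' (F x) - integral\<^sup>L M' (S x) \<partial>M) \<le> (e * measure M' L) * measure M K"
      proof (rule X.norm_integral_le_compact[OF _ K])
        fix x assume x: "x \<in> topspace T"
        have "norm (\<integral>y. F x y - S x y \<partial>M') \<le> (e * indicator K x) * measure M' L"
          using approx x int_y[OF x] S_int_y
          by (intro Y.norm_integral_le_compact[OF _ L]) (auto simp: S_def)
        then show "norm (integral\<^sup>L M' (F x) - integral\<^sup>L M' (S x)) \<le> e * measure M' L * indicator K x"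
          using int_y[OF x] S_int_y by (simp add: mult.commute mult.left_commute)
      qed (use int_xy S_xy in simp)
      then show ?thesis using int_xy S_xy by (simp add: dist_norm)
    qed
    have 2: "dist ?rhs (integral\<^sup>L M' (\<lambda>y. integral\<^sup>L M (\<lambda>x. S x y))) \<le> e * measure M K * measure M' L"
    proof -
      have "norm (\<integral>y. integral\<^sup>L M (\<lambda>x. F x y) - integral\<^sup>L M (\<lambda>x. S x y) \<partial>M') \<le> (e * measure M K) * measure M' L"
      proof (rule Y.norm_integral_le_compact[OF _ L])
        fix y assume y: "y \<in> topspace Y"
        have "norm (\<integral>x. F x y - S x y \<partial>M) \<le> (e * indicator L y) * measure M K"
          using approx y int_x[OF y] S_int_x
          by (intro X.norm_integral_le_compact[OF _ K]) (auto simp: S_def mult.commute mult.left_commute)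
        then show "norm (integral\<^sup>L M (\<lambda>x. F x y) - integral\<^sup>L M (\<lambda>x. S x y)) \<le> e * measure M K * indicator L y"
          using int_x[OF y] S_int_x by (simp add: mult.commute mult.left_commute)
      qed (use int_yx S_yx in simp)
      then show ?thesis using int_yx S_yx by (simp add: dist_norm)
    qed
    have "dist ?lhs ?rhs \<le> dist ?lhs (integral\<^sup>L M (\<lambda>x. integral\<^sup>L M' (S x))) +
        dist ?rhs (integral\<^sup>L M' (\<lambda>y. integral\<^sup>L M (\<lambda>x. S x y)))"
      unfolding S_eq by (rule dist_triangle2)
    with 1 2 show ?thesis by (simp add: algebra_simps)
  qed
  note le = this
  define C where "C = 2 * (measure M K * measure M' L)"
  have C: "C \<ge> 0" by (simp add: C_def)
  have "dist ?lhs ?rhs \<le> 0 + d" if d: "d > 0" for d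
  proof -
    have pos: "d / (C + 1) > 0" using d C by simp
    have "dist ?lhs ?rhs \<le> d / (C + 1) * C" using le[OF pos] by (simp only: C_def)
    also have "\<dots> \<le> d" using d C by (simp add: field_simps)
    finally show ?thesis by simp
  qed
  then have "dist ?lhs ?rhs \<le> 0" by (rule field_le_epsilon)
  then show ?thesis by simp
qed

section \<open>Locally compact groups\<close>

context topological_group
begin

lemma continuous_map_mult:
  assumes "continuous_map Z T f" "continuous_map Z T g"
  shows "continuous_map Z T (\<lambda>z. f z \<otimes> g z)"
proof -
  have "continuous_map Z (prod_topology T T) (\<lambda>z. (f z, g z))"
    by (rule continuous_map_pairedI[OF assms])
  from continuous_map_compose[OF this continuous_mult] show ?thesis by (simp add: o_def)
qed

lemma continuous_map_inverse:
  assumes "continuous_map Z T f"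
  shows "continuous_map Z T (\<lambda>z. inv (f z))"
  using continuous_map_compose[OF assms continuous_inv] by (simp add: o_def)

lemma continuous_map_left_translation: "a \<in> carrier G \<Longrightarrow> continuous_map T T (\<lambda>x. a \<otimes> x)"
  by (intro continuous_map_mult) (simp_all add: topspace_eq)

lemma continuous_map_right_translation: "a \<in> carrier G \<Longrightarrow> continuous_map T T (\<lambda>x. x \<otimes> a)"
  by (intro continuous_map_mult) (simp_all add: topspace_eq)

lemma openin_l_coset:
  assumes a: "a \<in> carrier G" and U: "openin T U"
  shows "openin T (a <# U)"
proof -
  have UG: "U \<subseteq> carrier G" using openin_subset[OF U] topspace_eq by simp
  have "openin T {x \<in> topspace T. inv a \<otimes> x \<in> U}"
    using continuous_map_left_translation[of "inv a"] a U by (intro openin_continuous_map_preimage) auto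
  moreover have "{x \<in> topspace T. inv a \<otimes> x \<in> U} = a <# U"
  proof
    show "{x \<in> topspace T. inv a \<otimes> x \<in> U} \<subseteq> a <# U"
    proof
      fix x assume "x \<in> {x \<in> topspace T. inv a \<otimes> x \<in> U}"
      then have "inv a \<otimes> x \<in> U" "x = a \<otimes> (inv a \<otimes> x)"
        using a by (simp_all add: topspace_eq flip: m_assoc)
      then show "x \<in> a <# U" unfolding l_coset_def by blast
    qed
    show "a <# U \<subseteq> {x \<in> topspace T. inv a \<otimes> x \<in> U}"
      using a UG by (auto simp: l_coset_def topspace_eq subset_iff simp flip: m_assoc)
  qed
  ultimately show ?thesis by simp
qed

lemma r_coset_eq_preimage:
  assumes a: "a \<in> carrier G" and E: "E \<subseteq> carrier G"
  shows "E #> a = {x \<in> carrier G. x \<otimes> inv a \<in> E}"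
proof
  show "E #> a \<subseteq> {x \<in> carrier G. x \<otimes> inv a \<in> E}"
    using a E by (auto simp: r_coset_def m_assoc subset_iff)
  show "{x \<in> carrier G. x \<otimes> inv a \<in> E} \<subseteq> E #> a"
  proof
    fix x assume "x \<in> {x \<in> carrier G. x \<otimes> inv a \<in> E}"
    then have "x \<otimes> inv a \<in> E" "x = (x \<otimes> inv a) \<otimes> a"
      using a by (simp_all add: m_assoc)
    then show "x \<in> E #> a" unfolding r_coset_def by blast
  qed
qed

lemma openin_r_coset:
  assumes a: "a \<in> carrier G" and U: "openin T U"
  shows "openin T (U #> a)"
proof -
  have "openin T {x \<in> topspace T. x \<otimes> inv a \<in> U}"
    using continuous_map_right_translation[of "inv a"] a U by (intro openin_continuous_map_preimage) auto
  then show ?thesis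
    using r_coset_eq_preimage[OF a] openin_subset[OF U] topspace_eq by simp
qed

lemma compactin_mult:
  assumes "compactin T K" "compactin T L"
  shows "compactin T ((\<lambda>(x, y). x \<otimes> y) ` (K \<times> L))"
  using assms by (intro image_compactin[OF _ continuous_mult]) (simp add: compactin_Times)

lemma compactin_inv: "compactin T K \<Longrightarrow> compactin T ((\<lambda>x. inv x) ` K)"
  by (rule image_compactin[OF _ continuous_inv])

lemma r_coset_r_coset_inv:
  assumes "a \<in> carrier G" "E \<subseteq> carrier G"
  shows "(E #> a) #> inv a = E"
  using assms by (simp add: coset_mult_assoc)

lemma compactin_r_coset: "a \<in> carrier G \<Longrightarrow> compactin T K \<Longrightarrow> compactin T (K #> a)"
  using image_compactin[OF _ continuous_map_right_translation, of K a]
  by (simp add: r_coset_def UNION_singleton_eq_range)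

end

context locally_compact_group
begin

text \<open>Local compactness is what makes Urysohn functions have compact support.\<close>

lemma urysohn_compact_support:
  assumes K: "compactin T K" and U: "openin T U" and "K \<subseteq> U"
  obtains f :: "'a \<Rightarrow> real" and C where "continuous_map T euclidean f" "compactin T C" "C \<subseteq> U"
    "\<forall>x\<in>topspace T. 0 \<le> f x \<and> f x \<le> 1" "\<forall>x\<in>K. f x = 1" "\<forall>x\<in>topspace T - C. f x = 0"
proof -
  have reg: "regular_space T"
    using locally_compact Hausdorff locally_compact_Hausdorff_imp_regular_space by blast
  have creg: "completely_regular_space T"
    using completely_regular_eq_regular_space[OF locally_compact] reg by blast
  obtain V L where V: "openin T V" "K \<subseteq> V" and L: "compactin T L" "closedin T L" "V \<subseteq> L"
    using locally_compact_space_compact_closed_compact[of T] Hausdorff locally_compact K by blast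
  have "closedin T (topspace T - (U \<inter> V))" using U V by blast
  moreover have "disjnt K (topspace T - (U \<inter> V))" using assms V by (auto simp: disjnt_def)
  ultimately obtain f where f: "continuous_map T (subtopology euclidean {0..1::real}) f"
    "f ` (topspace T - (U \<inter> V)) \<subseteq> {0}" "f ` K \<subseteq> {1}"
    using Urysohn_completely_regular_compact_closed[of 0 "1::real" T K] creg K by auto
  have fc: "continuous_map T euclidean f" and f01: "f ` topspace T \<subseteq> {0..1}"
    using f(1) by (auto simp: continuous_map_in_subtopology)
  \<comment> \<open>The closed set where \<open>f \<ge> 1/2\<close> lies in \<open>U \<inter> V\<close>, so that cutting \<open>f\<close> off below \<open>1/2\<close> gives
    a support inside \<open>U\<close>, and not merely inside the closure of \<open>U\<close>.\<close>
  define g where "g = (\<lambda>x. max 0 (2 * f x - 1))"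
  define C where "C = {x \<in> topspace T. f x \<in> {1/2..}}"
  have C_UV: "C \<subseteq> U \<inter> V"
  proof
    fix x assume x: "x \<in> C"
    show "x \<in> U \<inter> V"
    proof (rule ccontr)
      assume "x \<notin> U \<inter> V"
      then have "f x = 0" using f(2) x unfolding C_def by blast
      then show False using x by (simp add: C_def)
    qed
  qed
  have "closedin T C"
    unfolding C_def by (rule closedin_continuous_map_preimage[OF fc]) simp
  then have "compactin T C"
    using closed_compactin[OF L(1)] C_UV L(3) by blast
  moreover have "continuous_map T euclidean g"
    unfolding g_def by (rule continuous_map_euclidean_compose[OF fc]) (intro continuous_intros)
  moreover have "\<forall>x\<in>topspace T. 0 \<le> g x \<and> g x \<le> 1" using f01 by (auto simp: g_def)
  moreover have "\<forall>x\<in>K. g x = 1" using f(3) by (auto simp: g_def)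
  moreover have "\<forall>x\<in>topspace T - C. g x = 0" by (auto simp: g_def C_def)
  ultimately show thesis using C_UV by (intro that[of g C]) auto
qed

end

section \<open>Haar measure and the modular function\<close>

locale haar_group = locally_compact_group +
  fixes M :: "'a measure"
  assumes haar: "left_haar_measure G T M"
begin

sublocale locally_finite_borel T M
  using haar Hausdorff by unfold_locales (auto simp: left_haar_measure_def)

lemma space_carrier: "space M = carrier G"
  by (simp add: space_M topspace_eq)

lemma sets_subset: "E \<in> sets M \<Longrightarrow> E \<subseteq> carrier G"
  using sets.sets_into_space space_carrier by blast

lemma outer_regular:
  "E \<in> sets M \<Longrightarrow> emeasure M E = (INF U\<in>{U. openin T U \<and> E \<subseteq> U}. emeasure M U)"
  using haar unfolding left_haar_measure_def by blast

lemma inner_regular: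
  "openin T U \<Longrightarrow> emeasure M U = (SUP K\<in>{K. compactin T K \<and> K \<subseteq> U}. emeasure M K)"
  using haar unfolding left_haar_measure_def by blast

lemma left_invariant: "a \<in> carrier G \<Longrightarrow> E \<in> sets M \<Longrightarrow> emeasure M (a <# E) = emeasure M E"
  using haar unfolding left_haar_measure_def by blast

lemma distr_left_translation:
  assumes a: "a \<in> carrier G"
  shows "distr M M (\<lambda>x. a \<otimes> x) = M"
proof (rule measure_eqI)
  fix E assume "E \<in> sets (distr M M (\<lambda>x. a \<otimes> x))"
  then have E: "E \<in> sets M" by simp
  have "(\<lambda>x. a \<otimes> x) -` E \<inter> space M = inv a <# E"
  proof
    show "(\<lambda>x. a \<otimes> x) -` E \<inter> space M \<subseteq> inv a <# E"
    proof
      fix x assume "x \<in> (\<lambda>x. a \<otimes> x) -` E \<inter> space M"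
      then have "a \<otimes> x \<in> E" "x = inv a \<otimes> (a \<otimes> x)"
        using a by (simp_all add: space_carrier flip: m_assoc)
      then show "x \<in> inv a <# E" unfolding l_coset_def by blast
    qed
    show "inv a <# E \<subseteq> (\<lambda>x. a \<otimes> x) -` E \<inter> space M"
      using a sets_subset[OF E] by (auto simp: l_coset_def space_carrier subset_iff simp flip: m_assoc)
  qed
  then show "emeasure (distr M M (\<lambda>x. a \<otimes> x)) E = emeasure M E"
    using continuous_measurable[OF continuous_map_left_translation[OF a]] E a
    by (simp add: emeasure_distr left_invariant)
qed simp

lemma integral_left_translation:
  fixes f :: "'a \<Rightarrow> 'v::{banach, second_countable_topology}"
  assumes a: "a \<in> carrier G" and f: "continuous_map T euclidean f"
  shows "(\<integral>x. f (a \<otimes> x) \<partial>M) = integral\<^sup>L M f"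
  using integral_distr[OF continuous_measurable[OF continuous_map_left_translation[OF a]]
      continuous_borel_measurable[OF f]] distr_left_translation[OF a] by simp

lemma exists_compact_pos: "\<exists>K. compactin T K \<and> emeasure M K > 0"
proof (rule ccontr)
  assume "\<not> ?thesis"
  then have null: "emeasure M K = 0" if "compactin T K" for K
    using that by simp
  have "emeasure M (topspace T) = (SUP K\<in>{K. compactin T K \<and> K \<subseteq> topspace T}. emeasure M K)"
    by (rule inner_regular) simp
  also have "\<dots> \<le> 0" using null by (intro SUP_least) simp
  finally have "emeasure M (space M) = 0" by (simp add: space_M)
  then show False using haar by (simp add: left_haar_measure_def)
qed

text \<open>Finitely many translates of a nonempty open set cover a compact set of positive measure.\<close>

lemma emeasure_open_pos:
  assumes U: "openin T U" and ne: "U \<noteq> {}"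
  shows "emeasure M U > 0"
proof (rule ccontr)
  assume "\<not> emeasure M U > 0"
  then have null: "emeasure M U = 0" by simp
  obtain u where u: "u \<in> U" using ne by blast
  have UG: "U \<subseteq> carrier G" using openin_subset[OF U] topspace_eq by simp
  obtain K where K: "compactin T K" "emeasure M K > 0" using exists_compact_pos by blast
  have KG: "K \<subseteq> carrier G" using compactin_subset_topspace[OF K(1)] topspace_eq by simp
  define V where "V = (\<lambda>x. (x \<otimes> inv u) <# U)"
  have V_open: "openin T (V x)" if "x \<in> K" for x
    unfolding V_def using that KG u UG by (intro openin_l_coset[OF _ U]) auto
  have V_mem: "x \<in> V x" if "x \<in> K" for x
  proof -
    have "x = (x \<otimes> inv u) \<otimes> u" using that KG u UG by (simp add: m_assoc subset_iff)
    then show ?thesis unfolding V_def l_coset_def using u by blast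
  qed
  have "\<exists>\<F>. finite \<F> \<and> \<F> \<subseteq> V ` K \<and> K \<subseteq> \<Union>\<F>"
    using V_open V_mem by (intro compactinD[OF K(1)]) auto
  then obtain D where D: "finite D" "D \<subseteq> K" "K \<subseteq> \<Union>(V ` D)"
    by (metis finite_subset_image)
  have V_null: "emeasure M (V x) = 0" if "x \<in> D" for x
  proof -
    have "x \<otimes> inv u \<in> carrier G" using that D(2) KG u UG by blast
    then show ?thesis using null left_invariant[OF _ open_in_sets[OF U]] by (simp add: V_def)
  qed
  have VD: "V ` D \<subseteq> sets M" using V_open D(2) open_in_sets by blast
  have "emeasure M K \<le> emeasure M (\<Union>(V ` D))"
    using D VD by (intro emeasure_mono sets.finite_UN) auto
  also have "\<dots> \<le> (\<Sum>x\<in>D. emeasure M (V x))"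
    using D(1) VD by (rule emeasure_subadditive_finite)
  also have "\<dots> = 0" using V_null by simp
  finally show False using K(2) by simp
qed

lemma integral_pos:
  fixes f :: "'a \<Rightarrow> real"
  assumes f: "compact_support T f" and nonneg: "\<And>x. x \<in> carrier G \<Longrightarrow> 0 \<le> f x"
    and a: "a \<in> carrier G" "f a > 0"
  shows "integral\<^sup>L M f > 0"
proof -
  obtain K where fc: "continuous_map T euclidean f" and K: "compactin T K"
    and zero: "\<forall>x\<in>topspace T - K. f x = 0"
    using f by (rule compact_supportE)
  define U where "U = {x \<in> topspace T. f x \<in> {f a / 2<..}}"
  have U: "openin T U" unfolding U_def by (rule openin_continuous_map_preimage[OF fc]) simp
  have "a \<in> U" using a by (simp add: U_def topspace_eq)
  then have pos: "emeasure M U > 0" using emeasure_open_pos[OF U] by blast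
  have UK: "U \<subseteq> K" using zero a(2) by (force simp: U_def)
  have "emeasure M U \<le> emeasure M K" by (rule emeasure_mono[OF UK compact_in_sets[OF K]])
  then have fin: "emeasure M U < \<infinity>" using compact_finite[OF K] by (rule le_less_trans)
  have "0 < f a / 2 * measure M U"
    using pos fin a(2) by (simp add: emeasure_eq_ennreal_measure less_top)
  also have "\<dots> = (\<integral>x. f a / 2 * indicator U x \<partial>M)"
    using open_in_sets[OF U] sets.sets_into_space by (simp add: Int_absorb2)
  also have "\<dots> \<le> integral\<^sup>L M f"
  proof (rule integral_mono)
    show "integrable M (\<lambda>x. f a / 2 * indicator U x)"
      using open_in_sets[OF U] fin by simp
    show "f a / 2 * indicator U x \<le> f x" if "x \<in> space M" for x
      using that nonneg by (cases "x \<in> U") (auto simp: U_def space_carrier)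
  qed (rule integrable_compact_support[OF f])
  finally show ?thesis .
qed

lemma exists_bump:
  assumes a: "a \<in> carrier G"
  obtains f :: "'a \<Rightarrow> real" where "compact_support T f" "\<forall>x\<in>carrier G. 0 \<le> f x" "f a = 1"
proof -
  have "compactin T {a}" "{a} \<subseteq> topspace T" using a by (simp_all add: topspace_eq)
  then obtain f :: "'a \<Rightarrow> real" and C where "continuous_map T euclidean f" "compactin T C" "C \<subseteq> topspace T"
    "\<forall>x\<in>topspace T. 0 \<le> f x \<and> f x \<le> 1" "\<forall>x\<in>{a}. f x = 1" "\<forall>x\<in>topspace T - C. f x = 0"
    by (rule urysohn_compact_support[OF _ openin_topspace])
  then show thesis by (intro that[of f]) (auto simp: compact_support_def topspace_eq)
qed

lemma positive_bump:
  obtains b :: "'a \<Rightarrow> real" where "compact_support T b" "\<forall>x\<in>carrier G. 0 \<le> b x" "b \<one> = 1"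
    "integral\<^sup>L M b > 0"
proof -
  obtain b :: "'a \<Rightarrow> real" where b: "compact_support T b" "\<forall>x\<in>carrier G. 0 \<le> b x" "b \<one> = 1"
    using one_closed by (rule exists_bump)
  have pos: "integral\<^sup>L M b > 0"
    using b by (intro integral_pos[OF b(1) _ one_closed]) simp_all
  with b show thesis by (intro that)
qed

lemma compact_support_right_translation:
  assumes f: "compact_support T f" and a: "a \<in> carrier G"
  shows "compact_support T (\<lambda>x. f (x \<otimes> a))"
proof -
  obtain K where fc: "continuous_map T euclidean f" and K: "compactin T K"
    and zero: "\<forall>x\<in>topspace T - K. f x = 0"
    using f by (rule compact_supportE)
  have "continuous_map T euclidean (\<lambda>x. f (x \<otimes> a))"
    using continuous_map_compose[OF continuous_map_right_translation[OF a] fc] by (simp add: o_def)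
  moreover have "compactin T (K #> inv a)" using K a by (intro compactin_r_coset) auto
  moreover have "f (x \<otimes> a) = 0" if "x \<in> topspace T" "x \<notin> K #> inv a" for x
  proof -
    have "x \<otimes> a \<notin> K"
      using that r_coset_eq_preimage[of "inv a" K] compactin_subset_topspace[OF K] a
      by (simp add: topspace_eq)
    then show ?thesis using zero that a by (simp add: topspace_eq)
  qed
  ultimately show ?thesis by (rule compact_supportI)
qed

lemma compact_support_mult_left:
  fixes f g :: "'a \<Rightarrow> real"
  assumes g: "continuous_map T euclidean g" and f: "compact_support T f"
  shows "compact_support T (\<lambda>x. g x * f x)"
proof -
  obtain K where fc: "continuous_map T euclidean f" and K: "compactin T K"
    and zero: "\<forall>x\<in>topspace T - K. f x = 0"
    using f by (rule compact_supportE)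
  have "continuous_map T euclidean (\<lambda>x. g x * f x)"
    by (rule continuous_map_euclidean_compose2[OF g fc]) (intro continuous_intros)
  then show ?thesis by (rule compact_supportI[OF _ K]) (use zero in simp)
qed

lemma compact_support_inv:
  assumes f: "compact_support T f"
  shows "compact_support T (\<lambda>x. f (inv x))"
proof -
  obtain K where fc: "continuous_map T euclidean f" and K: "compactin T K"
    and zero: "\<forall>x\<in>topspace T - K. f x = 0"
    using f by (rule compact_supportE)
  have "continuous_map T euclidean (\<lambda>x. f (inv x))"
    using continuous_map_compose[OF continuous_inv fc] by (simp add: o_def)
  then show ?thesis
  proof (rule compact_supportI[OF _ compactin_inv[OF K]])
    fix x assume x: "x \<in> topspace T" "x \<notin> (\<lambda>x. inv x) ` K"
    have "inv x \<notin> K"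
    proof
      assume "inv x \<in> K"
      then have "inv (inv x) \<in> (\<lambda>x. inv x) ` K" by blast
      then show False using x by (simp add: topspace_eq)
    qed
    then show "f (inv x) = 0" using zero x by (simp add: topspace_eq)
  qed
qed

text \<open>If \<open>z\<close> stays in a compact neighbourhood \<open>C\<close> and \<open>f\<close> is supported in \<open>K\<close>, then
  \<open>t \<mapsto> f (t \<otimes> z)\<close> is supported in the fixed compact set \<open>K (inv C)\<close>.\<close>

lemma continuous_right_average:
  fixes f :: "'a \<Rightarrow> real"
  assumes f: "compact_support T f"
  shows "continuous_map T euclidean (\<lambda>s. \<integral>t. f (t \<otimes> s) \<partial>M)"
proof -
  obtain K where fc: "continuous_map T euclidean f" and K: "compactin T K"
    and zero: "\<forall>x\<in>topspace T - K. f x = 0"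
    using f by (rule compact_supportE)
  have "continuous_map (prod_topology T T) T (\<lambda>z. snd z \<otimes> fst z)"
    by (intro continuous_map_mult continuous_map_fst continuous_map_snd)
  from continuous_map_compose[OF this fc]
  have "continuous_map (prod_topology T T) euclidean (\<lambda>(s, t). f (t \<otimes> s))"
    by (simp add: o_def case_prod_unfold)
  then show ?thesis
  proof (rule continuous_map_integral)
    fix s assume s: "s \<in> topspace T"
    obtain U C where U: "openin T U" "s \<in> U" and C: "compactin T C" "U \<subseteq> C"
      using locally_compact s unfolding locally_compact_space_def by blast
    define L where "L = (\<lambda>(x, y). x \<otimes> y) ` (K \<times> (\<lambda>x. inv x) ` C)"
    have "compactin T L" unfolding L_def by (intro compactin_mult K compactin_inv C)
    moreover have "f (t \<otimes> z) = 0" if z: "z \<in> U" and t: "t \<in> topspace T - L" for z t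
    proof -
      have zG: "z \<in> carrier G" using z openin_subset[OF U(1)] topspace_eq by blast
      have tG: "t \<in> carrier G" using t topspace_eq by blast
      have "t \<otimes> z \<notin> K"
      proof
        assume "t \<otimes> z \<in> K"
        moreover have "inv z \<in> (\<lambda>x. inv x) ` C" using z C(2) by blast
        ultimately have "(t \<otimes> z) \<otimes> inv z \<in> L" unfolding L_def by force
        then show False using t tG zG by (simp add: m_assoc)
      qed
      then show ?thesis using zero tG zG by (simp add: topspace_eq)
    qed
    ultimately show "\<exists>U L. openin T U \<and> s \<in> U \<and> compactin T L \<and>
        (\<forall>z\<in>U. \<forall>t\<in>topspace T - L. f (t \<otimes> z) = 0)"
      using U by blast
  qed
qed

text \<open>Expand the product of the two integrals as a double integral, translate the inner variable by
  left invariance, exchange the integrals, and translate back.  This single computation yields the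
  existence of the modular function, its continuity and the inversion formula.\<close>

lemma integral_mult_integral:
  fixes f g :: "'a \<Rightarrow> real"
  assumes f: "compact_support T f" and g: "compact_support T g"
  shows "integral\<^sup>L M f * integral\<^sup>L M g = (\<integral>s. (\<integral>t. f (t \<otimes> s) \<partial>M) * g (inv s) \<partial>M)"
proof -
  obtain K where fc: "continuous_map T euclidean f" and K: "compactin T K"
    and fz: "\<forall>x\<in>topspace T - K. f x = 0"
    using f by (rule compact_supportE)
  obtain L where gc: "continuous_map T euclidean g" and L: "compactin T L"
    and gz: "\<forall>x\<in>topspace T - L. g x = 0"
    using g by (rule compact_supportE)
  have KG: "K \<subseteq> carrier G" and LG: "L \<subseteq> carrier G"
    using compactin_subset_topspace K L topspace_eq by blast+
  define KL where "KL = (\<lambda>(x, y). x \<otimes> y) ` (K \<times> L)"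
  have KL: "compactin T KL" unfolding KL_def by (rule compactin_mult[OF K L])
  have lfb: "locally_finite_borel T M" by (rule locally_finite_borel_axioms)
  have c1: "continuous_map (prod_topology T T) euclidean (\<lambda>(s, t). f s * g (inv s \<otimes> t))"
  proof -
    have "continuous_map (prod_topology T T) T (\<lambda>z. inv (fst z) \<otimes> snd z)"
      by (intro continuous_map_mult continuous_map_inverse continuous_map_fst continuous_map_snd)
    from continuous_map_compose[OF this gc]
    have "continuous_map (prod_topology T T) euclidean (\<lambda>z. g (inv (fst z) \<otimes> snd z))"
      by (simp add: o_def)
    moreover have "continuous_map (prod_topology T T) euclidean (\<lambda>z. f (fst z))"
      using continuous_map_compose[OF continuous_map_fst fc, of T] by (simp add: o_def)
    ultimately have "continuous_map (prod_topology T T) euclidean (\<lambda>z. f (fst z) * g (inv (fst z) \<otimes> snd z))"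
      by (intro continuous_map_euclidean_compose2[where h = "(*)"]) (auto intro!: continuous_intros)
    then show ?thesis by (simp add: case_prod_unfold)
  qed
  have z1: "f s * g (inv s \<otimes> t) = 0"
    if "s \<in> topspace T" "t \<in> topspace T" "s \<notin> K \<or> t \<notin> KL" for s t
  proof (cases "s \<in> K")
    case True
    have "inv s \<otimes> t \<notin> L"
    proof
      assume "inv s \<otimes> t \<in> L"
      then have "s \<otimes> (inv s \<otimes> t) \<in> KL" unfolding KL_def using True by force
      then show False using that True by (simp add: topspace_eq flip: m_assoc)
    qed
    then show ?thesis using gz that by (simp add: topspace_eq)
  qed (use fz that in simp)
  have c2: "continuous_map (prod_topology T T) euclidean (\<lambda>(t, s). f (t \<otimes> s) * g (inv s))"
  proof -
    have "continuous_map (prod_topology T T) T (\<lambda>z. fst z \<otimes> snd z)"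
      by (intro continuous_map_mult continuous_map_fst continuous_map_snd)
    from continuous_map_compose[OF this fc]
    have "continuous_map (prod_topology T T) euclidean (\<lambda>z. f (fst z \<otimes> snd z))"
      by (simp add: o_def)
    moreover have "continuous_map (prod_topology T T) T (\<lambda>z. inv (snd z))"
      by (intro continuous_map_inverse continuous_map_snd)
    from continuous_map_compose[OF this gc]
    have "continuous_map (prod_topology T T) euclidean (\<lambda>z. g (inv (snd z)))"
      by (simp add: o_def)
    ultimately have "continuous_map (prod_topology T T) euclidean (\<lambda>z. f (fst z \<otimes> snd z) * g (inv (snd z)))"
      by (intro continuous_map_euclidean_compose2[where h = "(*)"]) (auto intro!: continuous_intros)
    then show ?thesis by (simp add: case_prod_unfold)
  qed
  have z2: "f (t \<otimes> s) * g (inv s) = 0"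
    if "t \<in> topspace T" "s \<in> topspace T" "t \<notin> KL \<or> s \<notin> (\<lambda>x. inv x) ` L" for s t
  proof (cases "inv s \<in> L")
    case True
    then have "inv (inv s) \<in> (\<lambda>x. inv x) ` L" by blast
    then have "t \<notin> KL" using that by (simp add: topspace_eq)
    have "t \<otimes> s \<notin> K"
    proof
      assume "t \<otimes> s \<in> K"
      then have "(t \<otimes> s) \<otimes> inv s \<in> KL" unfolding KL_def using True by force
      then show False using that \<open>t \<notin> KL\<close> by (simp add: topspace_eq m_assoc)
    qed
    then show ?thesis using fz that by (simp add: topspace_eq)
  qed (use gz that in \<open>simp add: topspace_eq\<close>)
  have "integral\<^sup>L M f * integral\<^sup>L M g = (\<integral>s. f s * integral\<^sup>L M g \<partial>M)" by simp
  also have "\<dots> = (\<integral>s. (\<integral>t. f s * g (inv s \<otimes> t) \<partial>M) \<partial>M)"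
  proof (rule Bochner_Integration.integral_cong[OF refl])
    fix s assume "s \<in> space M"
    then show "f s * integral\<^sup>L M g = (\<integral>t. f s * g (inv s \<otimes> t) \<partial>M)"
      using integral_left_translation[OF _ gc, of "inv s"] by (simp add: space_carrier)
  qed
  also have "\<dots> = (\<integral>t. (\<integral>s. f s * g (inv s \<otimes> t) \<partial>M) \<partial>M)"
    by (rule fubini_compact_support[OF lfb lfb c1 K KL z1])
  also have "\<dots> = (\<integral>t. (\<integral>s. f (t \<otimes> s) * g (inv s) \<partial>M) \<partial>M)"
  proof (rule Bochner_Integration.integral_cong[OF refl])
    fix t assume "t \<in> space M"
    then have t: "t \<in> carrier G" by (simp add: space_carrier)
    have "continuous_map T euclidean (\<lambda>s. f s * g (inv s \<otimes> t))"
      using continuous_map_prod_slice[OF continuous_map_prod_swap[OF c1]] t by (simp add: topspace_eq)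
    from integral_left_translation[OF t this]
    have "(\<integral>s. f s * g (inv s \<otimes> t) \<partial>M) = (\<integral>s. f (t \<otimes> s) * g (inv (t \<otimes> s) \<otimes> t) \<partial>M)" by simp
    also have "\<dots> = (\<integral>s. f (t \<otimes> s) * g (inv s) \<partial>M)"
      using t by (intro Bochner_Integration.integral_cong)
        (simp_all add: space_carrier inv_mult_group m_assoc)
    finally show "(\<integral>s. f s * g (inv s \<otimes> t) \<partial>M) = (\<integral>s. f (t \<otimes> s) * g (inv s) \<partial>M)" .
  qed
  also have "\<dots> = (\<integral>s. (\<integral>t. f (t \<otimes> s) * g (inv s) \<partial>M) \<partial>M)"
    by (rule fubini_compact_support[OF lfb lfb c2 KL compactin_inv[OF L] z2])
  also have "\<dots> = (\<integral>s. (\<integral>t. f (t \<otimes> s) \<partial>M) * g (inv s) \<partial>M)" by simp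
  finally show ?thesis .
qed

text \<open>The previous identity determines \<open>s \<mapsto> \<integral>f (t \<otimes> s) dt\<close> up to the scalar \<open>\<integral>f\<close>: testing against
  \<open>g (inv s) = h s * k s\<close> shows that the difference \<open>h\<close> of two normalized averages vanishes.\<close>

lemma right_average_proportional:
  fixes f g :: "'a \<Rightarrow> real"
  assumes f: "compact_support T f" and g: "compact_support T g" and a: "a \<in> carrier G"
  shows "(\<integral>t. f (t \<otimes> a) \<partial>M) * integral\<^sup>L M g = integral\<^sup>L M f * (\<integral>t. g (t \<otimes> a) \<partial>M)"
proof (rule ccontr)
  define A where "A = (\<lambda>(f :: 'a \<Rightarrow> real) s. \<integral>t. f (t \<otimes> s) \<partial>M)"
  define h where "h = (\<lambda>s. A f s * integral\<^sup>L M g - A g s * integral\<^sup>L M f)"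
  have Af: "continuous_map T euclidean (A f)" and Ag: "continuous_map T euclidean (A g)"
    unfolding A_def by (rule continuous_right_average[OF f], rule continuous_right_average[OF g])
  have h: "continuous_map T euclidean h"
    unfolding h_def
    by (rule continuous_map_euclidean_compose2[OF Af Ag,
          where h = "\<lambda>x y. x * integral\<^sup>L M g - y * integral\<^sup>L M f"]) (intro continuous_intros)
  assume "\<not> ?thesis"
  then have ha: "h a \<noteq> 0" by (simp add: h_def A_def mult.commute)
  obtain k :: "'a \<Rightarrow> real" where k: "compact_support T k" "\<forall>x\<in>carrier G. 0 \<le> k x" "k a = 1"
    using a by (rule exists_bump)
  have hk: "compact_support T (\<lambda>x. h x * k x)" by (rule compact_support_mult_left[OF h k(1)])
  have hhk: "compact_support T (\<lambda>x. h x * (h x * k x))" by (rule compact_support_mult_left[OF h hk])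
  have Afhk: "compact_support T (\<lambda>x. A f x * (h x * k x))" by (rule compact_support_mult_left[OF Af hk])
  have Aghk: "compact_support T (\<lambda>x. A g x * (h x * k x))" by (rule compact_support_mult_left[OF Ag hk])
  define q where "q = (\<lambda>x. h (inv x) * k (inv x))"
  have q: "compact_support T q" unfolding q_def by (rule compact_support_inv[OF hk])
  have A_eq: "integral\<^sup>L M e * integral\<^sup>L M q = (\<integral>s. A e s * (h s * k s) \<partial>M)"
    if e: "compact_support T e" for e
  proof -
    have "integral\<^sup>L M e * integral\<^sup>L M q = (\<integral>s. A e s * q (inv s) \<partial>M)"
      unfolding A_def by (rule integral_mult_integral[OF e q])
    also have "\<dots> = (\<integral>s. A e s * (h s * k s) \<partial>M)"
      by (intro Bochner_Integration.integral_cong) (simp_all add: q_def space_carrier)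
    finally show ?thesis .
  qed
  have "(\<integral>s. h s * (h s * k s) \<partial>M) =
      (\<integral>s. integral\<^sup>L M g * (A f s * (h s * k s)) - integral\<^sup>L M f * (A g s * (h s * k s)) \<partial>M)"
    by (simp add: h_def algebra_simps)
  also have "\<dots> = integral\<^sup>L M g * (\<integral>s. A f s * (h s * k s) \<partial>M) -
      integral\<^sup>L M f * (\<integral>s. A g s * (h s * k s) \<partial>M)"
    using integrable_compact_support[OF Afhk] integrable_compact_support[OF Aghk] by simp
  also have "\<dots> = 0" unfolding A_eq[OF f, symmetric] A_eq[OF g, symmetric] by simp
  finally have "(\<integral>s. h s * (h s * k s) \<partial>M) = 0" .
  moreover have "(\<integral>s. h s * (h s * k s) \<partial>M) > 0"
  proof (rule integral_pos[OF hhk _ a])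
    show "0 \<le> h x * (h x * k x)" if "x \<in> carrier G" for x
      using k(2) that by (simp flip: mult.assoc)
    show "0 < h a * (h a * k a)"
    proof -
      have "0 < h a * h a" using ha by (metis not_real_square_gt_zero)
      then show ?thesis using k(3) by simp
    qed
  qed
  ultimately show False by simp
qed

text \<open>The factor by which a right translation of the argument scales the integral; it is the
  modular function at the inverse.\<close>

definition right_factor :: "'a \<Rightarrow> real" where
  "right_factor s = (let f = SOME f. compact_support T f \<and> integral\<^sup>L M f = 1
     in \<integral>t. f (t \<otimes> s) \<partial>M)"

text \<open>Compare \<open>f\<close> with the fixed function that defines \<open>right_factor\<close>; such a function of integral one
  exists because nonnegative bumps have positive integral.\<close>

lemma right_average:
  fixes f :: "'a \<Rightarrow> real"
  assumes f: "compact_support T f" and s: "s \<in> carrier G"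
  shows "(\<integral>t. f (t \<otimes> s) \<partial>M) = right_factor s * integral\<^sup>L M f"
proof -
  obtain b :: "'a \<Rightarrow> real" where b: "compact_support T b" "\<forall>x\<in>carrier G. 0 \<le> b x" "b \<one> = 1"
    and pos: "integral\<^sup>L M b > 0" by (rule positive_bump)
  have "continuous_map T euclidean (\<lambda>_. inverse (integral\<^sup>L M b))" by simp
  then have "compact_support T (\<lambda>x. inverse (integral\<^sup>L M b) * b x)"
    using b(1) by (rule compact_support_mult_left)
  moreover have "(\<integral>x. inverse (integral\<^sup>L M b) * b x \<partial>M) = 1" using pos by simp
  ultimately have ex: "\<exists>f :: 'a \<Rightarrow> real. compact_support T f \<and> integral\<^sup>L M f = 1" by blast
  define e :: "'a \<Rightarrow> real" where "e = (SOME f. compact_support T f \<and> integral\<^sup>L M f = 1)"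
  have e: "compact_support T e" "integral\<^sup>L M e = 1"
    using someI_ex[OF ex] by (simp_all add: e_def)
  have "right_factor s = (\<integral>t. e (t \<otimes> s) \<partial>M)"
    by (simp add: right_factor_def e_def)
  then show ?thesis using right_average_proportional[OF f e(1) s] e(2) by (simp add: mult.commute)
qed

lemma continuous_right_factor: "continuous_map T euclidean right_factor"
proof -
  obtain b :: "'a \<Rightarrow> real" where b: "compact_support T b" "\<forall>x\<in>carrier G. 0 \<le> b x" "b \<one> = 1"
    and pos: "integral\<^sup>L M b > 0" by (rule positive_bump)
  have "continuous_map T euclidean (\<lambda>s. (\<integral>t. b (t \<otimes> s) \<partial>M) / integral\<^sup>L M b)"
    using pos
    by (intro continuous_map_euclidean_compose[OF continuous_right_average[OF b(1)],
          where h = "\<lambda>x. x / integral\<^sup>L M b"] continuous_intros) simp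
  then show ?thesis
    by (rule continuous_map_eq) (use pos right_average[OF b(1)] in \<open>simp add: topspace_eq\<close>)
qed

lemma right_factor_pos:
  assumes s: "s \<in> carrier G"
  shows "right_factor s > 0"
proof -
  obtain b :: "'a \<Rightarrow> real" where b: "compact_support T b" "\<forall>x\<in>carrier G. 0 \<le> b x" "b \<one> = 1"
    and pos: "integral\<^sup>L M b > 0" by (rule positive_bump)
  have "(\<integral>t. b (t \<otimes> s) \<partial>M) > 0"
    using b s by (intro integral_pos[OF compact_support_right_translation[OF b(1) s], of "inv s"]) simp_all
  then show ?thesis using right_average[OF b(1) s] pos by (simp add: zero_less_mult_iff)
qed

lemma right_factor_mult:
  assumes s: "s \<in> carrier G" and t: "t \<in> carrier G"
  shows "right_factor (s \<otimes> t) = right_factor s * right_factor t"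
proof -
  obtain b :: "'a \<Rightarrow> real" where b: "compact_support T b" "\<forall>x\<in>carrier G. 0 \<le> b x" "b \<one> = 1"
    and pos: "integral\<^sup>L M b > 0" by (rule positive_bump)
  have "right_factor (s \<otimes> t) * integral\<^sup>L M b = (\<integral>x. b (x \<otimes> (s \<otimes> t)) \<partial>M)"
    using right_average[OF b(1)] s t by simp
  also have "\<dots> = (\<integral>x. b ((x \<otimes> s) \<otimes> t) \<partial>M)"
    using s t by (intro Bochner_Integration.integral_cong) (simp_all add: space_carrier m_assoc)
  also have "\<dots> = right_factor s * (right_factor t * integral\<^sup>L M b)"
    using right_average[OF compact_support_right_translation[OF b(1) t] s] right_average[OF b(1) t]
    by simp
  finally show ?thesis using pos by simp
qed

text \<open>Dividing \<open>integral_mult_integral\<close> by the integral of a bump turns its right average into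
  \<open>right_factor\<close>: inversion maps Haar measure to the measure with density \<open>right_factor\<close>.\<close>

lemma integral_inversion:
  fixes g :: "'a \<Rightarrow> real"
  assumes g: "compact_support T g"
  shows "(\<integral>s. right_factor s * g (inv s) \<partial>M) = integral\<^sup>L M g"
proof -
  obtain b :: "'a \<Rightarrow> real" where b: "compact_support T b" "\<forall>x\<in>carrier G. 0 \<le> b x" "b \<one> = 1"
    and pos: "integral\<^sup>L M b > 0" by (rule positive_bump)
  have "integral\<^sup>L M b * integral\<^sup>L M g = (\<integral>s. (\<integral>t. b (t \<otimes> s) \<partial>M) * g (inv s) \<partial>M)"
    by (rule integral_mult_integral[OF b(1) g])
  also have "\<dots> = (\<integral>s. integral\<^sup>L M b * (right_factor s * g (inv s)) \<partial>M)"
    using right_average[OF b(1)]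
    by (intro Bochner_Integration.integral_cong) (simp_all add: space_carrier)
  also have "\<dots> = integral\<^sup>L M b * (\<integral>s. right_factor s * g (inv s) \<partial>M)" by simp
  finally show ?thesis using pos by simp
qed

text \<open>The scaling of integrals is transferred to measures: to open sets by inner regularity and
  Urysohn functions, and from there to Borel sets by outer regularity.\<close>

lemma emeasure_open_r_coset_le:
  assumes U: "openin T U" and x: "x \<in> carrier G"
  shows "emeasure M (U #> x) \<le> ennreal (right_factor (inv x)) * emeasure M U"
proof -
  have UG: "U \<subseteq> carrier G" using openin_subset[OF U] topspace_eq by simp
  have "emeasure M K \<le> ennreal (right_factor (inv x)) * emeasure M U"
    if K: "compactin T K" "K \<subseteq> U #> x" for K
  proof -
    have KG: "K \<subseteq> carrier G" using compactin_subset_topspace[OF K(1)] topspace_eq by simp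
    have K': "compactin T (K #> inv x)" using K(1) x by (intro compactin_r_coset) simp_all
    have "K #> inv x \<subseteq> (U #> x) #> inv x" using K(2) unfolding r_coset_def by blast
    also have "\<dots> = U" using r_coset_r_coset_inv[OF x UG] .
    finally have sub: "K #> inv x \<subseteq> U" .
    obtain f :: "'a \<Rightarrow> real" and C where f: "continuous_map T euclidean f" "compactin T C" "C \<subseteq> U"
      "\<forall>x\<in>topspace T. 0 \<le> f x \<and> f x \<le> 1" "\<forall>y\<in>K #> inv x. f y = 1" "\<forall>x\<in>topspace T - C. f x = 0"
      by (rule urysohn_compact_support[OF K' U sub])
    have fs: "compact_support T f" using f(1,2,6) by (auto simp: compact_support_def)
    have fx: "compact_support T (\<lambda>t. f (t \<otimes> inv x))"
      using x by (intro compact_support_right_translation[OF fs]) simp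
    have "measure M K = (\<integral>t. indicator K t \<partial>M)"
      using compact_in_sets[OF K(1)] sets.sets_into_space by (simp add: Int_absorb2)
    also have "\<dots> \<le> (\<integral>t. f (t \<otimes> inv x) \<partial>M)"
    proof (rule integral_mono)
      show "integrable M (indicator K :: 'a \<Rightarrow> real)"
        using compact_in_sets[OF K(1)] compact_finite[OF K(1)] by simp
      show "integrable M (\<lambda>t. f (t \<otimes> inv x))" by (rule integrable_compact_support[OF fx])
      fix t assume "t \<in> space M"
      then have t: "t \<in> carrier G" by (simp add: space_carrier)
      show "indicator K t \<le> f (t \<otimes> inv x)"
      proof (cases "t \<in> K")
        case True
        then have "t \<otimes> inv x \<in> K #> inv x" unfolding r_coset_def by blast
        then show ?thesis using f(5) True by simp
      qed (use f(4) t x in \<open>simp add: topspace_eq\<close>)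
    qed
    also have "\<dots> = right_factor (inv x) * integral\<^sup>L M f"
      using right_average[OF fs, of "inv x"] x by simp
    also have "integral\<^sup>L M f \<le> (\<integral>t. indicator C t \<partial>M)"
    proof (rule integral_mono[OF integrable_compact_support[OF fs]])
      show "integrable M (indicator C :: 'a \<Rightarrow> real)"
        using compact_in_sets[OF f(2)] compact_finite[OF f(2)] by simp
      show "f t \<le> indicator C t" if "t \<in> space M" for t
        using f(4,6) that by (cases "t \<in> C") (simp_all add: space_M)
    qed
    also have "(\<integral>t. indicator C t \<partial>M) = measure M C"
      using compact_in_sets[OF f(2)] sets.sets_into_space by (simp add: Int_absorb2)
    finally have "measure M K \<le> right_factor (inv x) * measure M C"
      using right_factor_pos[of "inv x"] x by simp
    then have "ennreal (measure M K) \<le> ennreal (right_factor (inv x)) * ennreal (measure M C)"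
      using right_factor_pos[of "inv x"] x by (simp add: ennreal_leI flip: ennreal_mult)
    also have "ennreal (measure M K) = emeasure M K"
      using compact_finite[OF K(1)] by (simp add: emeasure_eq_ennreal_measure less_top)
    also have "ennreal (measure M C) = emeasure M C"
      using compact_finite[OF f(2)] by (simp add: emeasure_eq_ennreal_measure less_top)
    also have "emeasure M C \<le> emeasure M U"
      by (rule emeasure_mono[OF f(3) open_in_sets[OF U]])
    finally show ?thesis by (simp add: mult_left_mono)
  qed
  then show ?thesis
    unfolding inner_regular[OF openin_r_coset[OF x U]] by (intro SUP_least) blast
qed

lemma sets_r_coset:
  assumes E: "E \<in> sets M" and x: "x \<in> carrier G"
  shows "E #> x \<in> sets M"
proof -
  have "(\<lambda>y. y \<otimes> inv x) -` E \<inter> space M \<in> sets M"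
    using x by (intro measurable_sets[OF continuous_measurable[OF continuous_map_right_translation] E]) simp
  moreover have "(\<lambda>y. y \<otimes> inv x) -` E \<inter> space M = E #> x"
    unfolding r_coset_eq_preimage[OF x sets_subset[OF E]] space_carrier by blast
  ultimately show ?thesis by simp
qed

lemma right_factor_inv:
  assumes x: "x \<in> carrier G"
  shows "right_factor x * right_factor (inv x) = 1"
proof -
  have "right_factor \<one> = right_factor \<one> * right_factor \<one>"
    using right_factor_mult[of \<one> \<one>] by simp
  then have "right_factor \<one> = 1" using right_factor_pos[of \<one>] by simp
  then show ?thesis using right_factor_mult[of x "inv x"] x by simp
qed

lemma emeasure_r_coset_le:
  assumes E: "E \<in> sets M" and x: "x \<in> carrier G"
  shows "emeasure M (E #> x) \<le> ennreal (right_factor (inv x)) * emeasure M E"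
proof -
  let ?c = "right_factor (inv x)" and ?d = "right_factor x"
  have pos: "?c > 0" "?d > 0" using right_factor_pos x by simp_all
  have dc: "ennreal ?d * ennreal ?c = 1" "ennreal ?c * ennreal ?d = 1"
    using right_factor_inv[OF x] pos by (simp_all add: mult.commute flip: ennreal_mult)
  have "ennreal ?d * emeasure M (E #> x) \<le> emeasure M U" if U: "openin T U" "E \<subseteq> U" for U
  proof -
    have "emeasure M (E #> x) \<le> emeasure M (U #> x)"
      using U(2) by (intro emeasure_mono open_in_sets[OF openin_r_coset[OF x U(1)]])
        (auto simp: r_coset_def)
    also have "\<dots> \<le> ennreal ?c * emeasure M U" by (rule emeasure_open_r_coset_le[OF U(1) x])
    finally have "ennreal ?d * emeasure M (E #> x) \<le> ennreal ?d * (ennreal ?c * emeasure M U)"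
      by (rule mult_left_mono) simp
    also have "\<dots> = emeasure M U" using dc by (simp flip: mult.assoc)
    finally show ?thesis .
  qed
  then have "ennreal ?d * emeasure M (E #> x) \<le> emeasure M E"
    unfolding outer_regular[OF E] by (intro INF_greatest) blast
  then have "ennreal ?c * (ennreal ?d * emeasure M (E #> x)) \<le> ennreal ?c * emeasure M E"
    by (rule mult_left_mono) simp
  then show ?thesis using dc by (simp flip: mult.assoc)
qed

text \<open>The reverse inequality is the previous one for the inverse translation.\<close>

lemma emeasure_r_coset:
  assumes E: "E \<in> sets M" and x: "x \<in> carrier G"
  shows "emeasure M (E #> x) = ennreal (right_factor (inv x)) * emeasure M E"
proof (rule antisym)
  let ?c = "right_factor (inv x)" and ?d = "right_factor x"
  have pos: "?c > 0" "?d > 0" using right_factor_pos x by simp_all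
  have cd: "ennreal ?c * ennreal ?d = 1"
    using right_factor_inv[OF x] pos by (simp add: mult.commute flip: ennreal_mult)
  have "emeasure M ((E #> x) #> inv x) \<le> ennreal (right_factor (inv (inv x))) * emeasure M (E #> x)"
    using x by (intro emeasure_r_coset_le sets_r_coset[OF E]) simp_all
  then have "emeasure M E \<le> ennreal ?d * emeasure M (E #> x)"
    using x sets_subset[OF E] by (simp add: r_coset_r_coset_inv)
  then have "ennreal ?c * emeasure M E \<le> ennreal ?c * (ennreal ?d * emeasure M (E #> x))"
    by (rule mult_left_mono) simp
  also have "\<dots> = emeasure M (E #> x)" using cd by (simp flip: mult.assoc)
  finally show "ennreal ?c * emeasure M E \<le> emeasure M (E #> x)" .
qed (rule emeasure_r_coset_le[OF E x])

text \<open>A compact set of positive (and finite) measure makes the scaling factor unique, so that the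
  definite description in \<open>modular_function\<close> denotes it.\<close>

lemma modular_function_eq:
  assumes x: "x \<in> carrier G"
  shows "modular_function G M x = right_factor (inv x)"
  unfolding modular_function_def
proof (rule the_equality)
  show "0 < right_factor (inv x) \<and>
      (\<forall>E\<in>sets M. emeasure M (E #> x) = ennreal (right_factor (inv x)) * emeasure M E)"
    using x emeasure_r_coset right_factor_pos by simp
next
  fix c assume c: "0 < c \<and> (\<forall>E\<in>sets M. emeasure M (E #> x) = ennreal c * emeasure M E)"
  obtain K where K: "compactin T K" "emeasure M K > 0" using exists_compact_pos by blast
  have "ennreal c * emeasure M K = ennreal (right_factor (inv x)) * emeasure M K"
    using c compact_in_sets[OF K(1)] emeasure_r_coset[OF _ x] by metis
  then have "emeasure M K * ennreal c = emeasure M K * ennreal (right_factor (inv x))"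
    by (simp add: mult.commute)
  then have "ennreal c = ennreal (right_factor (inv x))"
    using K(2) compact_finite[OF K(1)] unfolding ennreal_mult_cancel_left by auto
  then show "c = right_factor (inv x)" using c right_factor_pos[of "inv x"] x by simp
qed

lemma modular_function_pos: "x \<in> carrier G \<Longrightarrow> modular_function G M x > 0"
  by (simp add: modular_function_eq right_factor_pos)

lemma modular_function_mult:
  "x \<in> carrier G \<Longrightarrow> y \<in> carrier G \<Longrightarrow>
    modular_function G M (x \<otimes> y) = modular_function G M x * modular_function G M y"
  by (simp add: modular_function_eq inv_mult_group right_factor_mult)

lemma continuous_modular_function: "continuous_map T euclidean (modular_function G M)"
proof -
  have "continuous_map T euclidean (\<lambda>x. right_factor (inv x))"
    using continuous_map_compose[OF continuous_inv continuous_right_factor] by (simp add: o_def)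
  then show ?thesis
    by (rule continuous_map_eq) (simp add: topspace_eq modular_function_eq)
qed

lemma integral_modular_inversion:
  fixes g :: "'a \<Rightarrow> real"
  assumes g: "compact_support T g"
  shows "(\<integral>s. modular_function G M (inv s) * g (inv s) \<partial>M) = integral\<^sup>L M g"
proof -
  have "(\<integral>s. modular_function G M (inv s) * g (inv s) \<partial>M) = (\<integral>s. right_factor s * g (inv s) \<partial>M)"
    by (intro Bochner_Integration.integral_cong) (simp_all add: space_carrier modular_function_eq)
  then show ?thesis using integral_inversion[OF g] by simp
qed

end

section \<open>Integration over the quotient group\<close>

text \<open>Functions on the quotient are handled as functions on the group that are constant on cosets.
  Joint continuity descends to the quotient because products of the quotient map with locally
  compact Hausdorff spaces are again quotient maps.\<close>

locale quotient_haar = locally_compact_group G T + normal N G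
  for G :: "('a, 'm) monoid_scheme" (structure) and T :: "'a topology" and N :: "'a set" +
  fixes \<mu> :: "'a set measure"
  assumes closed_N: "closedin T N"
    and haar_quotient: "left_haar_measure (G Mod N) (coset_topology G N T) \<mu>"
begin

abbreviation Q where "Q \<equiv> coset_topology G N T"
abbreviation q where "q x \<equiv> N #> x"

lemma carrier_quotient: "carrier (G Mod N) = q ` carrier G"
  by (auto simp: FactGroup_def RCOSETS_def)

lemma q_in [simp]: "x \<in> carrier G \<Longrightarrow> q x \<in> carrier (G Mod N)"
  by (simp add: carrier_quotient)

lemma q_mult: "x \<in> carrier G \<Longrightarrow> y \<in> carrier G \<Longrightarrow> q x \<otimes>\<^bsub>G Mod N\<^esub> q y = q (x \<otimes> y)"
  by (simp add: FactGroup_def rcos_sum)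

lemma q_inv: "x \<in> carrier G \<Longrightarrow> inv\<^bsub>G Mod N\<^esub> q x = q (inv x)"
  by (simp add: inv_FactGroup rcos_inv)

lemma N_in_carrier: "s \<in> N \<Longrightarrow> s \<in> carrier G"
  using subset by blast

lemma q_absorb:
  assumes "x \<in> carrier G" "s \<in> N"
  shows "q (x \<otimes> s) = q x"
proof -
  have s: "s \<in> carrier G" using assms(2) by (rule N_in_carrier)
  have c: "x \<otimes> s \<otimes> inv x \<in> N" using inv_op_closed2[OF assms(1,2)] .
  have "q (x \<otimes> s) = q ((x \<otimes> s \<otimes> inv x) \<otimes> x)" using assms(1) s by (simp add: m_assoc)
  also have "\<dots> = q (x \<otimes> s \<otimes> inv x) #> x"
    using assms(1) s by (simp add: coset_mult_assoc subset)
  also have "q (x \<otimes> s \<otimes> inv x) = N"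
    by (rule coset_join2[OF _ subgroup_axioms c]) (use assms(1) s in simp)
  finally show ?thesis .
qed

lemma q_eqE:
  assumes "x \<in> carrier G" "y \<in> carrier G" "q x = q y"
  obtains s where "s \<in> N" "y = x \<otimes> s"
proof -
  have "y \<in> q x" using rcos_self[OF assms(2) subgroup_axioms] assms(3) by simp
  then obtain n where n: "n \<in> N" "y = n \<otimes> x" unfolding r_coset_def by blast
  have nc: "n \<in> carrier G" using n(1) by (rule N_in_carrier)
  have "inv x \<otimes> n \<otimes> x \<in> N" using inv_op_closed1[OF assms(1) n(1)] .
  moreover have "y = x \<otimes> (inv x \<otimes> n \<otimes> x)"
    using n nc assms(1) by (simp add: m_assoc) (simp flip: m_assoc)
  ultimately show thesis by (rule that)
qed

lemma quotient_map_q: "quotient_map T Q q"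
  by (rule quotient_map_coset_topology[OF topspace_eq])

lemma continuous_q: "continuous_map T Q q"
  by (rule quotient_imp_continuous_map[OF quotient_map_q])

lemma topspace_Q: "topspace Q = carrier (G Mod N)"
  using quotient_imp_surjective_map[OF quotient_map_q] by (simp add: topspace_eq carrier_quotient)

text \<open>The saturation of an open set is a union of translates of it.\<close>

lemma open_map_q: "open_map T Q q"
  unfolding open_map_def
proof (intro allI impI)
  fix U assume U: "openin T U"
  have UG: "U \<subseteq> carrier G" using openin_subset[OF U] topspace_eq by simp
  have "{x \<in> carrier G. q x \<in> q ` U} = (\<Union>s\<in>N. U #> s)"
  proof
    show "{x \<in> carrier G. q x \<in> q ` U} \<subseteq> (\<Union>s\<in>N. U #> s)"
    proof
      fix x assume "x \<in> {x \<in> carrier G. q x \<in> q ` U}"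
      then obtain u where u: "u \<in> U" "x \<in> carrier G" "q u = q x" by auto
      moreover have "u \<in> carrier G" using u UG by blast
      ultimately obtain s where "s \<in> N" "x = u \<otimes> s" using q_eqE by metis
      then show "x \<in> (\<Union>s\<in>N. U #> s)" using u(1) unfolding r_coset_def by blast
    qed
    show "(\<Union>s\<in>N. U #> s) \<subseteq> {x \<in> carrier G. q x \<in> q ` U}"
    proof
      fix x assume "x \<in> (\<Union>s\<in>N. U #> s)"
      then obtain s u where su: "s \<in> N" "u \<in> U" "x = u \<otimes> s" unfolding r_coset_def by blast
      then have "u \<in> carrier G" "s \<in> carrier G" using UG N_in_carrier by blast+
      then show "x \<in> {x \<in> carrier G. q x \<in> q ` U}" using su q_absorb by simp
    qed
  qed
  moreover have "openin T (\<Union>s\<in>N. U #> s)"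
    using openin_r_coset[OF N_in_carrier U] by blast
  moreover have "q ` U \<subseteq> carrier (G Mod N)" using UG by auto
  ultimately show "openin Q (q ` U)"
    by (simp add: openin_coset_topology[OF topspace_eq])
qed

text \<open>The cosets of \<open>x\<close> and \<open>y\<close> differ iff \<open>inv x \<otimes> y\<close> lies outside the closed subgroup; this is an open
  condition on the pair.\<close>

lemma Hausdorff_Q: "Hausdorff_space Q"
  unfolding Hausdorff_space_def topspace_Q
proof (intro allI impI)
  fix c d assume cd: "c \<in> carrier (G Mod N) \<and> d \<in> carrier (G Mod N) \<and> c \<noteq> d"
  then obtain x y where xy: "x \<in> carrier G" "y \<in> carrier G" "c = q x" "d = q y"
    by (auto simp: carrier_quotient)
  define W where "W = {z \<in> topspace (prod_topology T T). inv (fst z) \<otimes> snd z \<in> topspace T - N}"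
  have "continuous_map (prod_topology T T) T (\<lambda>z. inv (fst z) \<otimes> snd z)"
    by (intro continuous_map_mult continuous_map_inverse continuous_map_fst continuous_map_snd)
  moreover have "openin T (topspace T - N)" using closed_N by blast
  ultimately have W: "openin (prod_topology T T) W"
    unfolding W_def by (rule openin_continuous_map_preimage)
  have "inv x \<otimes> y \<notin> N"
  proof
    assume "inv x \<otimes> y \<in> N"
    then have "q (x \<otimes> (inv x \<otimes> y)) = q x" by (rule q_absorb[OF xy(1)])
    then show False using cd xy by (simp flip: m_assoc)
  qed
  then have "(x, y) \<in> W"
    using xy by (simp add: W_def topspace_eq)
  then have "\<exists>U V. openin T U \<and> openin T V \<and> x \<in> U \<and> y \<in> V \<and> U \<times> V \<subseteq> W"
    using W unfolding openin_prod_topology_alt by simp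
  then obtain U V where UV: "openin T U" "openin T V" "x \<in> U" "y \<in> V" "U \<times> V \<subseteq> W"
    by blast
  have "disjnt (q ` U) (q ` V)"
    unfolding disjnt_iff
  proof (intro allI notI, elim conjE)
    fix e assume "e \<in> q ` U" "e \<in> q ` V"
    then obtain u v where uv: "u \<in> U" "v \<in> V" "q u = q v" by auto
    then have G: "u \<in> carrier G" "v \<in> carrier G" using openin_subset UV(1,2) topspace_eq by blast+
    then obtain s where "s \<in> N" "v = u \<otimes> s" using uv(3) by (rule q_eqE)
    then have "inv u \<otimes> v \<in> N" using G N_in_carrier by (simp flip: m_assoc)
    moreover have "(u, v) \<in> W" using uv UV(5) by blast
    ultimately show False by (simp add: W_def)
  qed
  then show "\<exists>U V. openin Q U \<and> openin Q V \<and> c \<in> U \<and> d \<in> V \<and> disjnt U V"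
    using open_map_q UV xy unfolding open_map_def by blast
qed

lemma locally_compact_Q: "locally_compact_space Q"
  using locally_compact_space_continuous_open_map_image[OF continuous_q open_map_q _ locally_compact]
    quotient_imp_surjective_map[OF quotient_map_q] by blast

lemma quotient_map_q_q:
  "quotient_map (prod_topology T T) (prod_topology Q Q) (\<lambda>(x, y). (q x, q y))"
proof -
  have 1: "quotient_map (prod_topology T T) (prod_topology T Q) (\<lambda>(x, y). (x, q y))"
    using quotient_map_prod_right[OF locally_compact _ quotient_map_q] Hausdorff by blast
  have 2: "quotient_map (prod_topology T Q) (prod_topology Q Q) (\<lambda>(x, y). (q x, y))"
    using quotient_map_prod_left[OF locally_compact_Q _ quotient_map_q] Hausdorff_Q by blast
  from quotient_map_compose[OF 1 2] show ?thesis by (simp add: o_def case_prod_unfold)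
qed

lemma haar_group_quotient: "haar_group (G Mod N) Q \<mu>"
proof (intro haar_group.intro locally_compact_group.intro topological_group.intro
    haar_group_axioms.intro locally_compact_group_axioms.intro topological_group_axioms.intro)
  show "Group.group (G Mod N)" by (rule factorgroup_is_group)
  show "continuous_map (prod_topology Q Q) Q (\<lambda>(x, y). x \<otimes>\<^bsub>G Mod N\<^esub> y)"
  proof (rule continuous_compose_quotient_map[OF quotient_map_q_q])
    have "continuous_map (prod_topology T T) Q (\<lambda>z. q (fst z \<otimes> snd z))"
    proof -
      have "continuous_map (prod_topology T T) T (\<lambda>z. fst z \<otimes> snd z)"
        by (intro continuous_map_mult continuous_map_fst continuous_map_snd)
      from continuous_map_compose[OF this continuous_q] show ?thesis by (simp add: o_def)
    qed
    then show "continuous_map (prod_topology T T) Q ((\<lambda>(x, y). x \<otimes>\<^bsub>G Mod N\<^esub> y) \<circ> (\<lambda>(x, y). (q x, q y)))"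
      by (rule continuous_map_eq) (clarsimp simp: topspace_eq rcos_sum)
  qed
  show "continuous_map Q Q (\<lambda>x. inv\<^bsub>G Mod N\<^esub> x)"
  proof (rule continuous_compose_quotient_map[OF quotient_map_q])
    have "continuous_map T Q (\<lambda>x. q (inv x))"
      using continuous_map_compose[OF continuous_inv continuous_q] by (simp add: o_def)
    then show "continuous_map T Q ((\<lambda>x. inv\<^bsub>G Mod N\<^esub> x) \<circ> q)"
      by (rule continuous_map_eq) (simp add: topspace_eq q_inv)
  qed
qed (simp_all add: topspace_Q Hausdorff_Q locally_compact_Q haar_quotient)

sublocale Q: haar_group "G Mod N" Q \<mu>
  by (rule haar_group_quotient)

text \<open>The representative at which \<open>coset_integral\<close> evaluates its integrand.\<close>

definition coset_rep :: "'a set \<Rightarrow> 'a" where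
  "coset_rep c = (SOME y. y \<in> c)"

lemma coset_integral_eq: "coset_integral \<mu> F = (\<integral>c. F (coset_rep c) \<partial>\<mu>)"
  by (simp add: coset_integral_def coset_rep_def)

lemma coset_rep:
  assumes "c \<in> carrier (G Mod N)"
  shows "coset_rep c \<in> carrier G" "q (coset_rep c) = c"
proof -
  obtain x where x: "x \<in> carrier G" "c = q x" using assms by (auto simp: carrier_quotient)
  have "x \<in> c" using rcos_self[OF x(1) subgroup_axioms] x(2) by simp
  then have rep: "coset_rep c \<in> q x" unfolding coset_rep_def x(2) by (rule someI)
  then show "coset_rep c \<in> carrier G" using r_coset_subset_G[OF subset x(1)] by blast
  show "q (coset_rep c) = c" using repr_independence[OF rep x(1) subgroup_axioms] x(2) by simp
qed

definition coset_invariant :: "('a \<Rightarrow> 'v) \<Rightarrow> bool" where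
  "coset_invariant F \<longleftrightarrow> (\<forall>x\<in>carrier G. \<forall>s\<in>N. F (x \<otimes> s) = F x)"

lemma coset_rep_q:
  assumes F: "coset_invariant F" and x: "x \<in> carrier G"
  shows "F (coset_rep (q x)) = F x"
proof -
  have "q x = q (coset_rep (q x))" using coset_rep(2) x by simp
  then obtain s where "s \<in> N" "coset_rep (q x) = x \<otimes> s"
    using q_eqE[OF x coset_rep(1)] x by (metis q_in)
  then show ?thesis using F x by (simp add: coset_invariant_def)
qed

lemma coset_integral_cong:
  assumes "\<And>x. x \<in> carrier G \<Longrightarrow> F x = F' x"
  shows "coset_integral \<mu> F = coset_integral \<mu> F'"
  unfolding coset_integral_eq
  using assms coset_rep(1) by (intro Bochner_Integration.integral_cong) (simp_all add: Q.space_carrier)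

text \<open>Although \<open>coset_rep\<close> is an arbitrary section, composing an invariant function with it yields a
  continuous function: it is the factorization through the quotient map.\<close>

lemma continuous_coset_rep2:
  fixes F :: "'b \<Rightarrow> 'a \<Rightarrow> 'v::topological_space"
  assumes Z: "locally_compact_space Z" "Hausdorff_space Z"
    and F: "continuous_map (prod_topology Z T) euclidean (\<lambda>(z, x). F z x)"
    and inv: "\<And>z. z \<in> topspace Z \<Longrightarrow> coset_invariant (F z)"
  shows "continuous_map (prod_topology Z Q) euclidean (\<lambda>(z, c). F z (coset_rep c))"
proof (rule continuous_compose_quotient_map)
  show "quotient_map (prod_topology Z T) (prod_topology Z Q) (\<lambda>(z, x). (z, q x))"
    using quotient_map_prod_right[OF Z(1) _ quotient_map_q] Z(2) by blast
  show "continuous_map (prod_topology Z T) euclidean ((\<lambda>(z, c). F z (coset_rep c)) \<circ> (\<lambda>(z, x). (z, q x)))"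
    by (rule continuous_map_eq[OF F]) (auto simp: topspace_eq coset_rep_q inv)
qed

lemma continuous_coset_rep:
  assumes F: "continuous_map T euclidean F" and inv: "coset_invariant F"
  shows "continuous_map Q euclidean (\<lambda>c. F (coset_rep c))"
proof (rule continuous_compose_quotient_map[OF quotient_map_q])
  show "continuous_map T euclidean ((\<lambda>c. F (coset_rep c)) \<circ> q)"
    by (rule continuous_map_eq[OF F]) (simp add: topspace_eq coset_rep_q inv)
qed

definition coset_compact :: "('a \<Rightarrow> 'v::{zero, topological_space}) \<Rightarrow> bool" where
  "coset_compact F \<longleftrightarrow> continuous_map T euclidean F \<and> coset_invariant F \<and>
     (\<exists>K. compactin Q K \<and> (\<forall>x\<in>carrier G. q x \<notin> K \<longrightarrow> F x = 0))"

lemma coset_compact_support: "coset_compact F \<Longrightarrow> compact_support Q (\<lambda>c. F (coset_rep c))"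
  unfolding coset_compact_def compact_support_def topspace_Q
  using continuous_coset_rep coset_rep by (metis DiffE)

lemma coset_compact_integrable:
  fixes F :: "'a \<Rightarrow> 'v::{banach, second_countable_topology}"
  shows "coset_compact F \<Longrightarrow> integrable \<mu> (\<lambda>c. F (coset_rep c))"
  by (rule Q.integrable_compact_support[OF coset_compact_support])

lemma coset_integral_add:
  fixes F F' :: "'a \<Rightarrow> 'v::{banach, second_countable_topology}"
  assumes "coset_compact F" "coset_compact F'"
  shows "coset_integral \<mu> (\<lambda>x. F x + F' x) = coset_integral \<mu> F + coset_integral \<mu> F'"
  using coset_compact_integrable[OF assms(1)] coset_compact_integrable[OF assms(2)]
  by (simp add: coset_integral_eq)

lemma coset_integral_mono:
  fixes F F' :: "'a \<Rightarrow> real"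
  assumes "integrable \<mu> (\<lambda>c. F (coset_rep c))" "integrable \<mu> (\<lambda>c. F' (coset_rep c))"
    and "\<And>x. x \<in> carrier G \<Longrightarrow> F x \<le> F' x"
  shows "coset_integral \<mu> F \<le> coset_integral \<mu> F'"
  unfolding coset_integral_eq
  by (rule integral_mono[OF assms(1,2)]) (simp add: assms(3) coset_rep(1) Q.space_carrier)

lemma coset_integral_translate:
  fixes F :: "'a \<Rightarrow> 'v::{banach, second_countable_topology}"
  assumes F: "continuous_map T euclidean F" and inv: "coset_invariant F" and z: "z \<in> carrier G"
  shows "coset_integral \<mu> (\<lambda>y. F (z \<otimes> y)) = coset_integral \<mu> F"
proof -
  have "coset_integral \<mu> F = (\<integral>c. F (coset_rep (q z \<otimes>\<^bsub>G Mod N\<^esub> c)) \<partial>\<mu>)"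
    unfolding coset_integral_eq
    by (rule Q.integral_left_translation[OF q_in[OF z] continuous_coset_rep[OF F inv], symmetric])
  also have "\<dots> = (\<integral>c. F (z \<otimes> coset_rep c) \<partial>\<mu>)"
  proof (rule Bochner_Integration.integral_cong[OF refl])
    fix c assume "c \<in> space \<mu>"
    then have c: "coset_rep c \<in> carrier G" "c = q (coset_rep c)"
      using coset_rep by (simp_all add: Q.space_carrier)
    have "q z \<otimes>\<^bsub>G Mod N\<^esub> c = q (z \<otimes> coset_rep c)"
      by (subst c(2)) (rule q_mult[OF z c(1)])
    then show "F (coset_rep (q z \<otimes>\<^bsub>G Mod N\<^esub> c)) = F (z \<otimes> coset_rep c)"
      using coset_rep_q[OF inv] z c(1) by simp
  qed
  finally show ?thesis by (simp add: coset_integral_eq)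
qed

text \<open>Descend in one variable after the other, then apply Fubini on the quotient.\<close>

lemma
  fixes F :: "'a \<Rightarrow> 'a \<Rightarrow> 'v::{banach, second_countable_topology}"
  assumes F: "continuous_map (prod_topology T T) euclidean (\<lambda>(x, y). F x y)"
    and inv1: "\<And>y. y \<in> carrier G \<Longrightarrow> coset_invariant (\<lambda>x. F x y)"
    and inv2: "\<And>x. x \<in> carrier G \<Longrightarrow> coset_invariant (F x)"
    and K: "compactin Q K" and L: "compactin Q L"
    and zero: "\<And>x y. x \<in> carrier G \<Longrightarrow> y \<in> carrier G \<Longrightarrow> q x \<notin> K \<or> q y \<notin> L \<Longrightarrow> F x y = 0"
  shows coset_fubini: "coset_integral \<mu> (\<lambda>x. coset_integral \<mu> (F x)) =
      coset_integral \<mu> (\<lambda>y. coset_integral \<mu> (\<lambda>x. F x y))" (is ?fubini)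
    and coset_fubini_integrable: "integrable \<mu> (\<lambda>c. coset_integral \<mu> (F (coset_rep c)))" (is ?integrable)
proof -
  have "continuous_map (prod_topology T Q) euclidean (\<lambda>(x, d). F x (coset_rep d))"
    using continuous_coset_rep2[OF locally_compact Hausdorff F] inv2 by (simp add: topspace_eq)
  from continuous_map_prod_swap[OF this]
  have "continuous_map (prod_topology Q T) euclidean (\<lambda>(d, x). F x (coset_rep d))" .
  then have "continuous_map (prod_topology Q Q) euclidean (\<lambda>(d, c). F (coset_rep c) (coset_rep d))"
    by (rule continuous_coset_rep2[OF locally_compact_Q Hausdorff_Q])
      (simp add: inv1 coset_rep(1) topspace_Q)
  from continuous_map_prod_swap[OF this]
  have cont: "continuous_map (prod_topology Q Q) euclidean (\<lambda>(c, d). F (coset_rep c) (coset_rep d))" .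
  have z: "F (coset_rep c) (coset_rep d) = 0"
    if "c \<in> topspace Q" "d \<in> topspace Q" "c \<notin> K \<or> d \<notin> L" for c d
    using that zero[of "coset_rep c" "coset_rep d"] coset_rep by (simp add: topspace_Q)
  show ?fubini
    unfolding coset_integral_eq
    by (rule fubini_compact_support[OF Q.locally_finite_borel_axioms Q.locally_finite_borel_axioms cont K L z])
  have "continuous_map Q euclidean (\<lambda>c. \<integral>d. F (coset_rep c) (coset_rep d) \<partial>\<mu>)"
    using z by (intro Q.continuous_map_integral_compact[OF cont L]) simp
  then have "compact_support Q (\<lambda>c. \<integral>d. F (coset_rep c) (coset_rep d) \<partial>\<mu>)"
  proof (rule compact_supportI[OF _ K])
    fix c assume c: "c \<in> topspace Q" "c \<notin> K"
    have "(\<integral>d. F (coset_rep c) (coset_rep d) \<partial>\<mu>) = (\<integral>d. 0 \<partial>\<mu>)"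
      using z c by (intro Bochner_Integration.integral_cong) (simp_all add: Q.space_M)
    then show "(\<integral>d. F (coset_rep c) (coset_rep d) \<partial>\<mu>) = 0" by simp
  qed
  then show ?integrable
    unfolding coset_integral_eq by (rule Q.integrable_compact_support)
qed

lemma continuous_coset_integral:
  fixes F :: "'a \<Rightarrow> 'a \<Rightarrow> 'v::{banach, second_countable_topology}"
  assumes F: "continuous_map (prod_topology T T) euclidean (\<lambda>(x, y). F x y)"
    and inv: "\<And>x. x \<in> carrier G \<Longrightarrow> coset_invariant (F x)"
    and L: "compactin Q L"
    and zero: "\<And>x y. x \<in> carrier G \<Longrightarrow> y \<in> carrier G \<Longrightarrow> q y \<notin> L \<Longrightarrow> F x y = 0"
  shows "continuous_map T euclidean (\<lambda>x. coset_integral \<mu> (F x))"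
  unfolding coset_integral_eq
proof (rule Q.continuous_map_integral_compact[OF _ L])
  show "continuous_map (prod_topology T Q) euclidean (\<lambda>(x, c). F x (coset_rep c))"
    using continuous_coset_rep2[OF locally_compact Hausdorff F] inv by (simp add: topspace_eq)
  show "F x (coset_rep c) = 0" if "x \<in> topspace T" "c \<in> topspace Q" "c \<notin> L" for x c
    using that zero[of x "coset_rep c"] coset_rep by (simp add: topspace_eq topspace_Q)
qed

abbreviation \<Delta> where "\<Delta> x \<equiv> modular_function (G Mod N) \<mu> (q x)"

lemma coset_integral_inversion:
  fixes F :: "'a \<Rightarrow> real"
  assumes F: "coset_compact F"
  shows "coset_integral \<mu> (\<lambda>x. \<Delta> (inv x) * F (inv x)) = coset_integral \<mu> F"
proof -
  have inv: "coset_invariant F" using F by (simp add: coset_compact_def)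
  have "coset_integral \<mu> F = (\<integral>c. modular_function (G Mod N) \<mu> (inv\<^bsub>G Mod N\<^esub> c) *
      F (coset_rep (inv\<^bsub>G Mod N\<^esub> c)) \<partial>\<mu>)"
    unfolding coset_integral_eq
    by (rule Q.integral_modular_inversion[OF coset_compact_support[OF F], symmetric])
  also have "\<dots> = (\<integral>c. \<Delta> (inv (coset_rep c)) * F (inv (coset_rep c)) \<partial>\<mu>)"
  proof (rule Bochner_Integration.integral_cong[OF refl])
    fix c assume "c \<in> space \<mu>"
    then have c: "coset_rep c \<in> carrier G" "c = q (coset_rep c)"
      using coset_rep by (simp_all add: Q.space_carrier)
    have "inv\<^bsub>G Mod N\<^esub> c = q (inv (coset_rep c))"
      by (subst c(2)) (rule q_inv[OF c(1)])
    then show "modular_function (G Mod N) \<mu> (inv\<^bsub>G Mod N\<^esub> c) * F (coset_rep (inv\<^bsub>G Mod N\<^esub> c)) =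
        \<Delta> (inv (coset_rep c)) * F (inv (coset_rep c))"
      using coset_rep_q[OF inv] c(1) by simp
  qed
  finally show ?thesis by (simp add: coset_integral_eq)
qed

lemma modular_pos: "x \<in> carrier G \<Longrightarrow> \<Delta> x > 0"
  by (simp add: Q.modular_function_pos)

lemma modular_mult: "x \<in> carrier G \<Longrightarrow> y \<in> carrier G \<Longrightarrow> \<Delta> (x \<otimes> y) = \<Delta> x * \<Delta> y"
  using Q.modular_function_mult[of "q x" "q y"] by (simp add: rcos_sum)

lemma modular_inv:
  assumes x: "x \<in> carrier G"
  shows "\<Delta> x * \<Delta> (inv x) = 1"
proof -
  have "\<Delta> \<one> = \<Delta> \<one> * \<Delta> \<one>" using modular_mult[of \<one> \<one>] by simp
  then have "\<Delta> \<one> = 1" using modular_pos[of \<one>] by simp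
  then show ?thesis using modular_mult[of x "inv x"] x by simp
qed

lemma continuous_modular_inv: "continuous_map T euclidean (\<lambda>x. \<Delta> (inv x))"
  using continuous_map_compose[OF continuous_map_compose[OF continuous_inv continuous_q]
      Q.continuous_modular_function] by (simp add: o_def)

end

section \<open>Covariant functions\<close>

locale covariant = quotient_haar +
  fixes \<xi> :: "'a \<Rightarrow> complex"
  assumes invariant_character: "\<xi> \<in> invariant_characters G N T"
begin

lemma \<xi>_norm: "s \<in> N \<Longrightarrow> cmod (\<xi> s) = 1"
  and \<xi>_mult: "s \<in> N \<Longrightarrow> t \<in> N \<Longrightarrow> \<xi> (s \<otimes> t) = \<xi> s * \<xi> t"
  and \<xi>_conj: "x \<in> carrier G \<Longrightarrow> s \<in> N \<Longrightarrow> \<xi> (inv x \<otimes> s \<otimes> x) = \<xi> s"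
  using invariant_character by (simp_all add: invariant_characters_def is_character_def)

lemma \<xi>_mult_cnj: "s \<in> N \<Longrightarrow> \<xi> s * cnj (\<xi> s) = 1"
  using \<xi>_norm[of s] complex_norm_square[of "\<xi> s"] by simp

lemma \<xi>_inv:
  assumes s: "s \<in> N"
  shows "\<xi> (inv s) = cnj (\<xi> s)"
proof -
  have si: "inv s \<in> N" using s by (rule m_inv_closed)
  have "\<xi> \<one> = \<xi> \<one> * \<xi> \<one>" using \<xi>_mult[of \<one> \<one>] by simp
  moreover have "\<xi> \<one> \<noteq> 0" using \<xi>_norm[of \<one>] by force
  ultimately have "\<xi> \<one> = 1" by simp
  then have "\<xi> s * \<xi> (inv s) = 1" using \<xi>_mult[OF s si] N_in_carrier[OF s] by simp
  then have "(cnj (\<xi> s) * \<xi> s) * \<xi> (inv s) = cnj (\<xi> s)" by (simp add: mult.assoc)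
  then show ?thesis using \<xi>_mult_cnj[OF s] by (simp add: mult.commute)
qed

definition equivariant :: "('a \<Rightarrow> complex) \<Rightarrow> bool" where
  "equivariant \<psi> \<longleftrightarrow> continuous_map T euclidean \<psi> \<and>
     (\<forall>x\<in>carrier G. \<forall>s\<in>N. \<psi> (x \<otimes> s) = \<xi> s * \<psi> x)"

lemma equivariant_continuous: "equivariant \<psi> \<Longrightarrow> continuous_map T euclidean \<psi>"
  by (simp add: equivariant_def)

lemma equivariant_right: "equivariant \<psi> \<Longrightarrow> x \<in> carrier G \<Longrightarrow> s \<in> N \<Longrightarrow> \<psi> (x \<otimes> s) = \<xi> s * \<psi> x"
  by (simp add: equivariant_def)

text \<open>Invariance of the character makes right equivariance two-sided.\<close>

lemma equivariant_left:
  assumes \<psi>: "equivariant \<psi>" and x: "x \<in> carrier G" and s: "s \<in> N"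
  shows "\<psi> (s \<otimes> x) = \<xi> s * \<psi> x"
proof -
  have "s \<otimes> x = x \<otimes> (inv x \<otimes> s \<otimes> x)"
    using x N_in_carrier[OF s] by (simp add: m_assoc) (simp flip: m_assoc)
  then show ?thesis
    using equivariant_right[OF \<psi> x inv_op_closed1[OF x s]] \<xi>_conj[OF x s] by simp
qed

lemma equivariant_translate:
  assumes \<psi>: "equivariant \<psi>" and z: "z \<in> carrier G"
  shows "equivariant (\<lambda>x. \<psi> (z \<otimes> x))"
  unfolding equivariant_def
proof (intro conjI ballI)
  show "continuous_map T euclidean (\<lambda>x. \<psi> (z \<otimes> x))"
    using continuous_map_compose[OF continuous_map_left_translation[OF z] equivariant_continuous[OF \<psi>]]
    by (simp add: o_def)
  show "\<psi> (z \<otimes> (x \<otimes> s)) = \<xi> s * \<psi> (z \<otimes> x)" if "x \<in> carrier G" "s \<in> N" for x s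
    using equivariant_right[OF \<psi>, of "z \<otimes> x" s] that z N_in_carrier by (simp add: m_assoc)
qed

lemma coset_invariant_norm:
  assumes "equivariant \<psi>"
  shows "coset_invariant (\<lambda>x. cmod (\<psi> x))"
  using equivariant_right[OF assms] \<xi>_norm by (simp add: coset_invariant_def norm_mult)

text \<open>The integrand of the covariant convolution is constant on cosets: the factors \<open>\<xi> s\<close> and
  \<open>\<xi> (inv s)\<close> cancel, the second one being moved to the right of \<open>inv y \<otimes> x\<close> by the invariance
  of \<open>\<xi>\<close>.\<close>

lemma coset_invariant_convolution:
  assumes \<psi>: "equivariant \<psi>" and \<phi>: "equivariant \<phi>" and x: "x \<in> carrier G"
  shows "coset_invariant (\<lambda>y. \<psi> y * \<phi> (inv y \<otimes> x))"
  unfolding coset_invariant_def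
proof (intro ballI)
  fix y s assume y: "y \<in> carrier G" and s: "s \<in> N"
  have sG: "s \<in> carrier G" using s by (rule N_in_carrier)
  have "inv (y \<otimes> s) \<otimes> x = inv s \<otimes> (inv y \<otimes> x)"
    using x y sG by (simp add: inv_mult_group m_assoc)
  then have "\<phi> (inv (y \<otimes> s) \<otimes> x) = cnj (\<xi> s) * \<phi> (inv y \<otimes> x)"
    using equivariant_left[OF \<phi>, of "inv y \<otimes> x" "inv s"] x y s \<xi>_inv by simp
  then have "\<psi> (y \<otimes> s) * \<phi> (inv (y \<otimes> s) \<otimes> x) = (\<xi> s * cnj (\<xi> s)) * (\<psi> y * \<phi> (inv y \<otimes> x))"
    using equivariant_right[OF \<psi> y s] by simp
  then show "\<psi> (y \<otimes> s) * \<phi> (inv (y \<otimes> s) \<otimes> x) = \<psi> y * \<phi> (inv y \<otimes> x)"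
    using \<xi>_mult_cnj[OF s] by simp
qed

lemma coset_invariant_in_argument:
  assumes \<phi>: "equivariant \<phi>" and y: "y \<in> carrier G"
  shows "coset_invariant (\<lambda>x. cmod (\<phi> (inv y \<otimes> x)))"
  using coset_invariant_norm[OF equivariant_translate[OF \<phi>, of "inv y"]] y by simp

lemma continuous_convolution_integrand:
  assumes \<psi>: "equivariant \<psi>" and \<phi>: "equivariant \<phi>"
  shows "continuous_map (prod_topology T T) euclidean (\<lambda>(x, y). \<psi> y * \<phi> (inv y \<otimes> x))"
proof -
  have "continuous_map (prod_topology T T) T (\<lambda>z. inv (snd z) \<otimes> fst z)"
    by (intro continuous_map_mult continuous_map_inverse continuous_map_fst continuous_map_snd)
  from continuous_map_compose[OF this equivariant_continuous[OF \<phi>]]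
  have "continuous_map (prod_topology T T) euclidean (\<lambda>z. \<phi> (inv (snd z) \<otimes> fst z))"
    by (simp add: o_def)
  moreover have "continuous_map (prod_topology T T) euclidean (\<lambda>z. \<psi> (snd z))"
    using continuous_map_compose[OF continuous_map_snd equivariant_continuous[OF \<psi>], of T]
    by (simp add: o_def)
  ultimately have "continuous_map (prod_topology T T) euclidean (\<lambda>z. \<psi> (snd z) * \<phi> (inv (snd z) \<otimes> fst z))"
    by (intro continuous_map_euclidean_compose2[where h = "(*)"]) (auto intro!: continuous_intros)
  then show ?thesis by (simp add: case_prod_unfold)
qed

abbreviation \<C> where "\<C> \<equiv> covariant_functions G N T \<xi>"

text \<open>The set where an equivariant function does not vanish is a union of cosets, hence so is its
  closure, and the image of this closure in the quotient is closed.  Being closed, it is compact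
  once it lies in some compact set.\<close>

lemma compact_support_image_iff:
  assumes \<psi>: "equivariant \<psi>"
  shows "compactin Q (q ` (T closure_of {x \<in> carrier G. \<psi> x \<noteq> 0})) \<longleftrightarrow>
    (\<exists>K. compactin Q K \<and> (\<forall>x\<in>carrier G. q x \<notin> K \<longrightarrow> \<psi> x = 0))"
proof
  let ?S = "{x \<in> carrier G. \<psi> x \<noteq> 0}"
  have S: "?S \<subseteq> T closure_of ?S" by (rule closure_of_subset) (auto simp: topspace_eq)
  {
    assume "compactin Q (q ` (T closure_of ?S))"
    then show "\<exists>K. compactin Q K \<and> (\<forall>x\<in>carrier G. q x \<notin> K \<longrightarrow> \<psi> x = 0)"
      using S by (intro exI[of _ "q ` (T closure_of ?S)"]) blast
  next
    assume "\<exists>K. compactin Q K \<and> (\<forall>x\<in>carrier G. q x \<notin> K \<longrightarrow> \<psi> x = 0)"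
    then obtain K where K: "compactin Q K" "\<forall>x\<in>carrier G. q x \<notin> K \<longrightarrow> \<psi> x = 0" by blast
    have cl: "T closure_of ?S \<subseteq> carrier G" using closure_of_subset_topspace[of T] topspace_eq by simp
    have "closedin Q K" using compactin_imp_closedin[OF Hausdorff_Q K(1)] .
    then have "closedin T {x \<in> topspace T. q x \<in> K}"
      by (rule closedin_continuous_map_preimage[OF continuous_q])
    then have "T closure_of ?S \<subseteq> {x \<in> topspace T. q x \<in> K}"
      by (rule closure_of_minimal[rotated]) (use K(2) in \<open>auto simp: topspace_eq\<close>)
    then have sub: "q ` (T closure_of ?S) \<subseteq> K" by blast
    have saturated: "x \<otimes> s \<in> T closure_of ?S" if x: "x \<in> T closure_of ?S" and s: "s \<in> N" for x s
    proof -
      have sG: "s \<in> carrier G" using s by (rule N_in_carrier)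
      have "\<xi> s \<noteq> 0" using \<xi>_norm[OF s] by force
      then have "(\<lambda>x. x \<otimes> s) ` ?S \<subseteq> ?S" using equivariant_right[OF \<psi> _ s] sG by auto
      then have "T closure_of ((\<lambda>x. x \<otimes> s) ` ?S) \<subseteq> T closure_of ?S" by (rule closure_of_mono)
      moreover have "(\<lambda>x. x \<otimes> s) ` (T closure_of ?S) \<subseteq> T closure_of ((\<lambda>x. x \<otimes> s) ` ?S)"
        by (rule continuous_map_image_closure_subset[OF continuous_map_right_translation[OF sG]])
      ultimately show ?thesis using x by blast
    qed
    have eq: "{x \<in> carrier G. q x \<in> topspace Q - q ` (T closure_of ?S)} = topspace T - T closure_of ?S"
    proof
      show "{x \<in> carrier G. q x \<in> topspace Q - q ` (T closure_of ?S)} \<subseteq> topspace T - T closure_of ?S"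
        by (auto simp: topspace_eq)
      show "topspace T - T closure_of ?S \<subseteq> {x \<in> carrier G. q x \<in> topspace Q - q ` (T closure_of ?S)}"
      proof
        fix x assume x: "x \<in> topspace T - T closure_of ?S"
        then have xG: "x \<in> carrier G" by (simp add: topspace_eq)
        have "q x \<notin> q ` (T closure_of ?S)"
        proof
          assume "q x \<in> q ` (T closure_of ?S)"
          then obtain y where y: "y \<in> T closure_of ?S" "q y = q x" by auto
          have "y \<in> carrier G" using y(1) cl by blast
          then obtain s where "s \<in> N" "x = y \<otimes> s" using q_eqE xG y(2) by metis
          then show False using saturated[OF y(1)] x by blast
        qed
        then show "x \<in> {x \<in> carrier G. q x \<in> topspace Q - q ` (T closure_of ?S)}"
          using xG by (simp add: topspace_Q)
      qed
    qed
    have "openin Q (topspace Q - q ` (T closure_of ?S))"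
      unfolding openin_coset_topology[OF topspace_eq] eq
    proof
      show "topspace Q - q ` (T closure_of ?S) \<subseteq> carrier (G Mod N)"
        unfolding topspace_Q by (rule Diff_subset)
      show "openin T (topspace T - T closure_of ?S)"
        by (rule openin_diff[OF openin_topspace closedin_closure_of])
    qed
    then have "closedin Q (q ` (T closure_of ?S))"
      using subset_trans[OF sub compactin_subset_topspace[OF K(1)]] by (simp only: closedin_def)
    then show "compactin Q (q ` (T closure_of ?S))"
      by (rule closed_compactin[OF K(1) sub])
  }
qed

lemma \<C>_iff:
  "\<psi> \<in> \<C> \<longleftrightarrow> \<psi> \<in> extensional (carrier G) \<and> equivariant \<psi> \<and>
     (\<exists>K. compactin Q K \<and> (\<forall>x\<in>carrier G. q x \<notin> K \<longrightarrow> \<psi> x = 0))"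
proof (cases "equivariant \<psi>")
  case True
  then show ?thesis
    unfolding covariant_functions_def mem_Collect_eq compact_support_image_iff[OF True]
    by (simp add: equivariant_def)
qed (auto simp: covariant_functions_def equivariant_def)

lemma \<C>_equivariant: "\<psi> \<in> \<C> \<Longrightarrow> equivariant \<psi>"
  by (simp add: \<C>_iff)

lemma \<C>_support:
  assumes "\<psi> \<in> \<C>"
  obtains K where "compactin Q K" "\<forall>x\<in>carrier G. q x \<notin> K \<longrightarrow> \<psi> x = 0"
  using assms unfolding \<C>_iff by blast

lemma \<C>_eqI:
  assumes "\<psi> \<in> \<C>" "\<phi> \<in> \<C>" "\<And>x. x \<in> carrier G \<Longrightarrow> \<psi> x = \<phi> x"
  shows "\<psi> = \<phi>"
  using assms by (auto simp: \<C>_iff intro: extensionalityI)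

lemma \<C>_norm_compact:
  assumes "\<psi> \<in> \<C>"
  shows "coset_compact (\<lambda>x. cmod (\<psi> x))"
proof -
  have "continuous_map T euclidean (\<lambda>x. cmod (\<psi> x))"
    by (rule continuous_map_euclidean_compose[OF equivariant_continuous[OF \<C>_equivariant[OF assms]]])
      (intro continuous_intros)
  then show ?thesis
    using coset_invariant_norm[OF \<C>_equivariant[OF assms]] assms
    unfolding coset_compact_def \<C>_iff by auto
qed

lemma restrict_in_\<C>:
  assumes \<psi>: "equivariant \<psi>" and K: "compactin Q K" "\<And>x. x \<in> carrier G \<Longrightarrow> q x \<notin> K \<Longrightarrow> \<psi> x = 0"
  shows "restrict \<psi> (carrier G) \<in> \<C>"
  unfolding \<C>_iff
proof (intro conjI)
  have "continuous_map T euclidean (restrict \<psi> (carrier G))"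
    by (rule continuous_map_eq[OF equivariant_continuous[OF \<psi>]]) (simp add: topspace_eq)
  then show "equivariant (restrict \<psi> (carrier G))"
    using equivariant_right[OF \<psi>] N_in_carrier by (simp add: equivariant_def)
  show "\<exists>K. compactin Q K \<and> (\<forall>x\<in>carrier G. q x \<notin> K \<longrightarrow> restrict \<psi> (carrier G) x = 0)"
    using K by auto
qed simp

lemma \<C>_add:
  assumes \<psi>: "\<psi> \<in> \<C>" and \<phi>: "\<phi> \<in> \<C>"
  shows "(\<lambda>x\<in>carrier G. \<psi> x + \<phi> x) \<in> \<C>"
proof -
  obtain K where K: "compactin Q K" "\<forall>x\<in>carrier G. q x \<notin> K \<longrightarrow> \<psi> x = 0" using \<psi> by (rule \<C>_support)
  obtain L where L: "compactin Q L" "\<forall>x\<in>carrier G. q x \<notin> L \<longrightarrow> \<phi> x = 0" using \<phi> by (rule \<C>_support)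
  note e = \<C>_equivariant[OF \<psi>] \<C>_equivariant[OF \<phi>]
  have "continuous_map T euclidean (\<lambda>x. \<psi> x + \<phi> x)"
    by (rule continuous_map_euclidean_compose2[OF equivariant_continuous[OF e(1)] equivariant_continuous[OF e(2)]])
      (intro continuous_intros)
  then have "equivariant (\<lambda>x. \<psi> x + \<phi> x)"
    using equivariant_right[OF e(1)] equivariant_right[OF e(2)] by (simp add: equivariant_def distrib_left)
  then show ?thesis
    by (rule restrict_in_\<C>[OF _ compactin_Un[OF K(1) L(1)]]) (use K(2) L(2) in simp)
qed

lemma \<C>_smult:
  assumes \<psi>: "\<psi> \<in> \<C>"
  shows "(\<lambda>x\<in>carrier G. c * \<psi> x) \<in> \<C>"
proof -
  obtain K where K: "compactin Q K" "\<forall>x\<in>carrier G. q x \<notin> K \<longrightarrow> \<psi> x = 0" using \<psi> by (rule \<C>_support)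
  note e = \<C>_equivariant[OF \<psi>]
  have "continuous_map T euclidean (\<lambda>x. c * \<psi> x)"
    by (rule continuous_map_euclidean_compose[OF equivariant_continuous[OF e]]) (intro continuous_intros)
  then have "equivariant (\<lambda>x. c * \<psi> x)"
    using equivariant_right[OF e] by (simp add: equivariant_def)
  then show ?thesis by (rule restrict_in_\<C>[OF _ K(1)]) (use K(2) in simp)
qed

lemma \<C>_zero: "(\<lambda>x\<in>carrier G. 0) \<in> \<C>"
  by (rule restrict_in_\<C>[OF _ compactin_empty]) (simp_all add: equivariant_def)

abbreviation convolution (infixl "\<natural>" 70) where
  "\<psi> \<natural> \<phi> \<equiv> covariant_convolution G \<mu> \<psi> \<phi>"

lemma convolution_apply:
  "x \<in> carrier G \<Longrightarrow> (\<psi> \<natural> \<phi>) x = coset_integral \<mu> (\<lambda>y. \<psi> y * \<phi> (inv y \<otimes> x))"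
  by (simp add: covariant_convolution_def)

text \<open>A convolution is supported in the product of the supports.\<close>

lemma mult_in_supports:
  assumes "x \<in> carrier G" "y \<in> carrier G" "q y \<in> K" "q (inv y \<otimes> x) \<in> L"
  shows "q x \<in> (\<lambda>(c, d). c \<otimes>\<^bsub>G Mod N\<^esub> d) ` (K \<times> L)"
proof -
  have "y \<otimes> (inv y \<otimes> x) = x" using assms by (simp flip: m_assoc)
  then have "q x = q y \<otimes>\<^bsub>G Mod N\<^esub> q (inv y \<otimes> x)"
    using assms by (simp add: rcos_sum)
  then show ?thesis using assms(3,4) by (intro image_eqI[of _ _ "(q y, q (inv y \<otimes> x))"]) simp_all
qed

lemma convolution_in_\<C>:
  assumes \<psi>: "\<psi> \<in> \<C>" and \<phi>: "\<phi> \<in> \<C>"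
  shows "\<psi> \<natural> \<phi> \<in> \<C>"
proof -
  obtain K where K: "compactin Q K" "\<forall>x\<in>carrier G. q x \<notin> K \<longrightarrow> \<psi> x = 0" using \<psi> by (rule \<C>_support)
  obtain L where L: "compactin Q L" "\<forall>x\<in>carrier G. q x \<notin> L \<longrightarrow> \<phi> x = 0" using \<phi> by (rule \<C>_support)
  note e = \<C>_equivariant[OF \<psi>] \<C>_equivariant[OF \<phi>]
  let ?f = "\<lambda>x. coset_integral \<mu> (\<lambda>y. \<psi> y * \<phi> (inv y \<otimes> x))"
  have "continuous_map T euclidean ?f"
    using K(2) by (intro continuous_coset_integral[OF continuous_convolution_integrand[OF e]
          coset_invariant_convolution[OF e] K(1)]) simp_all
  moreover have "?f (x \<otimes> s) = \<xi> s * ?f x" if x: "x \<in> carrier G" and s: "s \<in> N" for x s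
  proof -
    have "?f (x \<otimes> s) = coset_integral \<mu> (\<lambda>y. \<xi> s * (\<psi> y * \<phi> (inv y \<otimes> x)))"
    proof (rule coset_integral_cong)
      fix y assume y: "y \<in> carrier G"
      then have "\<phi> (inv y \<otimes> (x \<otimes> s)) = \<xi> s * \<phi> (inv y \<otimes> x)"
        using equivariant_right[OF e(2), of "inv y \<otimes> x" s] x s N_in_carrier by (simp add: m_assoc)
      then show "\<psi> y * \<phi> (inv y \<otimes> (x \<otimes> s)) = \<xi> s * (\<psi> y * \<phi> (inv y \<otimes> x))" by simp
    qed
    then show ?thesis by (simp add: coset_integral_eq)
  qed
  ultimately have f: "equivariant ?f" by (simp add: equivariant_def)
  have "restrict ?f (carrier G) \<in> \<C>"
  proof (rule restrict_in_\<C>[OF f Q.compactin_mult[OF K(1) L(1)]])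
    fix x assume x: "x \<in> carrier G" "q x \<notin> (\<lambda>(c, d). c \<otimes>\<^bsub>G Mod N\<^esub> d) ` (K \<times> L)"
    have "?f x = coset_integral \<mu> (\<lambda>y. 0)"
    proof (rule coset_integral_cong)
      fix y assume y: "y \<in> carrier G"
      then have "q y \<notin> K \<or> q (inv y \<otimes> x) \<notin> L" using mult_in_supports x by blast
      then show "\<psi> y * \<phi> (inv y \<otimes> x) = 0" using K(2) L(2) x y by auto
    qed
    then show "?f x = 0" by (simp add: coset_integral_eq)
  qed
  then show ?thesis by (simp add: covariant_convolution_def)
qed

lemma convolution_integrand_compact:
  assumes \<psi>: "\<psi> \<in> \<C>" and \<phi>: "\<phi> \<in> \<C>" and x: "x \<in> carrier G"
  shows "coset_compact (\<lambda>y. \<psi> y * \<phi> (inv y \<otimes> x))"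
proof -
  obtain K where K: "compactin Q K" "\<forall>x\<in>carrier G. q x \<notin> K \<longrightarrow> \<psi> x = 0" using \<psi> by (rule \<C>_support)
  note e = \<C>_equivariant[OF \<psi>] \<C>_equivariant[OF \<phi>]
  have "continuous_map T euclidean (\<lambda>y. \<psi> y * \<phi> (inv y \<otimes> x))"
    using continuous_map_prod_slice[OF continuous_convolution_integrand[OF e]] x
    by (simp add: topspace_eq)
  then show ?thesis
    using coset_invariant_convolution[OF e x] K unfolding coset_compact_def by auto
qed

text \<open>Exchange the two integrations, then substitute \<open>z \<otimes> y\<close> for \<open>y\<close> in the inner one.\<close>

lemma convolution_assoc:
  assumes \<psi>: "\<psi> \<in> \<C>" and \<phi>: "\<phi> \<in> \<C>" and \<eta>: "\<eta> \<in> \<C>"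
  shows "(\<psi> \<natural> \<phi>) \<natural> \<eta> = \<psi> \<natural> (\<phi> \<natural> \<eta>)"
proof (rule \<C>_eqI)
  show "(\<psi> \<natural> \<phi>) \<natural> \<eta> \<in> \<C>" "\<psi> \<natural> (\<phi> \<natural> \<eta>) \<in> \<C>"
    using assms convolution_in_\<C> by simp_all
  fix x assume x: "x \<in> carrier G"
  obtain K where K: "compactin Q K" "\<forall>x\<in>carrier G. q x \<notin> K \<longrightarrow> \<psi> x = 0" using \<psi> by (rule \<C>_support)
  obtain L where L: "compactin Q L" "\<forall>x\<in>carrier G. q x \<notin> L \<longrightarrow> \<phi> x = 0" using \<phi> by (rule \<C>_support)
  note e = \<C>_equivariant[OF \<psi>] \<C>_equivariant[OF \<phi>] \<C>_equivariant[OF \<eta>]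
  define F where "F = (\<lambda>y z. \<psi> z * \<phi> (inv z \<otimes> y) * \<eta> (inv y \<otimes> x))"
  have F_inner: "F y z = \<psi> z * (\<phi> (inv z \<otimes> y) * \<eta> (inv y \<otimes> x))" for y z
    by (simp add: F_def)
  have swap: "coset_integral \<mu> (\<lambda>y. coset_integral \<mu> (F y)) =
      coset_integral \<mu> (\<lambda>z. coset_integral \<mu> (\<lambda>y. F y z))"
  proof (rule coset_fubini[OF _ _ _ Q.compactin_mult[OF K(1) L(1)] K(1)])
    have "continuous_map (prod_topology T T) T (\<lambda>z. inv (fst z) \<otimes> x)"
      using x by (intro continuous_map_mult continuous_map_inverse continuous_map_fst) (simp add: topspace_eq)
    from continuous_map_compose[OF this equivariant_continuous[OF e(3)]]
    have "continuous_map (prod_topology T T) euclidean (\<lambda>z. \<eta> (inv (fst z) \<otimes> x))"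
      by (simp add: o_def)
    with continuous_convolution_integrand[OF e(1,2)]
    have "continuous_map (prod_topology T T) euclidean
        (\<lambda>z. (case z of (y, z) \<Rightarrow> \<psi> z * \<phi> (inv z \<otimes> y)) * \<eta> (inv (fst z) \<otimes> x))"
      by (rule continuous_map_euclidean_compose2[where h = "(*)"]) (intro continuous_intros)
    then show "continuous_map (prod_topology T T) euclidean (\<lambda>(y, z). F y z)"
      by (simp add: F_def case_prod_unfold)
    show "coset_invariant (\<lambda>y. F y z)" if z: "z \<in> carrier G" for z
    proof -
      have "equivariant (\<lambda>y. \<phi> (inv z \<otimes> y))" using z by (intro equivariant_translate[OF e(2)]) simp
      from coset_invariant_convolution[OF this e(3) x] show ?thesis
        unfolding coset_invariant_def F_inner by simp
    qed
    show "coset_invariant (F y)" if "y \<in> carrier G" for y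
      using coset_invariant_convolution[OF e(1,2) that] unfolding coset_invariant_def F_def by simp
    show "F y z = 0" if yz: "y \<in> carrier G" "z \<in> carrier G"
      and "q y \<notin> (\<lambda>(c, d). c \<otimes>\<^bsub>G Mod N\<^esub> d) ` (K \<times> L) \<or> q z \<notin> K" for y z
    proof -
      have "q z \<notin> K \<or> q (inv z \<otimes> y) \<notin> L" using that mult_in_supports by blast
      then show ?thesis using K(2) L(2) yz by (auto simp: F_def)
    qed
  qed
  have "((\<psi> \<natural> \<phi>) \<natural> \<eta>) x = coset_integral \<mu> (\<lambda>y. (\<psi> \<natural> \<phi>) y * \<eta> (inv y \<otimes> x))"
    by (rule convolution_apply[OF x])
  also have "\<dots> = coset_integral \<mu> (\<lambda>y. coset_integral \<mu> (F y))"
    by (rule coset_integral_cong) (simp add: convolution_apply F_def coset_integral_eq)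
  also note swap
  also have "coset_integral \<mu> (\<lambda>z. coset_integral \<mu> (\<lambda>y. F y z)) =
      coset_integral \<mu> (\<lambda>z. \<psi> z * (\<phi> \<natural> \<eta>) (inv z \<otimes> x))"
  proof (rule coset_integral_cong)
    fix z assume z: "z \<in> carrier G"
    define k where "k = (\<lambda>y. \<phi> (inv z \<otimes> y) * \<eta> (inv y \<otimes> x))"
    have tr: "equivariant (\<lambda>y. \<phi> (inv z \<otimes> y))" using z by (intro equivariant_translate[OF e(2)]) simp
    have "continuous_map T euclidean k"
      using continuous_map_prod_slice[OF continuous_convolution_integrand[OF tr e(3)]] x
      by (simp add: topspace_eq k_def)
    moreover have "coset_invariant k"
      using coset_invariant_convolution[OF tr e(3) x] by (simp add: k_def)
    ultimately have "coset_integral \<mu> k = coset_integral \<mu> (\<lambda>y. k (z \<otimes> y))"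
      by (rule coset_integral_translate[OF _ _ z, symmetric])
    also have "\<dots> = coset_integral \<mu> (\<lambda>y. \<phi> y * \<eta> (inv y \<otimes> (inv z \<otimes> x)))"
    proof (rule coset_integral_cong)
      fix y assume y: "y \<in> carrier G"
      have "inv z \<otimes> (z \<otimes> y) = y" using y z by (simp flip: m_assoc)
      moreover have "inv (z \<otimes> y) \<otimes> x = inv y \<otimes> (inv z \<otimes> x)"
        using x y z by (simp add: inv_mult_group m_assoc)
      ultimately show "k (z \<otimes> y) = \<phi> y * \<eta> (inv y \<otimes> (inv z \<otimes> x))" by (simp add: k_def)
    qed
    also have "\<dots> = (\<phi> \<natural> \<eta>) (inv z \<otimes> x)" using x z by (simp add: convolution_apply)
    finally show "coset_integral \<mu> (\<lambda>y. F y z) = \<psi> z * (\<phi> \<natural> \<eta>) (inv z \<otimes> x)"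
      by (simp add: F_inner k_def coset_integral_eq)
  qed
  also have "\<dots> = (\<psi> \<natural> (\<phi> \<natural> \<eta>)) x" by (rule convolution_apply[OF x, symmetric])
  finally show "((\<psi> \<natural> \<phi>) \<natural> \<eta>) x = (\<psi> \<natural> (\<phi> \<natural> \<eta>)) x" .
qed

text \<open>After exchanging the integrations, the inner integral of \<open>cmod (\<phi> (inv y \<otimes> x))\<close> over \<open>x\<close> is the
  norm of \<open>\<phi>\<close> by left invariance.\<close>

lemma norm_convolution_le:
  assumes \<psi>: "\<psi> \<in> \<C>" and \<phi>: "\<phi> \<in> \<C>"
  shows "coset_integral \<mu> (\<lambda>x. cmod ((\<psi> \<natural> \<phi>) x)) \<le>
    coset_integral \<mu> (\<lambda>x. cmod (\<psi> x)) * coset_integral \<mu> (\<lambda>x. cmod (\<phi> x))"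
proof -
  obtain K where K: "compactin Q K" "\<forall>x\<in>carrier G. q x \<notin> K \<longrightarrow> \<psi> x = 0" using \<psi> by (rule \<C>_support)
  obtain L where L: "compactin Q L" "\<forall>x\<in>carrier G. q x \<notin> L \<longrightarrow> \<phi> x = 0" using \<phi> by (rule \<C>_support)
  note e = \<C>_equivariant[OF \<psi>] \<C>_equivariant[OF \<phi>]
  define F where "F = (\<lambda>x y. cmod (\<psi> y) * cmod (\<phi> (inv y \<otimes> x)))"
  have F_norm: "F x y = cmod (\<psi> y * \<phi> (inv y \<otimes> x))" for x y by (simp add: F_def norm_mult)
  have cont: "continuous_map (prod_topology T T) euclidean (\<lambda>(x, y). F x y)"
    using continuous_map_euclidean_compose[OF continuous_convolution_integrand[OF e] continuous_on_norm_id]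
    by (simp add: F_norm case_prod_unfold)
  have inv1: "coset_invariant (\<lambda>x. F x y)" if "y \<in> carrier G" for y
    using coset_invariant_in_argument[OF e(2) that] by (simp add: coset_invariant_def F_def)
  have inv2: "coset_invariant (F x)" if "x \<in> carrier G" for x
    using coset_invariant_convolution[OF e that] by (simp add: coset_invariant_def F_norm)
  have zero: "F x y = 0" if xy: "x \<in> carrier G" "y \<in> carrier G"
    and "q x \<notin> (\<lambda>(c, d). c \<otimes>\<^bsub>G Mod N\<^esub> d) ` (K \<times> L) \<or> q y \<notin> K" for x y
  proof -
    have "q y \<notin> K \<or> q (inv y \<otimes> x) \<notin> L" using that mult_in_supports by blast
    then show ?thesis using K(2) L(2) xy by (auto simp: F_def)
  qed
  note fub = cont inv1 inv2 Q.compactin_mult[OF K(1) L(1)] K(1) zero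
  have "coset_integral \<mu> (\<lambda>x. cmod ((\<psi> \<natural> \<phi>) x)) \<le> coset_integral \<mu> (\<lambda>x. coset_integral \<mu> (F x))"
  proof (rule coset_integral_mono)
    show "integrable \<mu> (\<lambda>c. cmod ((\<psi> \<natural> \<phi>) (coset_rep c)))"
      by (rule coset_compact_integrable[OF \<C>_norm_compact[OF convolution_in_\<C>[OF \<psi> \<phi>]]])
    show "integrable \<mu> (\<lambda>c. coset_integral \<mu> (F (coset_rep c)))"
      by (rule coset_fubini_integrable[OF fub])
    fix x assume "x \<in> carrier G"
    then show "cmod ((\<psi> \<natural> \<phi>) x) \<le> coset_integral \<mu> (F x)"
      by (simp add: convolution_apply coset_integral_eq F_norm integral_norm_bound)
  qed
  also have "\<dots> = coset_integral \<mu> (\<lambda>y. coset_integral \<mu> (\<lambda>x. F x y))"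
    by (rule coset_fubini[OF fub])
  also have "\<dots> = coset_integral \<mu> (\<lambda>y. cmod (\<psi> y) * coset_integral \<mu> (\<lambda>x. cmod (\<phi> x)))"
  proof (rule coset_integral_cong)
    fix y assume y: "y \<in> carrier G"
    have "coset_integral \<mu> (\<lambda>x. cmod (\<phi> (inv y \<otimes> x))) = coset_integral \<mu> (\<lambda>x. cmod (\<phi> x))"
      using \<C>_norm_compact[OF \<phi>] y
      by (intro coset_integral_translate[of "\<lambda>x. cmod (\<phi> x)"]) (simp_all add: coset_compact_def)
    then show "coset_integral \<mu> (\<lambda>x. F x y) = cmod (\<psi> y) * coset_integral \<mu> (\<lambda>x. cmod (\<phi> x))"
      by (simp add: F_def coset_integral_eq)
  qed
  also have "\<dots> = coset_integral \<mu> (\<lambda>x. cmod (\<psi> x)) * coset_integral \<mu> (\<lambda>x. cmod (\<phi> x))"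
    by (simp add: coset_integral_eq)
  finally show ?thesis .
qed

abbreviation star where "star \<equiv> covariant_involution G N \<mu>"

lemma star_apply: "x \<in> carrier G \<Longrightarrow> star \<psi> x = complex_of_real (\<Delta> (inv x)) * cnj (\<psi> (inv x))"
  by (simp add: covariant_involution_def)

lemma star_in_\<C>:
  assumes \<psi>: "\<psi> \<in> \<C>"
  shows "star \<psi> \<in> \<C>"
proof -
  obtain K where K: "compactin Q K" "\<forall>x\<in>carrier G. q x \<notin> K \<longrightarrow> \<psi> x = 0" using \<psi> by (rule \<C>_support)
  note e = \<C>_equivariant[OF \<psi>]
  let ?f = "\<lambda>x. complex_of_real (\<Delta> (inv x)) * cnj (\<psi> (inv x))"
  have "continuous_map T euclidean (\<lambda>x. \<psi> (inv x))"
    using continuous_map_compose[OF continuous_inv equivariant_continuous[OF e]] by (simp add: o_def)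
  then have "continuous_map T euclidean ?f"
    by (rule continuous_map_euclidean_compose2[OF continuous_modular_inv,
          where h = "\<lambda>a b. complex_of_real a * cnj b"]) (intro continuous_intros)
  moreover have "?f (x \<otimes> s) = \<xi> s * ?f x" if x: "x \<in> carrier G" and s: "s \<in> N" for x s
  proof -
    have sG: "s \<in> carrier G" using s by (rule N_in_carrier)
    have "q (inv (x \<otimes> s)) = inv\<^bsub>G Mod N\<^esub> q (x \<otimes> s)"
      by (rule q_inv[symmetric]) (use x sG in simp)
    also have "\<dots> = q (inv x)" unfolding q_absorb[OF x s] by (rule q_inv[OF x])
    finally have "q (inv (x \<otimes> s)) = q (inv x)" .
    moreover have "\<psi> (inv (x \<otimes> s)) = cnj (\<xi> s) * \<psi> (inv x)"
      using equivariant_left[OF e, of "inv x" "inv s"] x s sG \<xi>_inv by (simp add: inv_mult_group)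
    ultimately show ?thesis by (simp only: complex_cnj_mult complex_cnj_cnj mult.left_commute)
  qed
  ultimately have f: "equivariant ?f" by (simp add: equivariant_def)
  have "restrict ?f (carrier G) \<in> \<C>"
  proof (rule restrict_in_\<C>[OF f Q.compactin_inv[OF K(1)]])
    fix x assume x: "x \<in> carrier G" "q x \<notin> (\<lambda>c. inv\<^bsub>G Mod N\<^esub> c) ` K"
    have "q (inv x) \<notin> K"
    proof
      assume "q (inv x) \<in> K"
      then have "inv\<^bsub>G Mod N\<^esub> q (inv x) \<in> (\<lambda>c. inv\<^bsub>G Mod N\<^esub> c) ` K" by (rule imageI)
      then show False using x by (simp add: q_inv)
    qed
    then show "?f x = 0" using K(2) x by simp
  qed
  then show ?thesis by (simp add: covariant_involution_def)
qed

lemma star_star: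
  assumes \<psi>: "\<psi> \<in> \<C>"
  shows "star (star \<psi>) = \<psi>"
proof (rule \<C>_eqI)
  show "star (star \<psi>) \<in> \<C>" "\<psi> \<in> \<C>" using \<psi> star_in_\<C> by simp_all
  fix x assume x: "x \<in> carrier G"
  have "star (star \<psi>) x = complex_of_real (\<Delta> x * \<Delta> (inv x)) * \<psi> x"
    using x by (simp add: star_apply)
  then show "star (star \<psi>) x = \<psi> x" using modular_inv[OF x] by simp
qed

text \<open>This is the inversion formula on the quotient, and the reason for the modular factor in the
  involution.\<close>

lemma norm_star:
  assumes \<psi>: "\<psi> \<in> \<C>"
  shows "coset_integral \<mu> (\<lambda>x. cmod (star \<psi> x)) = coset_integral \<mu> (\<lambda>x. cmod (\<psi> x))"
proof -
  have "coset_integral \<mu> (\<lambda>x. cmod (star \<psi> x)) = coset_integral \<mu> (\<lambda>x. \<Delta> (inv x) * cmod (\<psi> (inv x)))"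
  proof (rule coset_integral_cong)
    fix x assume x: "x \<in> carrier G"
    then show "cmod (star \<psi> x) = \<Delta> (inv x) * cmod (\<psi> (inv x))"
      using modular_pos[of "inv x"] by (simp add: star_apply norm_mult)
  qed
  also have "\<dots> = coset_integral \<mu> (\<lambda>x. cmod (\<psi> x))"
    by (rule coset_integral_inversion[OF \<C>_norm_compact[OF \<psi>]])
  finally show ?thesis .
qed

text \<open>The modular factors combine to the constant \<open>\<Delta> (inv x)\<close>, and translating the integration variable
  by \<open>x\<close> identifies the remaining integrals.\<close>

lemma star_convolution:
  assumes \<psi>: "\<psi> \<in> \<C>" and \<phi>: "\<phi> \<in> \<C>"
  shows "star (\<psi> \<natural> \<phi>) = star \<phi> \<natural> star \<psi>"
proof (rule \<C>_eqI)
  show "star (\<psi> \<natural> \<phi>) \<in> \<C>" "star \<phi> \<natural> star \<psi> \<in> \<C>"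
    using \<psi> \<phi> star_in_\<C> convolution_in_\<C> by simp_all
  note e = \<C>_equivariant[OF \<psi>] \<C>_equivariant[OF \<phi>]
  fix x assume x: "x \<in> carrier G"
  define k where "k = (\<lambda>y. \<psi> y * \<phi> (inv y \<otimes> inv x))"
  have "coset_compact k" unfolding k_def using x by (intro convolution_integrand_compact[OF \<psi> \<phi>]) simp
  then have k: "coset_integral \<mu> (\<lambda>y. k (inv x \<otimes> y)) = coset_integral \<mu> k"
    using x by (intro coset_integral_translate) (simp_all add: coset_compact_def)
  have "(star \<phi> \<natural> star \<psi>) x = coset_integral \<mu> (\<lambda>y. star \<phi> y * star \<psi> (inv y \<otimes> x))"
    by (rule convolution_apply[OF x])
  also have "\<dots> = coset_integral \<mu> (\<lambda>y. complex_of_real (\<Delta> (inv x)) * cnj (k (inv x \<otimes> y)))"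
  proof (rule coset_integral_cong)
    fix y assume y: "y \<in> carrier G"
    have 1: "inv (inv y \<otimes> x) = inv x \<otimes> y" using x y by (simp add: inv_mult_group)
    have "inv (inv x \<otimes> y) \<otimes> inv x = inv y" using x y by (simp add: inv_mult_group m_assoc)
    then have 2: "k (inv x \<otimes> y) = \<psi> (inv x \<otimes> y) * \<phi> (inv y)" by (simp add: k_def)
    have "\<Delta> (inv y) * \<Delta> (inv x \<otimes> y) = \<Delta> (inv x) * (\<Delta> y * \<Delta> (inv y))"
      using modular_mult[of "inv x" y] x y by simp
    then have 3: "\<Delta> (inv y) * \<Delta> (inv x \<otimes> y) = \<Delta> (inv x)"
      using modular_inv[OF y] by simp
    have "star \<phi> y * star \<psi> (inv y \<otimes> x) =
        complex_of_real (\<Delta> (inv y) * \<Delta> (inv x \<otimes> y)) * cnj (\<psi> (inv x \<otimes> y) * \<phi> (inv y))"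
      using x y 1 by (simp add: star_apply)
    then show "star \<phi> y * star \<psi> (inv y \<otimes> x) = complex_of_real (\<Delta> (inv x)) * cnj (k (inv x \<otimes> y))"
      unfolding 2 3 .
  qed
  also have "\<dots> = complex_of_real (\<Delta> (inv x)) * cnj (coset_integral \<mu> (\<lambda>y. k (inv x \<otimes> y)))"
    by (simp add: coset_integral_eq)
  also have "\<dots> = star (\<psi> \<natural> \<phi>) x"
    unfolding k using x by (simp add: star_apply convolution_apply k_def)
  finally show "star (\<psi> \<natural> \<phi>) x = (star \<phi> \<natural> star \<psi>) x" by (rule sym)
qed

lemma convolution_add_left:
  assumes \<psi>: "\<psi> \<in> \<C>" and \<phi>: "\<phi> \<in> \<C>" and \<eta>: "\<eta> \<in> \<C>"
  shows "(\<lambda>x\<in>carrier G. \<psi> x + \<phi> x) \<natural> \<eta> = (\<lambda>x\<in>carrier G. (\<psi> \<natural> \<eta>) x + (\<phi> \<natural> \<eta>) x)"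
proof (rule \<C>_eqI)
  show "(\<lambda>x\<in>carrier G. \<psi> x + \<phi> x) \<natural> \<eta> \<in> \<C>"
    "(\<lambda>x\<in>carrier G. (\<psi> \<natural> \<eta>) x + (\<phi> \<natural> \<eta>) x) \<in> \<C>"
    using assms by (simp_all add: convolution_in_\<C> \<C>_add)
  fix x assume x: "x \<in> carrier G"
  have "((\<lambda>x\<in>carrier G. \<psi> x + \<phi> x) \<natural> \<eta>) x =
      coset_integral \<mu> (\<lambda>y. \<psi> y * \<eta> (inv y \<otimes> x) + \<phi> y * \<eta> (inv y \<otimes> x))"
    unfolding convolution_apply[OF x] by (rule coset_integral_cong) (simp add: distrib_right)
  then show "((\<lambda>x\<in>carrier G. \<psi> x + \<phi> x) \<natural> \<eta>) x = (\<lambda>x\<in>carrier G. (\<psi> \<natural> \<eta>) x + (\<phi> \<natural> \<eta>) x) x"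
    using x coset_integral_add[OF convolution_integrand_compact[OF \<psi> \<eta> x] convolution_integrand_compact[OF \<phi> \<eta> x]]
    by (simp add: convolution_apply)
qed

lemma convolution_add_right:
  assumes \<psi>: "\<psi> \<in> \<C>" and \<phi>: "\<phi> \<in> \<C>" and \<eta>: "\<eta> \<in> \<C>"
  shows "\<psi> \<natural> (\<lambda>x\<in>carrier G. \<phi> x + \<eta> x) = (\<lambda>x\<in>carrier G. (\<psi> \<natural> \<phi>) x + (\<psi> \<natural> \<eta>) x)"
proof (rule \<C>_eqI)
  show "\<psi> \<natural> (\<lambda>x\<in>carrier G. \<phi> x + \<eta> x) \<in> \<C>"
    "(\<lambda>x\<in>carrier G. (\<psi> \<natural> \<phi>) x + (\<psi> \<natural> \<eta>) x) \<in> \<C>"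
    using assms by (simp_all add: convolution_in_\<C> \<C>_add)
  fix x assume x: "x \<in> carrier G"
  have "(\<psi> \<natural> (\<lambda>x\<in>carrier G. \<phi> x + \<eta> x)) x =
      coset_integral \<mu> (\<lambda>y. \<psi> y * \<phi> (inv y \<otimes> x) + \<psi> y * \<eta> (inv y \<otimes> x))"
    unfolding convolution_apply[OF x] by (rule coset_integral_cong) (simp add: x distrib_left)
  then show "(\<psi> \<natural> (\<lambda>x\<in>carrier G. \<phi> x + \<eta> x)) x = (\<lambda>x\<in>carrier G. (\<psi> \<natural> \<phi>) x + (\<psi> \<natural> \<eta>) x) x"
    using x coset_integral_add[OF convolution_integrand_compact[OF \<psi> \<phi> x] convolution_integrand_compact[OF \<psi> \<eta> x]]
    by (simp add: convolution_apply)
qed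

lemma convolution_smult:
  "(\<lambda>x\<in>carrier G. c * \<psi> x) \<natural> \<phi> = (\<lambda>x\<in>carrier G. c * (\<psi> \<natural> \<phi>) x)"
  "\<psi> \<natural> (\<lambda>x\<in>carrier G. c * \<phi> x) = (\<lambda>x\<in>carrier G. c * (\<psi> \<natural> \<phi>) x)"
proof -
  have "coset_integral \<mu> (\<lambda>y. restrict (\<lambda>x. c * \<psi> x) (carrier G) y * \<phi> (inv y \<otimes> x)) =
      c * coset_integral \<mu> (\<lambda>y. \<psi> y * \<phi> (inv y \<otimes> x))" for x
  proof -
    have "coset_integral \<mu> (\<lambda>y. restrict (\<lambda>x. c * \<psi> x) (carrier G) y * \<phi> (inv y \<otimes> x)) =
        coset_integral \<mu> (\<lambda>y. c * (\<psi> y * \<phi> (inv y \<otimes> x)))"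
      by (rule coset_integral_cong) simp
    then show ?thesis by (simp add: coset_integral_eq)
  qed
  then show "(\<lambda>x\<in>carrier G. c * \<psi> x) \<natural> \<phi> = (\<lambda>x\<in>carrier G. c * (\<psi> \<natural> \<phi>) x)"
    unfolding covariant_convolution_def by (intro restrict_ext) simp
  have "coset_integral \<mu> (\<lambda>y. \<psi> y * restrict (\<lambda>x. c * \<phi> x) (carrier G) (inv y \<otimes> x)) =
      c * coset_integral \<mu> (\<lambda>y. \<psi> y * \<phi> (inv y \<otimes> x))" if "x \<in> carrier G" for x
  proof -
    have "coset_integral \<mu> (\<lambda>y. \<psi> y * restrict (\<lambda>x. c * \<phi> x) (carrier G) (inv y \<otimes> x)) =
        coset_integral \<mu> (\<lambda>y. c * (\<psi> y * \<phi> (inv y \<otimes> x)))"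
      using that by (intro coset_integral_cong) simp
    then show ?thesis by (simp add: coset_integral_eq)
  qed
  then show "\<psi> \<natural> (\<lambda>x\<in>carrier G. c * \<phi> x) = (\<lambda>x\<in>carrier G. c * (\<psi> \<natural> \<phi>) x)"
    unfolding covariant_convolution_def by (intro restrict_ext) simp
qed

lemma covariant_alg_simps:
  "carrier (covariant_alg G N T \<mu> \<xi>) = \<C>"
  "\<psi> \<otimes>\<^bsub>covariant_alg G N T \<mu> \<xi>\<^esub> \<phi> = \<psi> \<natural> \<phi>"
  "\<zero>\<^bsub>covariant_alg G N T \<mu> \<xi>\<^esub> = (\<lambda>x\<in>carrier G. 0)"
  "\<psi> \<oplus>\<^bsub>covariant_alg G N T \<mu> \<xi>\<^esub> \<phi> = (\<lambda>x\<in>carrier G. \<psi> x + \<phi> x)"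
  "c \<odot>\<^bsub>covariant_alg G N T \<mu> \<xi>\<^esub> \<psi> = (\<lambda>x\<in>carrier G. c * \<psi> x)"
  "nrm (covariant_alg G N T \<mu> \<xi>) \<psi> = coset_integral \<mu> (\<lambda>x. cmod (\<psi> x))"
  by (simp_all add: covariant_alg_def)

lemma seminormed_space_covariant_alg: "seminormed_space (covariant_alg G N T \<mu> \<xi>)"
proof (intro seminormed_space.intro seminormed_space_axioms.intro)
  let ?A = "covariant_alg G N T \<mu> \<xi>"
  have ab: "abelian_group ?A"
  proof (rule abelian_groupI; unfold covariant_alg_simps)
    fix \<psi> assume \<psi>: "\<psi> \<in> \<C>"
    have "(\<lambda>x\<in>carrier G. (\<lambda>x\<in>carrier G. (-1) * \<psi> x) x + \<psi> x) = (\<lambda>x\<in>carrier G. 0)"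
      by (intro restrict_ext) simp
    then show "\<exists>\<phi>\<in>\<C>. (\<lambda>x\<in>carrier G. \<phi> x + \<psi> x) = (\<lambda>x\<in>carrier G. 0)"
      using \<C>_smult[OF \<psi>] by blast
    show "(\<lambda>x\<in>carrier G. (\<lambda>x\<in>carrier G. 0) x + \<psi> x) = \<psi>"
      by (rule \<C>_eqI[OF \<C>_add[OF \<C>_zero \<psi>] \<psi>]) simp
  qed (simp_all add: \<C>_add \<C>_zero add_ac cong: restrict_cong)
  show "Module.module (ring_of_type_algebra :: complex ring) ?A"
  proof (rule moduleI[OF cring_from_type_algebra ab]; unfold covariant_alg_simps)
    fix \<psi> assume \<psi>: "\<psi> \<in> \<C>"
    have "(\<lambda>x\<in>carrier G. 1 * \<psi> x) = \<psi>"
      by (rule \<C>_eqI[OF \<C>_smult[OF \<psi>] \<psi>]) simp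
    then show "(\<lambda>x\<in>carrier G. \<one>\<^bsub>ring_of_type_algebra\<^esub> * \<psi> x) = \<psi>" by simp
  qed (simp_all add: \<C>_smult distrib_left distrib_right mult.assoc cong: restrict_cong)
  fix \<psi> \<phi> assume "\<psi> \<in> carrier ?A" "\<phi> \<in> carrier ?A"
  then have \<psi>: "\<psi> \<in> \<C>" and \<phi>: "\<phi> \<in> \<C>" by (simp_all add: covariant_alg_simps)
  note n = \<C>_norm_compact[OF \<psi>] \<C>_norm_compact[OF \<phi>]
  have "coset_integral \<mu> (\<lambda>x. cmod ((\<lambda>x\<in>carrier G. \<psi> x + \<phi> x) x)) \<le>
      coset_integral \<mu> (\<lambda>x. cmod (\<psi> x) + cmod (\<phi> x))"
    using coset_compact_integrable[OF n(1)] coset_compact_integrable[OF n(2)]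
    by (intro coset_integral_mono coset_compact_integrable[OF \<C>_norm_compact[OF \<C>_add[OF \<psi> \<phi>]]])
      (simp_all add: norm_triangle_ineq)
  then show "nrm ?A (\<psi> \<oplus>\<^bsub>?A\<^esub> \<phi>) \<le> nrm ?A \<psi> + nrm ?A \<phi>"
    using coset_integral_add[OF n] by (simp add: covariant_alg_simps)
next
  fix c \<psi>
  have "coset_integral \<mu> (\<lambda>x. cmod ((\<lambda>x\<in>carrier G. c * \<psi> x) x)) =
      coset_integral \<mu> (\<lambda>x. cmod c * cmod (\<psi> x))"
    by (rule coset_integral_cong) (simp add: norm_mult)
  then show "nrm (covariant_alg G N T \<mu> \<xi>) (c \<odot>\<^bsub>covariant_alg G N T \<mu> \<xi>\<^esub> \<psi>) =
      cmod c * nrm (covariant_alg G N T \<mu> \<xi>) \<psi>"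
    by (simp add: covariant_alg_simps coset_integral_eq)
qed

lemma seminormed_star_algebra_covariant_alg:
  "seminormed_star_algebra (covariant_alg G N T \<mu> \<xi>) star"
proof (rule seminormed_star_algebra.intro[OF seminormed_space_covariant_alg
      seminormed_star_algebra_axioms.intro]; unfold covariant_alg_simps)
  fix \<psi> \<phi> assume "\<psi> \<in> \<C>" "\<phi> \<in> \<C>"
  then show "star (\<lambda>x\<in>carrier G. \<psi> x + \<phi> x) = (\<lambda>x\<in>carrier G. star \<psi> x + star \<phi> x)"
    by (intro \<C>_eqI) (simp_all add: \<C>_add star_in_\<C> star_apply distrib_left)
next
  fix c \<psi> assume "\<psi> \<in> \<C>"
  then show "star (\<lambda>x\<in>carrier G. c * \<psi> x) = (\<lambda>x\<in>carrier G. cnj c * star \<psi> x)"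
    by (intro \<C>_eqI) (simp_all add: \<C>_smult star_in_\<C> star_apply)
qed (simp_all add: convolution_in_\<C> convolution_assoc convolution_add_left convolution_add_right
    convolution_smult norm_convolution_le star_in_\<C> star_star star_convolution norm_star)

end

section \<open>The extended involution\<close>

theorem theorem3p26:
  fixes G :: "('a, 'm) monoid_scheme" and T :: "'a topology" and N :: "'a set"
    and \<mu>G \<mu>N :: "'a measure" and \<mu>Q :: "'a set measure" and \<xi> :: "'a \<Rightarrow> complex"
  assumes "locally_compact_group G T"
    and "N \<lhd> G" and "closedin T N"
    and "left_haar_measure G T \<mu>G"
    and "left_haar_measure (G\<lparr>carrier := N\<rparr>) (subtopology T N) \<mu>N"
    and "left_haar_measure (G Mod N) (coset_topology G N T) \<mu>Q"
    and "weil_formula G \<mu>G \<mu>N \<mu>Q"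
    and "\<xi> \<in> invariant_characters G N T"
  shows "(\<forall>\<psi>\<in>covariant_functions G N T \<xi>.
            covariant_involution G N \<mu>Q \<psi> \<in> covariant_functions G N T \<xi>) \<and>
         (\<exists>J. isometric_involution (covariant_L1 G N T \<mu>Q \<xi>) J \<and>
              extends_covariant_involution G N T \<mu>Q \<xi> J \<and>
              banach_star_algebra (covariant_L1 G N T \<mu>Q \<xi>) J \<and>
              (\<forall>J'. isometric_involution (covariant_L1 G N T \<mu>Q \<xi>) J' \<and>
                    extends_covariant_involution G N T \<mu>Q \<xi> J' \<longrightarrow>
                    (\<forall>a\<in>carrier (covariant_L1 G N T \<mu>Q \<xi>). J' a = J a)))"
proof -
  interpret covariant G T N \<mu>Q \<xi>
    using assms(1,2,3,6,8)
    by (simp add: covariant_def covariant_axioms_def quotient_haar_def quotient_haar_axioms_def)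
  interpret A: seminormed_star_algebra "covariant_alg G N T \<mu>Q \<xi>" "covariant_involution G N \<mu>Q"
    by (rule seminormed_star_algebra_covariant_alg)
  show ?thesis
    unfolding covariant_L1_def extends_covariant_involution_def
  proof (intro conjI exI[of _ A.completion_star] ballI allI impI)
    show "covariant_involution G N \<mu>Q \<psi> \<in> covariant_functions G N T \<xi>"
      if "\<psi> \<in> covariant_functions G N T \<xi>" for \<psi>
      using that by (rule star_in_\<C>)
    show "isometric_involution (banach_completion (covariant_alg G N T \<mu>Q \<xi>)) A.completion_star"
      by (rule A.isometric_involution_completion_star)
    show "A.completion_star (to_completion (covariant_alg G N T \<mu>Q \<xi>) \<psi>) =
        to_completion (covariant_alg G N T \<mu>Q \<xi>) (covariant_involution G N \<mu>Q \<psi>)"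
      if "\<psi> \<in> covariant_functions G N T \<xi>" for \<psi>
      using that by (intro A.completion_star_to_completion) (simp add: covariant_alg_simps)
    show "banach_star_algebra (banach_completion (covariant_alg G N T \<mu>Q \<xi>)) A.completion_star"
      by (rule A.banach_star_algebra_completion)
    show "J' a = A.completion_star a"
      if "isometric_involution (banach_completion (covariant_alg G N T \<mu>Q \<xi>)) J' \<and>
          (\<forall>\<psi>\<in>covariant_functions G N T \<xi>. J' (to_completion (covariant_alg G N T \<mu>Q \<xi>) \<psi>) =
            to_completion (covariant_alg G N T \<mu>Q \<xi>) (covariant_involution G N \<mu>Q \<psi>))"
        and "a \<in> carrier (banach_completion (covariant_alg G N T \<mu>Q \<xi>))" for J' a
      using that by (intro A.isometric_involution_completion_unique) (simp_all add: covariant_alg_simps)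
  qed
qed

end
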